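(* Let $(k_N)_{N\in\mathbb N}$ be a sequence of positive integers and $(G_N)_{N\in\mathbb N}$ a sequence of finite Abelian groups with $|G_N|\to\infty$ and $\log k_N/\log|G_N|\to0$. Suppose there exists a constant $c>0$ such that for all $N$ $$k_N\ge c\log|G_N|,\qquad m_*(G_N)\ge\frac{\log k_N}{\log\log k_N},\qquad d(G_N)\le\tfrac15\,\frac{\log|G_N|}{\log\log k_N}.$$ For each $N$ let $Z_{(N)}=[Z_1,\dots,Z_{k_N}]$ with $Z_1,\dots,Z_{k_N}$ i.i.d. uniform on $G_N$, and let $d^{\pm}_{G_k,N}(t)$ be the total variation distance to uniform at time $t$ of the random walk on the directed ($+$), respectively undirected ($-$), Cayley graph of $G_N$ generated by $Z_{(N)}$. Write $t_{\alpha,N}:=t_\alpha(k_N,|G_N|)$ (defined using the directed, respectively undirected, auxiliary walk). Then for every $\alpha\in\mathbb R$, as $N\to\infty$, $$t_{\alpha,N}/t_{0,N}\to1\qquad\text{and}\qquad d^\pm_{G_k,N}(t_{\alpha,N})\to\Psi(\alpha)\ \text{ in probability.}$$ That is, with high probability there is cutoff at time $t_0$ with profile given by $\{t_\alpha\}_{\alpha\in\mathbb R}$: for all $\varepsilon\in(0,1)$ the difference of mixing times $t_{\mathrm{mix}}(\varepsilon)-t_{\mathrm{mix}}(\frac12)$ is given, up to subleading order terms, by $t_{\Psi^{-1}(\varepsilon)}-t_0$. Moreover, the implicit lower bound on the total variation distance holds deterministically: for every $\alpha\in\mathbb R$, the infimum over all choices of generating multisets of size $k_N$ in $G_N$ of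 the total variation distance at time $t_{\alpha,N}$ is at least $\Psi(\alpha)-o(1)$.
   Context: Random walk on a Cayley graph: let $Z=[Z_1,\dots,Z_k]$ be a multiset of elements of a finite group $G$ (not required to generate $G$). The continuous-time, rate-1 random walk $S=(S(t))_{t\ge0}$ on the directed Cayley graph $G^+(Z)$, started from the identity, jumps at rate 1; at each jump $i\in\{1,\dots,k\}$ is chosen uniformly and the current position $g$ is replaced by $gZ_i$. On the undirected Cayley graph $G^-(Z)$, $g$ is replaced by $gZ_i$ or $gZ_i^{-1}$ with probability $\frac12$ each. The total variation distance is between the law of $S(t)$ conditional on $Z$ and the uniform distribution on $G$; it is a function of $Z$. $t_{\mathrm{mix}}(\varepsilon)$ is the first time at which this distance is at most $\varepsilon$. $d(G)$ is the minimal size of a generating set of $G$, and $m_*(G):=\max\{\min_{j}m_j : \oplus_{j=1}^{r}\mathbb Z_{m_j}\text{ is a decomposition of }G\}$. $\Psi(\alpha):=(2\pi)^{-1/2}\int_\alpha^\infty e^{-x^2/2}\,dx$. Entropic times: let $W=(W(t))_{t\ge0}$ be the rate-1 walk on $\mathbb Z^k$ started from $0$: at rate 1 a uniformly chosen coordinate is changed, by $+1$ in the directed case, and by $\pm1$ with probability $\frac12$ each in the undirected case. The coordinates $W_1(t),\dots,W_k(t)$ are i.i.d.; let $\nu_{t/k}$ be the law of $W_1(t)$ and $Q_1(t):=-\log\nu_{t/k}(W_1(t))$. For $n\in\mathbb N$, $\alpha\in\mathbb R$, $t_\alpha=t_\alpha(k,n)$ is defined by $\mathbb E[Q_1(t_\alpha)]=(\log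 n+\alpha\sqrt{vk})/k$, where $v:=\mathrm{Var}(Q_1(t_0))$ and $t_0$ is defined by $\mathbb E[Q_1(t_0)]=(\log n)/k$; it is defined whenever $\log n+\alpha\sqrt{vk}\ge0$ ($t\mapsto\mathbb E[Q_1(t)]$ is an increasing bijection of $[0,\infty)$). *)

theory Defs
  imports "HOL-Probability.Probability" "HOL-Algebra.Product_Groups"
begin

section \<open>Rate-1 continuous-time random walks\<close>

text \<open>Number of jumps made by time \<open>t\<close>. The case distinction is needed because
  \<^const>\<open>poisson_pmf\<close> is specified for positive rates only.\<close>

definition jump_count :: "real \<Rightarrow> nat pmf" where
  "jump_count t = (if t > 0 then poisson_pmf t else return_pmf 0)"

text \<open>Law at time \<open>t\<close> of the chain started at \<open>x\<close> which, at the points of a rate-1 Poisson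
  process, moves according to the transition kernel \<open>K\<close>.\<close>

definition ct_walk :: "('s \<Rightarrow> 's pmf) \<Rightarrow> 's \<Rightarrow> real \<Rightarrow> 's pmf" where
  "ct_walk K x t =
     bind_pmf (jump_count t) (\<lambda>n. ((\<lambda>p. bind_pmf p K) ^^ n) (return_pmf x))"

datatype orientation = Directed | Undirected

definition jump_sign :: "orientation \<Rightarrow> int pmf" where
  "jump_sign ori = (case ori of Directed \<Rightarrow> return_pmf 1 | Undirected \<Rightarrow> pmf_of_set {1, -1})"


section \<open>The walk on the Cayley graph\<close>

text \<open>The multiset of generators is given by an enumeration \<open>Z 0, \<dots>, Z (k - 1)\<close>.\<close>

definition cayley_step ::
    "orientation \<Rightarrow> 'a monoid \<Rightarrow> nat \<Rightarrow> (nat \<Rightarrow> 'a) \<Rightarrow> 'a \<Rightarrow> 'a pmf" where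
  "cayley_step ori G k Z g =
     bind_pmf (pmf_of_set {..<k}) (\<lambda>i.
       map_pmf (\<lambda>s. g \<otimes>\<^bsub>G\<^esub> (Z i [^]\<^bsub>G\<^esub> s)) (jump_sign ori))"

definition cayley_law ::
    "orientation \<Rightarrow> 'a monoid \<Rightarrow> nat \<Rightarrow> (nat \<Rightarrow> 'a) \<Rightarrow> real \<Rightarrow> 'a pmf" where
  "cayley_law ori G k Z t = ct_walk (cayley_step ori G k Z) \<one>\<^bsub>G\<^esub> t"

definition tv_dist :: "'a pmf \<Rightarrow> 'a pmf \<Rightarrow> real" where
  "tv_dist p q = (SUP A. \<bar>measure_pmf.prob p A - measure_pmf.prob q A\<bar>)"

definition cayley_dist ::
    "orientation \<Rightarrow> 'a monoid \<Rightarrow> nat \<Rightarrow> (nat \<Rightarrow> 'a) \<Rightarrow> real \<Rightarrow> real" where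
  "cayley_dist ori G k Z t = tv_dist (cayley_law ori G k Z t) (pmf_of_set (carrier G))"

text \<open>The value is \<open>\<infinity>\<close> if the distance never drops to \<open>\<epsilon>\<close>, which may happen when \<open>Z\<close> does
  not generate \<open>G\<close>.\<close>

definition t_mix ::
    "orientation \<Rightarrow> 'a monoid \<Rightarrow> nat \<Rightarrow> (nat \<Rightarrow> 'a) \<Rightarrow> real \<Rightarrow> ereal" where
  "t_mix ori G k Z \<epsilon> = Inf (ereal ` {t. 0 \<le> t \<and> cayley_dist ori G k Z t \<le> \<epsilon>})"

definition iid_generators :: "'a monoid \<Rightarrow> nat \<Rightarrow> (nat \<Rightarrow> 'a) pmf" where
  "iid_generators G k = Pi_pmf {..<k} undefined (\<lambda>_. pmf_of_set (carrier G))"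

definition tendsto_in_prob :: "(nat \<Rightarrow> 'z pmf) \<Rightarrow> (nat \<Rightarrow> 'z \<Rightarrow> real) \<Rightarrow> real \<Rightarrow> bool" where
  "tendsto_in_prob P X L \<longleftrightarrow>
     (\<forall>\<delta>>0. (\<lambda>N. measure_pmf.prob (P N) {z. \<bar>X N z - L\<bar> > \<delta>}) \<longlonglongrightarrow> 0)"

definition whp :: "(nat \<Rightarrow> 'z pmf) \<Rightarrow> (nat \<Rightarrow> 'z \<Rightarrow> bool) \<Rightarrow> bool" where
  "whp P E \<longleftrightarrow> (\<lambda>N. measure_pmf.prob (P N) {z. E N z}) \<longlonglongrightarrow> 1"


section \<open>Group invariants\<close>

definition min_gen_size :: "'a monoid \<Rightarrow> nat" where
  "min_gen_size G =
     (LEAST r. \<exists>A. A \<subseteq> carrier G \<and> finite A \<and> card A = r \<and> generate G A = carrier G)"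

text \<open>\<open>integer_mod_group 0\<close> is the infinite cyclic group, hence the positivity of the \<open>m j\<close>.
  Factors of order 1 are allowed; they only matter for the trivial group, which gets the
  value 1.\<close>

definition m_star :: "'a monoid \<Rightarrow> nat" where
  "m_star G =
     Max {Min (m ` {..<r}) | (m :: nat \<Rightarrow> nat) (r :: nat). r > 0 \<and> (\<forall>j<r. m j > 0) \<and>
            G \<cong> product_group {..<r} (\<lambda>j. integer_mod_group (m j))}"


section \<open>Entropic times\<close>

definition lattice_step :: "orientation \<Rightarrow> nat \<Rightarrow> (nat \<Rightarrow> int) \<Rightarrow> (nat \<Rightarrow> int) pmf" where
  "lattice_step ori k w =
     bind_pmf (pmf_of_set {..<k}) (\<lambda>i. map_pmf (\<lambda>s. w(i := w i + s)) (jump_sign ori))"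

definition lattice_law :: "orientation \<Rightarrow> nat \<Rightarrow> real \<Rightarrow> (nat \<Rightarrow> int) pmf" where
  "lattice_law ori k t = ct_walk (lattice_step ori k) (\<lambda>_. 0) t"

text \<open>Coordinates are numbered from 0, so this is the law of the first coordinate.\<close>

definition coord_law :: "orientation \<Rightarrow> nat \<Rightarrow> real \<Rightarrow> int pmf" where
  "coord_law ori k t = map_pmf (\<lambda>w. w 0) (lattice_law ori k t)"

definition Q_mean :: "orientation \<Rightarrow> nat \<Rightarrow> real \<Rightarrow> real" where
  "Q_mean ori k t =
     measure_pmf.expectation (coord_law ori k t) (\<lambda>x. - ln (pmf (coord_law ori k t) x))"

definition Q_var :: "orientation \<Rightarrow> nat \<Rightarrow> real \<Rightarrow> real" where
  "Q_var ori k t =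
     measure_pmf.variance (coord_law ori k t) (\<lambda>x. - ln (pmf (coord_law ori k t) x))"

definition entropic_time_0 :: "orientation \<Rightarrow> nat \<Rightarrow> nat \<Rightarrow> real" where
  "entropic_time_0 ori k n = (THE t. 0 \<le> t \<and> Q_mean ori k t = ln (real n) / real k)"

text \<open>Meaningful only if \<open>ln n + \<alpha> * sqrt (v * k) \<ge> 0\<close>; otherwise the value is unspecified.\<close>

definition entropic_time :: "orientation \<Rightarrow> nat \<Rightarrow> nat \<Rightarrow> real \<Rightarrow> real" where
  "entropic_time ori k n \<alpha> =
     (let v = Q_var ori k (entropic_time_0 ori k n)
      in THE t. 0 \<le> t \<and> Q_mean ori k t = (ln (real n) + \<alpha> * sqrt (v * real k)) / real k)"

definition Psi :: "real \<Rightarrow> real" where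
  "Psi \<alpha> = 1 / sqrt (2 * pi) * (LBINT x:{\<alpha>..}. exp (- x\<^sup>2 / 2))"

end

theory Submission
  imports Defs "HOL-Real_Asymp.Real_Asymp" "HOL-Algebra.FiniteProduct"
begin

text \<open>
  The position of the walk is the image of the lattice walk \<open>W(t)\<close>, whose coordinates are
  independent, under \<open>w \<mapsto> \<Prod>i. Z i ^ w i\<close>. Its surprisal \<open>- ln \<mu>(W(t))\<close> is a sum of \<open>k\<close> i.i.d. terms
  and satisfies a central limit theorem, so that at time \<open>t\<^sub>\<alpha>\<close> the event that \<open>\<mu>(W(t))\<close> is much larger
  than \<open>1 / |G|\<close> has probability close to \<open>Psi \<alpha>\<close>. Few points carry that much mass each, whence the
  lower bound for every choice of generators.

  For the upper bound, restrict to the typical points, where \<open>\<mu>\<close> is much smaller than \<open>1 / |G|\<close> and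
  all coordinates are at most of order \<open>ln k\<close>. By Cauchy-Schwarz it suffices to show that the expected
  number of collisions of two independent typical points \<open>w\<close>, \<open>w'\<close> exceeds that of the uniform law
  only slightly. If \<open>\<gamma>\<close> is the gcd of \<open>w - w'\<close>, then by Bezout the random word of \<open>w - w'\<close> is
  trivial with probability at most \<open>\<gamma> ^ d(G) / |G|\<close>, and \<open>w\<close>, \<open>w'\<close> are congruent modulo \<open>\<gamma>\<close>. The
  mass of congruent pairs is estimated coordinatewise: for bounded \<open>\<gamma>\<close> and \<open>t / k\<close> bounded below it
  is exponentially small in \<open>k\<close>, and otherwise replacing a factor \<open>\<mu> powr (1/4)\<close> by its bound
  \<open>|G| powr (-1/4)\<close> leaves a sum that is at most 1 per coordinate. The exponent \<open>1/4\<close> beats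
  \<open>(2 ln k) ^ d(G)\<close>, as \<open>d(G)\<close> is at most \<open>ln |G| / (5 ln (ln k))\<close>.

  The times \<open>t\<^sub>\<alpha>\<close> are controlled through the entropy of one coordinate as a function of
  \<open>s = t / k\<close>, which stays in a bounded interval but may tend to 0: the entropy, its derivative and the
  variance of the surprisal are compared with \<open>s * ell s\<close>, \<open>ell s\<close> and \<open>s * (ell s)\<^sup>2\<close>.
\<close>

section \<open>Continuous-time walks on the integer lattice\<close>

text \<open>The main obstacle is uniformity in \<open>s = t / k\<close>. If \<open>k\<close> is of
  larger order than \<open>ln |G|\<close>, then \<open>s\<close> tends to 0 and the law of a
  coordinate degenerates. That \<open>ln k\<close> is of smaller order than \<open>ln |G|\<close>
  still forces \<open>t\<close> to infinity, and both the relative size of the window and the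
  Lyapunov ratio are of order at most \<open>1 / sqrt t\<close>. Hence all moments are divided by
  powers of \<open>s\<close> and \<open>ell s\<close> and controlled by dominated convergence down
  to \<open>s = 0\<close>.

  The threshold for typical points is \<open>exp (- gap) / |G|\<close>. Here \<open>gap\<close>
  tends to infinity, so that the pairs \<open>w = w'\<close> contribute nothing in the limit, but
  more slowly than the standard deviation of the surprisal, so that the central limit theorem does
  not see it.

  The tilt \<open>1/4\<close> has to lie between two bounds. It must exceed the \<open>1/5\<close>
  in the hypothesis on \<open>d(G)\<close>. It must also be below \<open>1/2\<close>: for modulus 2
  the points of absolute value 2 lie in a residue class of mass close to 1 when \<open>s\<close> is
  small, and with tilt \<open>a\<close> they contribute about \<open>s powr (2 * (1 - a))\<close>,
  which has to be of smaller order than the loss of order \<open>s\<close> at the origin.\<close>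

lemma expectation_nat_pmf_sums:
  fixes p :: "nat pmf" and f :: "nat \<Rightarrow> real"
  assumes "integrable (measure_pmf p) f"
  shows "(\<lambda>n. pmf p n * f n) sums measure_pmf.expectation p f"
proof -
  have eq: "measure_pmf p = density (count_space UNIV) (\<lambda>x. ennreal (pmf p x))"
    by (rule measure_pmf_eq_density)
  have "integrable (count_space UNIV) (\<lambda>n. pmf p n * f n)"
    using assms by (subst (asm) eq) (simp add: integrable_density)
  from sums_integral_count_space_nat[OF this] show ?thesis
    by (subst eq) (simp add: integral_density)
qed

lemma prob_bind_pmf:
  "measure_pmf.prob (bind_pmf p f) A = measure_pmf.expectation p (\<lambda>x. measure_pmf.prob (f x) A)"
  unfolding measure_pmf_bind
  by (subst measure_pmf.measure_bind[where N="count_space UNIV"]) (auto simp: measure_pmf_in_subprob_algebra)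

lemma pmf_eq_prob: "pmf p x = measure_pmf.prob p {x}"
  by (simp add: measure_pmf_single)

definition chain_law :: "('s \<Rightarrow> 's pmf) \<Rightarrow> nat \<Rightarrow> 's pmf \<Rightarrow> 's pmf" where
  "chain_law K n p = ((\<lambda>p. bind_pmf p K) ^^ n) p"

lemma chain_law_0 [simp]: "chain_law K 0 p = p"
  and chain_law_Suc: "chain_law K (Suc n) p = bind_pmf (chain_law K n p) K"
  by (simp_all add: chain_law_def)

lemma ct_walk_chain_law: "ct_walk K x t = bind_pmf (jump_count t) (\<lambda>n. chain_law K n (return_pmf x))"
  by (simp add: ct_walk_def chain_law_def)

lemma chain_law_bind: "chain_law K n (bind_pmf p f) = bind_pmf p (\<lambda>y. chain_law K n (f y))"
  by (induction n) (simp_all add: chain_law_Suc bind_assoc_pmf)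

lemma chain_law_add: "chain_law K (m + n) p = chain_law K m (chain_law K n p)"
  by (simp add: chain_law_def funpow_add)

text \<open>Includes \<open>t = 0\<close>, where \<open>0 ^ 0 = 1\<close> turns the Poisson formula
  into the point mass at 0.\<close>

lemma pmf_jump_count: "t \<ge> 0 \<Longrightarrow> pmf (jump_count t) n = t ^ n / fact n * exp (- t)"
  by (cases "t = 0") (auto simp: jump_count_def power_0_left)

text \<open>Multiplication by \<open>exp t\<close> removes the Poisson normalisation and leaves a
  power series in \<open>t\<close> whose coefficients come from the jump chain; such series can be
  differentiated and compared.\<close>

lemma ct_walk_sums:
  assumes "t \<ge> 0"
  shows "(\<lambda>n. t ^ n / fact n * measure_pmf.prob (chain_law K n (return_pmf x)) A)
           sums (exp t * measure_pmf.prob (ct_walk K x t) A)"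
proof -
  have "(\<lambda>n. pmf (jump_count t) n * measure_pmf.prob (chain_law K n (return_pmf x)) A)
          sums measure_pmf.prob (ct_walk K x t) A"
    unfolding ct_walk_chain_law prob_bind_pmf
    by (rule expectation_nat_pmf_sums, rule measure_pmf.integrable_const_bound[where B=1]) auto
  from sums_mult[OF this, of "exp t"] show ?thesis
    using assms by (simp add: pmf_jump_count exp_minus field_simps)
qed

text \<open>Poisson variables add up by the binomial theorem.\<close>

lemma jump_count_add:
  assumes "t \<ge> 0" "u \<ge> 0"
  shows "jump_count (t + u) = bind_pmf (jump_count t) (\<lambda>n. map_pmf (\<lambda>m. m + n) (jump_count u))"
proof (rule pmf_eqI)
  fix i
  have eq: "pmf (map_pmf (\<lambda>m. m + n) (jump_count u)) i = (if n \<le> i then pmf (jump_count u) (i - n) else 0)" for n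
  proof (cases "n \<le> i")
    case True
    then have "pmf (map_pmf (\<lambda>m. m + n) (jump_count u)) ((i - n) + n) = pmf (jump_count u) (i - n)"
      by (intro pmf_map_inj') (auto simp: inj_def)
    then show ?thesis using True by simp
  next
    case False
    then show ?thesis by (auto simp: pmf_eq_0_set_pmf)
  qed
  have "(\<lambda>n. pmf (jump_count t) n * pmf (map_pmf (\<lambda>m. m + n) (jump_count u)) i)
          sums pmf (bind_pmf (jump_count t) (\<lambda>n. map_pmf (\<lambda>m. m + n) (jump_count u))) i"
    unfolding pmf_bind
    by (rule expectation_nat_pmf_sums, rule measure_pmf.integrable_const_bound[where B=1]) (auto simp: pmf_le_1)
  moreover have "(\<lambda>n. pmf (jump_count t) n * pmf (map_pmf (\<lambda>m. m + n) (jump_count u)) i)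
          sums (\<Sum>n\<le>i. pmf (jump_count t) n * pmf (map_pmf (\<lambda>m. m + n) (jump_count u)) i)"
    by (rule sums_finite) (auto simp: eq)
  ultimately have "pmf (bind_pmf (jump_count t) (\<lambda>n. map_pmf (\<lambda>m. m + n) (jump_count u))) i
     = (\<Sum>n\<le>i. pmf (jump_count t) n * pmf (map_pmf (\<lambda>m. m + n) (jump_count u)) i)"
    by (rule sums_unique2)
  also have "\<dots> = (\<Sum>n\<le>i. of_nat (i choose n) * t ^ n * u ^ (i - n) * (exp (- (t + u)) / fact i))"
  proof (rule sum.cong[OF refl])
    fix n assume "n \<in> {..i}"
    then have n: "n \<le> i" by simp
    have e: "exp (- (t + u)) = exp (- t) * exp (- u)"
      by (simp add: exp_add[symmetric])
    have "real (i choose n) / fact i = 1 / (fact n * fact (i - n))"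
      using n by (simp add: binomial_fact)
    then have "t ^ n * u ^ (i - n) * exp (- (t + u)) * (real (i choose n) / fact i)
        = t ^ n * u ^ (i - n) * exp (- (t + u)) * (1 / (fact n * fact (i - n)))" by (rule arg_cong)
    then have "real (i choose n) * t ^ n * u ^ (i - n) * (exp (- (t + u)) / fact i)
        = t ^ n * u ^ (i - n) * exp (- (t + u)) * (1 / (fact n * fact (i - n)))"
      by (simp only: times_divide_eq_right times_divide_eq_left mult_ac)
    then show "pmf (jump_count t) n * pmf (map_pmf (\<lambda>m. m + n) (jump_count u)) i
      = real (i choose n) * t ^ n * u ^ (i - n) * (exp (- (t + u)) / fact i)"
      unfolding eq e using n assms by (simp add: pmf_jump_count)
  qed
  also have "\<dots> = (t + u) ^ i * (exp (- (t + u)) / fact i)"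
    by (simp only: binomial_ring sum_distrib_right)
  also have "\<dots> = pmf (jump_count (t + u)) i"
    using assms by (simp add: pmf_jump_count)
  finally show "pmf (jump_count (t + u)) i
    = pmf (bind_pmf (jump_count t) (\<lambda>n. map_pmf (\<lambda>m. m + n) (jump_count u))) i" by simp
qed

text \<open>The semigroup property. It serves the monotonicity of the distance in time, without
  which bounds at single times would say nothing about the infimum in \<open>t_mix\<close>.\<close>

lemma ct_walk_add:
  assumes "t \<ge> 0" "u \<ge> 0"
  shows "ct_walk K x (t + u) = bind_pmf (ct_walk K x t) (\<lambda>y. ct_walk K y u)"
proof -
  have 1: "chain_law K (m + n) (return_pmf x)
     = bind_pmf (chain_law K n (return_pmf x)) (\<lambda>y. chain_law K m (return_pmf y))" for m n
    by (subst chain_law_bind[symmetric]) (simp add: chain_law_add bind_return_pmf')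
  have "ct_walk K x (t + u) = bind_pmf (jump_count t) (\<lambda>n. bind_pmf (jump_count u)
     (\<lambda>m. bind_pmf (chain_law K n (return_pmf x)) (\<lambda>y. chain_law K m (return_pmf y))))"
    unfolding ct_walk_chain_law jump_count_add[OF assms]
    by (simp add: bind_assoc_pmf bind_map_pmf 1)
  also have "\<dots> = bind_pmf (ct_walk K x t) (\<lambda>y. ct_walk K y u)"
    unfolding ct_walk_chain_law bind_assoc_pmf
    by (subst bind_commute_pmf) simp
  finally show ?thesis .
qed

section \<open>The walk of a single coordinate on the integers\<close>

definition one_step :: "orientation \<Rightarrow> int \<Rightarrow> int pmf" where
  "one_step ori x = map_pmf (\<lambda>\<sigma>. x + \<sigma>) (jump_sign ori)"

definition one_law :: "orientation \<Rightarrow> real \<Rightarrow> int pmf" where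
  "one_law ori s = ct_walk (one_step ori) 0 s"

definition srw :: "orientation \<Rightarrow> nat \<Rightarrow> int pmf" where
  "srw ori n = chain_law (one_step ori) n (return_pmf 0)"

lemma set_jump_sign: "set_pmf (jump_sign ori) = (case ori of Directed \<Rightarrow> {1} | Undirected \<Rightarrow> {1,-1})"
  by (cases ori) (auto simp: jump_sign_def)

lemma set_jump_sign_subset: "set_pmf (jump_sign ori) \<subseteq> {1, -1}"
  by (cases ori) (auto simp: set_jump_sign)

definition jp :: "orientation \<Rightarrow> int \<Rightarrow> real" where "jp ori = pmf (jump_sign ori)"

lemma jp_simps: "jp Directed 1 = 1" "jp Directed (-1) = 0" "jp Undirected 1 = 1/2" "jp Undirected (-1) = 1/2"
  by (auto simp: jp_def jump_sign_def pmf_return)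

lemma jp_nonneg [simp]: "jp ori \<sigma> \<ge> 0"
  by (simp add: jp_def)

lemma jp_1_ge: "jp ori 1 \<ge> 1/2" and jp_sum: "jp ori 1 + jp ori (-1) = 1"
  by (cases ori; simp add: jp_simps)+

lemma expectation_jump_sign:
  "measure_pmf.expectation (jump_sign ori) f = jp ori 1 * f 1 + jp ori (-1) * (f (-1) :: real)"
proof -
  have "measure_pmf.expectation (jump_sign ori) f = (\<Sum>a\<in>{1,-1}. f a * pmf (jump_sign ori) a)"
    using set_jump_sign_subset[of ori] by (intro integral_measure_pmf_real) auto
  then show ?thesis by (simp add: jp_def)
qed

lemma pmf_bind_one_step:
  "pmf (bind_pmf p (one_step ori)) x = jp ori 1 * pmf p (x - 1) + jp ori (-1) * pmf p (x + 1)"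
proof -
  have "bind_pmf p (one_step ori) = bind_pmf (jump_sign ori) (\<lambda>\<sigma>. map_pmf (\<lambda>y. y + \<sigma>) p)"
    unfolding one_step_def map_pmf_def by (subst bind_commute_pmf) simp
  moreover have "pmf (map_pmf (\<lambda>y. y + \<sigma>) p) ((x - \<sigma>) + \<sigma>) = pmf p (x - \<sigma>)" for \<sigma>
    by (rule pmf_map_inj') (auto simp: inj_def)
  ultimately show ?thesis
    by (simp add: pmf_bind expectation_jump_sign)
qed

lemma pmf_srw_Suc:
  "pmf (srw ori (Suc n)) x = jp ori 1 * pmf (srw ori n) (x - 1) + jp ori (-1) * pmf (srw ori n) (x + 1)"
  by (simp add: srw_def chain_law_Suc pmf_bind_one_step)

lemma srw_0 [simp]: "srw ori 0 = return_pmf 0"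
  by (simp add: srw_def)

lemma srw_support: "x \<in> set_pmf (srw ori n) \<Longrightarrow> \<bar>x\<bar> \<le> int n"
proof (induction n arbitrary: x)
  case (Suc n)
  then obtain y \<sigma> where "y \<in> set_pmf (srw ori n)" "\<sigma> \<in> set_pmf (jump_sign ori)" "x = y + \<sigma>"
    by (auto simp: srw_def chain_law_Suc one_step_def)
  with Suc.IH[of y] set_jump_sign_subset[of ori] show ?case by auto
qed auto

text \<open>All \<open>n\<close> jumps go up, each with probability at least 1/2 in either
  orientation. A lower bound on masses is an upper bound on surprisals.\<close>

lemma pmf_srw_diag: "pmf (srw ori n) (int n) \<ge> (1/2) ^ n"
proof (induction n)
  case (Suc n)
  have "(1/2) * (1/2)^n \<le> jp ori 1 * pmf (srw ori n) (int n)"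
    using Suc jp_1_ge[of ori] by (intro mult_mono) auto
  also have "\<dots> \<le> pmf (srw ori (Suc n)) (int (Suc n))"
    by (simp add: pmf_srw_Suc)
  finally show ?case by simp
qed auto

lemma srw_directed_neg: "x < 0 \<Longrightarrow> pmf (srw Directed n) x = 0"
  by (induction n arbitrary: x) (auto simp: pmf_srw_Suc jp_simps pmf_return)

lemma srw_undirected_sym: "pmf (srw Undirected n) (- x) = pmf (srw Undirected n) x"
proof (induction n arbitrary: x)
  case (Suc n)
  show ?case using Suc[of "x+1"] Suc[of "x - 1"] by (simp add: pmf_srw_Suc jp_simps)
qed (auto simp: pmf_return indicator_def)

definition egf :: "orientation \<Rightarrow> int \<Rightarrow> real \<Rightarrow> real" where
  "egf ori x s = (\<Sum>n. pmf (srw ori n) x / fact n * s ^ n)"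

lemma egf_summable: "summable (\<lambda>n. pmf (srw ori n) x / fact n * s ^ n)"
proof (rule summable_comparison_test)
  show "\<exists>N. \<forall>n\<ge>N. norm (pmf (srw ori n) x / fact n * s ^ n) \<le> norm (s ^ n /\<^sub>R fact n)"
    by (intro exI[of _ 0]) (auto simp: abs_mult field_simps power_abs intro!: mult_left_le pmf_le_1)
  show "summable (\<lambda>n. norm (s ^ n /\<^sub>R fact n))" by (rule summable_norm_exp)
qed

lemma egf_eq: "s \<ge> 0 \<Longrightarrow> egf ori x s = exp s * pmf (one_law ori s) x"
  using ct_walk_sums[of s "one_step ori" 0 "{x}"]
  unfolding egf_def one_law_def srw_def
  by (simp add: measure_pmf_single sums_iff mult.commute)

lemma egf_0: "egf ori x 0 = (if x = 0 then 1 else 0)"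
proof -
  have "egf ori x 0 = pmf (srw ori 0) x / fact 0"
    unfolding egf_def by (rule powser_zero[of "\<lambda>n. pmf (srw ori n) x / fact n"])
  then show ?thesis by (simp add: pmf_return)
qed

text \<open>The forward equation of the walk; the factor \<open>exp s\<close> in \<open>egf\<close>
  has absorbed the loss term.\<close>

lemma egf_deriv:
  "(egf ori x has_field_derivative (jp ori 1 * egf ori (x - 1) s + jp ori (-1) * egf ori (x + 1) s)) (at s)"
proof -
  have "(egf ori x has_field_derivative (\<Sum>n. diffs (\<lambda>n. pmf (srw ori n) x / fact n) n * s ^ n)) (at s)"
    unfolding egf_def[abs_def] by (rule termdiffs_strong_converges_everywhere) (rule egf_summable)
  also have "(\<lambda>n. diffs (\<lambda>n. pmf (srw ori n) x / fact n) n * s ^ n) =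
    (\<lambda>n. jp ori 1 * (pmf (srw ori n) (x - 1) / fact n * s ^ n) + jp ori (-1) * (pmf (srw ori n) (x + 1) / fact n * s ^ n))"
    (is "_ = (\<lambda>n. ?f n + ?g n)")
    by (rule ext) (simp add: diffs_def pmf_srw_Suc divide_simps del: of_nat_Suc, simp add: algebra_simps)
  also have "(\<Sum>n. ?f n + ?g n) = jp ori 1 * egf ori (x - 1) s + jp ori (-1) * egf ori (x + 1) s"
    unfolding egf_def
    by (intro sums_unique[symmetric] sums_add sums_mult summable_sums egf_summable)
  finally show ?thesis .
qed

section \<open>Independence of the coordinates of the lattice walk\<close>

definition lattice_op :: "orientation \<Rightarrow> nat \<Rightarrow> ((nat \<Rightarrow> int) \<Rightarrow> real) \<Rightarrow> (nat \<Rightarrow> int) \<Rightarrow> real" where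
  "lattice_op ori k f w =
     (\<Sum>i<k. jp ori 1 * f (w(i := w i - 1)) + jp ori (-1) * f (w(i := w i + 1))) / real k"

lemma pmf_bind_lattice_step:
  assumes "k > 0"
  shows "pmf (bind_pmf p (lattice_step ori k)) = lattice_op ori k (pmf p)"
proof (rule ext)
  fix w :: "nat \<Rightarrow> int"
  have inj: "inj (\<lambda>w :: nat \<Rightarrow> int. w(i := w i + \<sigma>))" for i \<sigma>
  proof (rule injI)
    fix x y :: "nat \<Rightarrow> int" assume "x(i := x i + \<sigma>) = y(i := y i + \<sigma>)"
    then have "(x(i := x i + \<sigma>)) j = (y(i := y i + \<sigma>)) j" for j by simp
    then show "x = y" by (intro ext) (metis add_right_cancel fun_upd_apply)
  qed
  have "bind_pmf p (lattice_step ori k) =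
     bind_pmf (pmf_of_set {..<k}) (\<lambda>i. bind_pmf (jump_sign ori) (\<lambda>\<sigma>. map_pmf (\<lambda>w. w(i := w i + \<sigma>)) p))"
    unfolding lattice_step_def map_pmf_def
    by (subst bind_commute_pmf, subst (2) bind_commute_pmf) simp
  moreover have "pmf (map_pmf (\<lambda>w. w(i := w i + \<sigma>)) p) w = pmf p (w(i := w i - \<sigma>))" for i \<sigma>
    using pmf_map_inj'[OF inj[of i \<sigma>], of p "w(i := w i - \<sigma>)"] by simp
  ultimately show "pmf (bind_pmf p (lattice_step ori k)) w = lattice_op ori k (pmf p) w"
    using assms
    by (simp add: pmf_bind expectation_jump_sign integral_pmf_of_set lattice_op_def lessThan_empty_iff)
qed

lemma pmf_chain_lattice:
  "k > 0 \<Longrightarrow> pmf (chain_law (lattice_step ori k) n p) = (lattice_op ori k ^^ n) (pmf p)"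
  by (induction n) (simp_all add: chain_law_Suc pmf_bind_lattice_step)

text \<open>The candidate for \<open>exp t\<close> times the law of the lattice walk: each of the
  \<open>k\<close> factors carries \<open>exp (t / k)\<close>.\<close>

definition prod_egf :: "orientation \<Rightarrow> nat \<Rightarrow> real \<Rightarrow> (nat \<Rightarrow> int) \<Rightarrow> real" where
  "prod_egf ori k t w = (if \<forall>i\<ge>k. w i = 0 then \<Prod>i<k. egf ori (w i) (t / k) else 0)"

text \<open>The product rule gives a sum over the coordinates, and the inner derivative
  \<open>1 / k\<close> turns it into the average in \<open>lattice_op\<close>. Off the support both
  sides vanish, since updates below \<open>k\<close> never repair a nonzero entry at or above
  \<open>k\<close>.\<close>

lemma prod_egf_deriv:
  assumes "k > 0"
  shows "((\<lambda>t. prod_egf ori k t w) has_field_derivative lattice_op ori k (prod_egf ori k t) w) (at t)"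
proof (cases "\<forall>i\<ge>k. w i = 0")
  case True
  have d: "((\<lambda>t. egf ori (w i) (t / k)) has_field_derivative
      (jp ori 1 * egf ori (w i - 1) (t / k) + jp ori (-1) * egf ori (w i + 1) (t / k)) * (1 / k)) (at t)" for i
    by (rule DERIV_chain2[OF egf_deriv]) (use assms in \<open>auto intro!: derivative_eq_intros\<close>)
  have upd: "prod_egf ori k t (w(i := x)) = egf ori x (t / k) * (\<Prod>j\<in>{..<k} - {i}. egf ori (w j) (t / k))"
    if "i < k" for i x
  proof -
    have "prod_egf ori k t (w(i := x)) = (\<Prod>j<k. egf ori ((w(i := x)) j) (t / k))"
      using True that by (auto simp: prod_egf_def)
    also have "\<dots> = egf ori x (t / k) * (\<Prod>j\<in>{..<k} - {i}. egf ori ((w(i := x)) j) (t / k))"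
      using that by (subst prod.remove[of _ i]) auto
    also have "(\<Prod>j\<in>{..<k} - {i}. egf ori ((w(i := x)) j) (t / k)) = (\<Prod>j\<in>{..<k} - {i}. egf ori (w j) (t / k))"
      by (rule prod.cong) auto
    finally show ?thesis .
  qed
  have "((\<lambda>t. \<Prod>i<k. egf ori (w i) (t / k)) has_field_derivative
      (\<Sum>i<k. ((jp ori 1 * egf ori (w i - 1) (t / k) + jp ori (-1) * egf ori (w i + 1) (t / k)) * (1 / k))
         * (\<Prod>j\<in>{..<k} - {i}. egf ori (w j) (t / k)))) (at t)"
    by (rule has_field_derivative_prod) (rule d)
  also have "(\<Sum>i<k. ((jp ori 1 * egf ori (w i - 1) (t / k) + jp ori (-1) * egf ori (w i + 1) (t / k)) * (1 / k))
         * (\<Prod>j\<in>{..<k} - {i}. egf ori (w j) (t / k))) = lattice_op ori k (prod_egf ori k t) w"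
    unfolding lattice_op_def sum_divide_distrib
    by (rule sum.cong) (auto simp: upd algebra_simps add_divide_distrib)
  finally show ?thesis using True by (simp add: prod_egf_def)
next
  case False
  then have z: "prod_egf ori k u (w(i := x)) = 0" "prod_egf ori k u w = 0" if "i < k" for i x u
    using that by (auto simp: prod_egf_def)
  have "lattice_op ori k (prod_egf ori k t) w = 0"
    by (auto simp: lattice_op_def z)
  moreover have "(\<lambda>t. prod_egf ori k t w) = (\<lambda>_. 0)" using z(2)[OF assms] by auto
  ultimately show ?thesis by simp
qed

lemma lattice_op_deriv:
  assumes "\<And>w. ((\<lambda>t. f t w) has_field_derivative f' w) (at t)"
  shows "((\<lambda>t. lattice_op ori k (f t) w) has_field_derivative lattice_op ori k f' w) (at t)"
  unfolding lattice_op_def by (intro DERIV_cdivide DERIV_sum DERIV_add DERIV_cmult assms)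

lemma lattice_op_pow_deriv:
  assumes "k > 0"
  shows "((\<lambda>t. (lattice_op ori k ^^ n) (prod_egf ori k t) w) has_field_derivative
            (lattice_op ori k ^^ Suc n) (prod_egf ori k t) w) (at t)"
proof (induction n arbitrary: w)
  case 0
  then show ?case using prod_egf_deriv[OF assms] by simp
next
  case (Suc n)
  from lattice_op_deriv[OF Suc] show ?case by simp
qed

lemma lattice_op_bound:
  assumes "\<And>w. \<bar>f w\<bar> \<le> C" "k > 0"
  shows "\<bar>lattice_op ori k f w\<bar> \<le> C"
proof -
  have "\<bar>jp ori 1 * f (w(i := w i - 1)) + jp ori (-1) * f (w(i := w i + 1))\<bar> \<le> C" for i
  proof -
    have "\<bar>jp ori 1 * f (w(i := w i - 1)) + jp ori (-1) * f (w(i := w i + 1))\<bar> \<le> jp ori 1 * C + jp ori (-1) * C"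
      using assms(1)
      by (intro order.trans[OF abs_triangle_ineq] add_mono) (auto simp: abs_mult intro!: mult_left_mono)
    also have "\<dots> = C" using jp_sum[of ori] by (metis distrib_right mult_1)
    finally show ?thesis .
  qed
  then have "\<bar>\<Sum>i<k. jp ori 1 * f (w(i := w i - 1)) + jp ori (-1) * f (w(i := w i + 1))\<bar> \<le> (\<Sum>i<k. C)"
    by (intro order.trans[OF sum_abs] sum_mono)
  then show ?thesis using assms(2) by (simp add: lattice_op_def field_simps)
qed

lemma lattice_op_pow_bound:
  "(\<And>w. \<bar>f w\<bar> \<le> C) \<Longrightarrow> k > 0 \<Longrightarrow> \<bar>(lattice_op ori k ^^ n) f w\<bar> \<le> C"
  by (induction n arbitrary: w) (auto intro: lattice_op_bound)

lemma egf_bounds: "s \<ge> 0 \<Longrightarrow> 0 \<le> egf ori x s" "s \<ge> 0 \<Longrightarrow> egf ori x s \<le> exp s"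
  by (auto simp: egf_eq pmf_le_1 mult_left_le)

lemma prod_egf_bound:
  assumes "k > 0" "t \<ge> 0" "t \<le> T"
  shows "\<bar>prod_egf ori k t w\<bar> \<le> exp T"
proof -
  have "\<bar>\<Prod>i<k. egf ori (w i) (t / k)\<bar> \<le> (\<Prod>i<k. exp (t / k))"
    unfolding abs_prod using egf_bounds[of "t/k" ori] assms by (intro prod_mono) auto
  also have "\<dots> = exp t" using assms by (simp flip: exp_of_nat_mult)
  also have "\<dots> \<le> exp T" using assms by simp
  finally show ?thesis by (auto simp: prod_egf_def)
qed

text \<open>Both sides, multiplied by \<open>exp t\<close>, solve \<open>f' = lattice_op f\<close> with the same initial value;
  as \<open>lattice_op\<close> is a contraction for the supremum norm, the Taylor series of the product at 0
  converges to it, and this series defines the walk.\<close>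

lemma pmf_lattice_law:
  assumes k: "k > 0" and t: "t \<ge> 0"
  shows "pmf (lattice_law ori k t) w =
           (if \<forall>i\<ge>k. w i = 0 then \<Prod>i<k. pmf (one_law ori (t / k)) (w i) else 0)"
proof -
  define d where "d n = (lattice_op ori k ^^ n) (prod_egf ori k 0) w" for n
  have p0: "prod_egf ori k 0 = pmf (return_pmf (\<lambda>_. 0))"
  proof
    fix w :: "nat \<Rightarrow> int"
    have "((\<forall>i\<ge>k. w i = 0) \<and> (\<forall>i<k. w i = 0)) \<longleftrightarrow> w = (\<lambda>_. 0)"
      by (metis ext not_less)
    then show "prod_egf ori k 0 w = pmf (return_pmf (\<lambda>_. 0)) w"
      by (auto simp: prod_egf_def egf_0 pmf_return indicator_def)
  qed
  have s1: "(\<lambda>n. t ^ n / fact n * d n) sums (exp t * pmf (lattice_law ori k t) w)"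
    using ct_walk_sums[OF t, of "lattice_step ori k" "\<lambda>_. 0" "{w}"]
    by (simp add: lattice_law_def measure_pmf_single pmf_chain_lattice k d_def p0)
  have s2: "(\<lambda>n. t ^ n / fact n * d n) sums prod_egf ori k t w"
  proof (cases "t = 0")
    case True
    have "(\<lambda>n. t ^ n / fact n * d n) sums (t ^ 0 / fact 0 * d 0)"
      by (rule sums_single[of 0, THEN back_subst[where P="\<lambda>f. f sums _"]]) (auto simp: True)
    then show ?thesis by (simp add: d_def True)
  next
    case False
    have bd: "norm (prod_egf ori k t w - (\<Sum>m<n. t ^ m / fact m * d m)) \<le> exp t * (t ^ n / fact n)" if "n > 0" for n
    proof -
      have "\<exists>\<xi>. 0 < \<xi> \<and> \<xi> < t \<and> prod_egf ori k t w =
        (\<Sum>m<n. (lattice_op ori k ^^ m) (prod_egf ori k 0) w / fact m * t ^ m)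
         + (lattice_op ori k ^^ n) (prod_egf ori k \<xi>) w / fact n * t ^ n"
        using t False that lattice_op_pow_deriv[OF k]
        by (intro Maclaurin[where diff="\<lambda>m t. (lattice_op ori k ^^ m) (prod_egf ori k t) w"]) auto
      then obtain \<xi> where \<xi>: "0 < \<xi>" "\<xi> < t" and eq: "prod_egf ori k t w =
        (\<Sum>m<n. t ^ m / fact m * d m) + (lattice_op ori k ^^ n) (prod_egf ori k \<xi>) w / fact n * t ^ n"
        by (auto simp: d_def mult_ac)
      have "\<bar>(lattice_op ori k ^^ n) (prod_egf ori k \<xi>) w\<bar> \<le> exp t"
        using \<xi> k by (intro lattice_op_pow_bound prod_egf_bound) auto
      then have "\<bar>(lattice_op ori k ^^ n) (prod_egf ori k \<xi>) w\<bar> * (t ^ n / fact n) \<le> exp t * (t ^ n / fact n)"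
        using t by (intro mult_right_mono) auto
      then show ?thesis using t unfolding eq real_norm_def by (simp add: abs_mult)
    qed
    have lim: "(\<lambda>n. exp t * (t ^ n / fact n)) \<longlonglongrightarrow> exp t * 0"
    proof (intro tendsto_mult tendsto_const)
      show "(\<lambda>n. t ^ n / fact n) \<longlonglongrightarrow> 0"
        using summable_LIMSEQ_zero[OF summable_exp[of t]] by (simp add: divide_inverse mult.commute)
    qed
    have "(\<lambda>n. prod_egf ori k t w - (\<Sum>m<n. t ^ m / fact m * d m)) \<longlonglongrightarrow> 0"
    proof (rule Lim_null_comparison)
      show "\<forall>\<^sub>F n in sequentially. norm (prod_egf ori k t w - (\<Sum>m<n. t ^ m / fact m * d m)) \<le> exp t * (t ^ n / fact n)"
        using bd by (intro eventually_sequentiallyI[of 1]) simp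
      show "(\<lambda>n. exp t * (t ^ n / fact n)) \<longlonglongrightarrow> 0"
        using lim by (simp only: mult_zero_right)
    qed
    from tendsto_diff[OF tendsto_const[of "prod_egf ori k t w"] this] show ?thesis
      by (simp add: sums_def)
  qed
  have "exp t * pmf (lattice_law ori k t) w = prod_egf ori k t w"
    using sums_unique2[OF s1 s2] .
  moreover have "(\<Prod>i<k. egf ori (w i) (t / k)) = exp t * (\<Prod>i<k. pmf (one_law ori (t / k)) (w i))"
    using k t by (simp add: egf_eq prod.distrib flip: exp_of_nat_mult)
  ultimately show ?thesis
    by (cases "\<forall>i\<ge>k. w i = 0") (simp_all add: prod_egf_def del: not_all)
qed

lemma lattice_law_Pi_pmf:
  assumes "k > 0" "t \<ge> 0"
  shows "lattice_law ori k t = Pi_pmf {..<k} 0 (\<lambda>_. one_law ori (t / k))"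
  by (rule pmf_eqI) (auto simp: pmf_lattice_law[OF assms] pmf_Pi not_less)

lemma coord_law_one_law:
  assumes "k > 0" "t \<ge> 0"
  shows "coord_law ori k t = one_law ori (t / k)"
  unfolding coord_law_def lattice_law_Pi_pmf[OF assms]
  using assms by (subst Pi_pmf_component) auto

section \<open>Tails and single jumps of one coordinate\<close>

lemma one_law_sums:
  "s \<ge> 0 \<Longrightarrow> (\<lambda>n. s ^ n / fact n * measure_pmf.prob (srw ori n) A) sums (exp s * measure_pmf.prob (one_law ori s) A)"
  unfolding one_law_def srw_def by (rule ct_walk_sums)

text \<open>Distance \<open>n\<close> requires at least \<open>n\<close> jumps, and
  \<open>fact (i + n) \<ge> fact n * fact i\<close> lets \<open>s ^ n / fact n\<close> be pulled out
  of the remaining Poisson series.\<close>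

lemma one_law_tail:
  assumes "s \<ge> 0" "\<And>x. x \<in> A \<Longrightarrow> int n \<le> \<bar>x\<bar>"
  shows "measure_pmf.prob (one_law ori s) A \<le> s ^ n / fact n"
proof -
  let ?f = "\<lambda>j. s ^ j / fact j * measure_pmf.prob (srw ori j) A"
  have z: "measure_pmf.prob (srw ori j) A = 0" if "j < n" for j
    using that assms(2) srw_support[of _ ori j] by (force simp: measure_pmf_zero_iff)
  have "(\<Sum>i<n. ?f i) = 0" using z by simp
  with one_law_sums[OF assms(1), of ori A]
  have s1: "(\<lambda>i. ?f (i + n)) sums (exp s * measure_pmf.prob (one_law ori s) A)"
    by (subst sums_iff_shift) simp
  have s2: "(\<lambda>i. s ^ n / fact n * (s ^ i /\<^sub>R fact i)) sums (s ^ n / fact n * exp s)"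
    by (intro sums_mult exp_converges)
  have le: "?f (i + n) \<le> s ^ n / fact n * (s ^ i /\<^sub>R fact i)" for i
  proof -
    have "fact n * fact i \<le> (fact (i + n) :: real)"
      using fact_fact_dvd_fact[of n i, where 'a=nat]
      by (metis add.commute dvd_imp_le fact_gt_zero of_nat_fact of_nat_le_iff of_nat_mult)
    then have "s ^ (i + n) / fact (i + n) \<le> s ^ (i + n) / (fact n * fact i)"
      using assms(1) by (intro divide_left_mono) auto
    moreover have "?f (i + n) \<le> s ^ (i + n) / fact (i + n)"
      using assms(1) by (intro mult_left_le) auto
    moreover have "s ^ (i + n) / (fact n * fact i) = s ^ n / fact n * (s ^ i /\<^sub>R fact i)"
      by (simp add: power_add field_simps)
    ultimately show ?thesis by linarith
  qed
  have "exp s * measure_pmf.prob (one_law ori s) A \<le> s ^ n / fact n * exp s"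
    by (rule sums_le[OF le s1 s2])
  then have "exp s * measure_pmf.prob (one_law ori s) A \<le> exp s * (s ^ n / fact n)"
    by (simp only: mult.commute)
  then show ?thesis by (simp only: mult_le_cancel_left_pos exp_gt_zero)
qed

lemma one_law_ge_term:
  assumes "s \<ge> 0"
  shows "exp (- s) * (s ^ n / fact n * measure_pmf.prob (srw ori n) A) \<le> measure_pmf.prob (one_law ori s) A"
proof -
  have "(\<Sum>j\<in>{n}. s ^ j / fact j * measure_pmf.prob (srw ori j) A) \<le> exp s * measure_pmf.prob (one_law ori s) A"
    using assms by (intro sum_le_suminf[OF sums_summable[OF one_law_sums[OF assms]],
       unfolded sums_unique[OF one_law_sums[OF assms], symmetric]]) auto
  then show ?thesis by (simp add: exp_minus field_simps)
qed

text \<open>The event of exactly one jump, of probability \<open>s * exp (- s)\<close>.\<close>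

lemma one_law_unit: "s \<ge> 0 \<Longrightarrow> s * exp (- s) \<le> measure_pmf.prob (one_law ori s) {x. \<bar>x\<bar> = 1}"
proof -
  assume s: "s \<ge> 0"
  have "set_pmf (srw ori (Suc 0)) \<subseteq> {x. \<bar>x\<bar> = 1}"
    using set_jump_sign_subset[of ori] by (auto simp: srw_def chain_law_Suc one_step_def bind_return_pmf)
  then have "measure_pmf.prob (srw ori (Suc 0)) {x. \<bar>x\<bar> = 1} = 1"
    by (simp add: measure_pmf.prob_eq_1 AE_measure_pmf_iff subset_iff)
  with one_law_ge_term[OF s, of "Suc 0" ori "{x. \<bar>x\<bar> = 1}"] show ?thesis by (simp add: mult.commute)
qed

section \<open>Moments of the surprisal of one coordinate\<close>

text \<open>Given by a power series instead of \<open>one_law\<close>, so that it is differentiable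
  at every real \<open>s\<close>; the behaviour as \<open>s\<close> decreases to 0 is then read off
  from an ordinary derivative at 0.\<close>

definition cpmf :: "orientation \<Rightarrow> int \<Rightarrow> real \<Rightarrow> real" where
  "cpmf ori x s = exp (- s) * egf ori x s"

lemma cpmf_eq: "s \<ge> 0 \<Longrightarrow> cpmf ori x s = pmf (one_law ori s) x"
  by (simp add: cpmf_def egf_eq exp_minus field_simps)

lemma cpmf_nonneg: "s \<ge> 0 \<Longrightarrow> cpmf ori x s \<ge> 0" and cpmf_le_1: "s \<ge> 0 \<Longrightarrow> cpmf ori x s \<le> 1"
  by (auto simp: cpmf_eq pmf_le_1)

lemma cpmf_upper: "s \<ge> 0 \<Longrightarrow> cpmf ori x s \<le> s ^ nat \<bar>x\<bar> / fact (nat \<bar>x\<bar>)"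
  using one_law_tail[of s "{x}" "nat \<bar>x\<bar>" ori] by (simp add: cpmf_eq measure_pmf_single)

lemma cpmf_lower: "s \<ge> 0 \<Longrightarrow> exp (- s) * ((s / 2) ^ n / fact n) \<le> cpmf ori (int n) s"
proof -
  assume s: "s \<ge> 0"
  have "exp (- s) * (s ^ n / fact n * (1/2) ^ n) \<le> exp (- s) * (s ^ n / fact n * pmf (srw ori n) (int n))"
    using s pmf_srw_diag[of n ori] by (intro mult_left_mono) auto
  also have "\<dots> \<le> cpmf ori (int n) s"
    using one_law_ge_term[OF s, of n ori "{int n}"] s by (simp add: measure_pmf_single cpmf_eq)
  finally show ?thesis by (simp add: power_divide mult.commute)
qed

lemma cpmf_pos: "s > 0 \<Longrightarrow> cpmf ori (int n) s > 0"
  using cpmf_lower[of s n ori] by (smt (verit) divide_pos_pos exp_gt_zero fact_gt_zero mult_pos_pos zero_less_power)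

lemma cpmf_zero: "cpmf ori x 0 = (if x = 0 then 1 else 0)"
  by (simp add: cpmf_def egf_0)

lemma cpmf_directed_neg: "x < 0 \<Longrightarrow> cpmf Directed x s = 0"
  by (simp add: cpmf_def egf_def srw_directed_neg)

lemma cpmf_undirected_sym: "cpmf Undirected (- x) s = cpmf Undirected x s"
  by (simp add: cpmf_def egf_def srw_undirected_sym)

definition cpmf' :: "orientation \<Rightarrow> int \<Rightarrow> real \<Rightarrow> real" where
  "cpmf' ori x s = jp ori 1 * cpmf ori (x - 1) s + jp ori (-1) * cpmf ori (x + 1) s - cpmf ori x s"

lemma cpmf_deriv: "(cpmf ori x has_field_derivative cpmf' ori x s) (at s)"
  unfolding cpmf_def[abs_def] cpmf'_def
  by (auto intro!: derivative_eq_intros egf_deriv simp: algebra_simps)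

lemma cpmf_continuous [continuous_intros]: "continuous (at s within A) (cpmf ori x)"
  using cpmf_deriv[of ori x s] DERIV_isCont continuous_at_imp_continuous_at_within by blast

lemma cpmf_tendsto: "(f \<longlongrightarrow> s) F \<Longrightarrow> ((\<lambda>t. cpmf ori x (f t)) \<longlongrightarrow> cpmf ori x s) F"
  by (rule isCont_tendsto_compose[OF cpmf_continuous])

text \<open>The number of points of absolute value \<open>n\<close> that the walk visits; they have
  equal masses, so sums over the integers become series over \<open>nat\<close>.\<close>

definition mult_abs :: "orientation \<Rightarrow> nat \<Rightarrow> real" where
  "mult_abs ori n = (if n = 0 \<or> ori = Directed then 1 else 2)"

lemma mult_abs_bounds: "1 \<le> mult_abs ori n" "mult_abs ori n \<le> 2"
  by (auto simp: mult_abs_def)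

definition abs_law :: "orientation \<Rightarrow> real \<Rightarrow> nat pmf" where
  "abs_law ori s = map_pmf (\<lambda>x. nat \<bar>x\<bar>) (one_law ori s)"

lemma pmf_abs_law:
  assumes "s \<ge> 0"
  shows "pmf (abs_law ori s) n = mult_abs ori n * cpmf ori (int n) s"
proof -
  have "pmf (abs_law ori s) n = measure_pmf.prob (one_law ori s) ((\<lambda>x. nat \<bar>x\<bar>) -` {n})"
    by (simp add: abs_law_def pmf_map)
  also have "(\<lambda>x. nat \<bar>x\<bar>) -` {n} = {int n, - int n}" by auto
  also have "measure_pmf.prob (one_law ori s) {int n, - int n} = (\<Sum>x\<in>{int n, - int n}. cpmf ori x s)"
    using assms by (subst measure_measure_pmf_finite) (simp_all add: cpmf_eq)
  also have "\<dots> = mult_abs ori n * cpmf ori (int n) s"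
    using cpmf_undirected_sym[of "int n" s] cpmf_directed_neg[of "- int n" s]
    by (cases ori; cases "n = 0") (auto simp: mult_abs_def)
  finally show ?thesis .
qed

lemma integrable_nat_pmf:
  fixes f :: "nat \<Rightarrow> real"
  assumes "summable (\<lambda>n. \<bar>pmf p n * f n\<bar>)"
  shows "integrable (measure_pmf p) f"
proof -
  have "integrable (count_space UNIV) (\<lambda>n. pmf p n * f n)"
    using assms by (subst integrable_count_space_nat_iff) simp
  then show ?thesis
    by (subst measure_pmf_eq_density) (simp add: integrable_density)
qed

text \<open>Agreement of \<open>f\<close> with \<open>g\<close> is required on the support only: in
  the directed case a negative integer has mass 0, and its surprisal is not that of its absolute
  value.\<close>

lemma one_law_expectation:
  assumes s: "s \<ge> 0" and f: "\<And>x. x \<in> set_pmf (one_law ori s) \<Longrightarrow> f x = g (nat \<bar>x\<bar>)"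
    and sm: "summable (\<lambda>n. \<bar>mult_abs ori n * cpmf ori (int n) s * g n\<bar>)"
  shows "integrable (one_law ori s) f"
    "measure_pmf.expectation (one_law ori s) f = (\<Sum>n. mult_abs ori n * cpmf ori (int n) s * g n)"
proof -
  have i: "integrable (abs_law ori s) g"
    using sm by (intro integrable_nat_pmf) (simp add: pmf_abs_law s)
  then have i': "integrable (one_law ori s) (\<lambda>x. g (nat \<bar>x\<bar>))"
    by (simp add: abs_law_def)
  then show "integrable (one_law ori s) f"
    by (subst integrable_cong_AE[where g="\<lambda>x. g (nat \<bar>x\<bar>)"]) (auto simp: AE_measure_pmf_iff f)
  have "measure_pmf.expectation (one_law ori s) f = measure_pmf.expectation (one_law ori s) (\<lambda>x. g (nat \<bar>x\<bar>))"
    by (intro integral_cong_AE) (auto simp: AE_measure_pmf_iff f)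
  also have "\<dots> = measure_pmf.expectation (abs_law ori s) g"
    by (simp add: abs_law_def)
  also have "\<dots> = (\<Sum>n. mult_abs ori n * cpmf ori (int n) s * g n)"
    using expectation_nat_pmf_sums[OF i] by (simp add: pmf_abs_law s sums_iff)
  finally show "measure_pmf.expectation (one_law ori s) f = (\<Sum>n. mult_abs ori n * cpmf ori (int n) s * g n)" .
qed

lemma mult_cpmf_sums: "s \<ge> 0 \<Longrightarrow> (\<lambda>n. mult_abs ori n * cpmf ori (int n) s) sums 1"
  using expectation_nat_pmf_sums[of "abs_law ori s" "\<lambda>_. 1"] by (simp add: pmf_abs_law)

lemma one_law_set_pmf:
  assumes "s > 0" "x \<in> set_pmf (one_law ori s)"
  shows "pmf (one_law ori s) x = cpmf ori (int (nat \<bar>x\<bar>)) s"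
proof (cases "x < 0")
  case True
  show ?thesis
  proof (cases ori)
    case Directed
    then show ?thesis using True assms cpmf_directed_neg[of x s] by (simp add: cpmf_eq set_pmf_iff)
  next
    case Undirected
    then show ?thesis using True assms cpmf_undirected_sym[of x s] by (simp add: cpmf_eq)
  qed
qed (use assms in \<open>simp add: cpmf_eq\<close>)

text \<open>As \<open>s\<close> tends to 0, the entropy of one coordinate is asymptotic to \<open>s * ell s\<close>; the
  constant \<open>exp 1\<close> makes \<open>ell\<close> at least 1 everywhere.\<close>

definition ell :: "real \<Rightarrow> real" where "ell s = ln (exp 1 + 1 / s)"

lemma ell_ge_1: "s > 0 \<Longrightarrow> ell s \<ge> 1"
  unfolding ell_def by (subst ln_ge_iff) (auto intro: add_pos_pos)

lemma ell_pos: "s > 0 \<Longrightarrow> ell s > 0"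
  using ell_ge_1[of s] by simp

lemma ell_ge_ln: "s > 0 \<Longrightarrow> - ln s \<le> ell s"
proof -
  assume s: "s > 0"
  then have "ln (1 / s) \<le> ell s"
    unfolding ell_def by (subst ln_le_cancel_iff) (auto simp: add_pos_pos)
  then show ?thesis using s by (simp add: ln_div)
qed

lemma ell_antimono: "0 < s \<Longrightarrow> s \<le> t \<Longrightarrow> ell t \<le> ell s"
  unfolding ell_def by (subst ln_le_cancel_iff) (auto simp: frac_le add_pos_pos)

lemma ell_tendsto: "(f \<longlongrightarrow> s) F \<Longrightarrow> s > 0 \<Longrightarrow> ((\<lambda>x. ell (f x)) \<longlongrightarrow> ell s) F"
proof -
  assume "(f \<longlongrightarrow> s) F" "s > 0"
  moreover have "exp 1 + 1 / s > 0" using \<open>s > 0\<close> by (intro add_pos_pos) auto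
  ultimately show ?thesis
    unfolding ell_def by (intro tendsto_intros) auto
qed

lemma poly_fact_summable:
  fixes x :: real
  assumes "x \<ge> 0"
  shows "summable (\<lambda>n. (real n + 1) ^ a * x ^ n / fact n)"
proof (rule summable_comparison_test)
  have "(real n + 1) ^ a \<le> fact a * (exp 1 * exp 1 ^ n)" for n
  proof -
    have "(real n + 1) ^ a / fact a \<le> exp (real n + 1)"
    proof -
      have "(\<Sum>i\<in>{a}. (real n + 1) ^ i /\<^sub>R fact i) \<le> (\<Sum>i. (real n + 1) ^ i /\<^sub>R fact i)"
        using summable_exp[of "real n + 1"] by (intro sum_le_suminf) auto
      then show ?thesis by (simp add: exp_def divide_inverse mult.commute)
    qed
    moreover have "exp (real n + 1) = exp 1 * exp 1 ^ n"
      by (simp add: exp_add exp_of_nat_mult[symmetric])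
    ultimately show ?thesis by (simp add: field_simps)
  qed
  then have "(real n + 1) ^ a * x ^ n / fact n \<le> fact a * (exp 1 * exp 1 ^ n) * x ^ n / fact n" for n
    using assms by (intro divide_right_mono mult_right_mono) auto
  also have "fact a * (exp 1 * exp 1 ^ n) * x ^ n / fact n = fact a * exp 1 * ((exp 1 * x) ^ n /\<^sub>R fact n)" for n
    by (simp add: power_mult_distrib divide_inverse)
  finally show "\<exists>N. \<forall>n\<ge>N. norm ((real n + 1) ^ a * x ^ n / fact n) \<le> fact a * exp 1 * ((exp 1 * x) ^ n /\<^sub>R fact n)"
    using assms by auto
  show "summable (\<lambda>n. fact a * exp 1 * ((exp 1 * x) ^ n /\<^sub>R fact n))"
    by (intro summable_mult summable_exp_generic)
qed

definition sur :: "orientation \<Rightarrow> nat \<Rightarrow> real \<Rightarrow> real" where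
  "sur ori n s = - ln (cpmf ori (int n) s)"

lemma sur_nonneg: "s \<ge> 0 \<Longrightarrow> sur ori n s \<ge> 0"
\<comment> \<open>If the mass is 0, the surprisal is 0 by the default value
  \<open>ln 0 = 0\<close>.\<close>
proof (cases "cpmf ori (int n) s = 0")
  case False
  assume "s \<ge> 0"
  then show ?thesis using False cpmf_nonneg[of s ori "int n"] cpmf_le_1[of s ori "int n"]
    by (simp add: sur_def ln_le_zero_iff)
qed (simp add: sur_def)

lemma sur_upper:
  assumes "s > 0"
  shows "sur ori n s \<le> s + real n * (ln 2 - ln s) + ln (fact n)"
proof -
  have "ln (exp (- s) * ((s / 2) ^ n / fact n)) \<le> ln (cpmf ori (int n) s)"
    using assms cpmf_lower[of s n ori] by (subst ln_le_cancel_iff) (auto simp: cpmf_pos)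
  also have "ln (exp (- s) * ((s / 2) ^ n / fact n)) = - s + real n * (ln s - ln 2) - ln (fact n)"
    using assms by (simp add: ln_mult ln_div ln_realpow)
  finally show ?thesis by (simp add: sur_def algebra_simps)
qed

lemma sur_0_le: "s > 0 \<Longrightarrow> sur ori 0 s \<le> s"
  using sur_upper[of s ori 0] by simp

lemma sur_lower:
  assumes "s > 0"
  shows "- real n * ln s + ln (fact n) \<le> sur ori n s"
proof -
  have "ln (cpmf ori (int n) s) \<le> ln (s ^ n / fact n)"
    using assms cpmf_upper[of s ori "int n"] by (subst ln_le_cancel_iff) (auto simp: cpmf_pos)
  also have "\<dots> = real n * ln s - ln (fact n)"
    using assms by (simp add: ln_div ln_realpow)
  finally show ?thesis by (simp add: sur_def)
qed

lemma ln_2_le_1: "ln (2::real) \<le> 1"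
  using ln_le_minus_one[of 2] by simp

text \<open>Polynomial growth in \<open>n\<close> is harmless against \<open>1 / fact n\<close>, and
  all dependence on small \<open>s\<close> sits in \<open>ell s\<close>. In \<open>S + 3\<close>,
  the summand \<open>S\<close> covers \<open>s\<close>, 2 covers \<open>n * (ln 2 - ln s)\<close>,
  and 1 covers \<open>ln (fact n)\<close>.\<close>

lemma sur_bound:
  assumes "0 < s" "s \<le> S"
  shows "sur ori n s \<le> (S + 3) * (real n + 1)\<^sup>2 * ell s"
proof -
  define L where "L = ell s"
  define m where "m = real n + 1"
  have L: "L \<ge> 1" "- ln s \<le> L" using assms ell_ge_1 ell_ge_ln by (auto simp: L_def)
  have m: "m \<ge> 1" by (simp add: m_def)
  have mL: "1 \<le> m\<^sup>2 * L" using L m by (metis mult_mono' mult_1 one_le_power zero_le_one)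
  have "ln (fact n) \<le> ln (real n ^ n)" if "n > 0"
    using that fact_le_power[of n, where 'a=real] by (subst ln_le_cancel_iff) auto
  also have "ln (real n ^ n) = real n * ln (real n)" if "n > 0" using that by (simp add: ln_realpow)
  also have "real n * ln (real n) \<le> real n * real n" if "n > 0"
    using that ln_le_minus_one[of "real n"] by (intro mult_left_mono) auto
  finally have "ln (fact n) \<le> real n * real n" by (cases "n = 0") auto
  also have "\<dots> \<le> m\<^sup>2 * L"
  proof -
    have "real n * real n \<le> m * m * 1" unfolding m_def mult_1_right by (intro mult_mono) auto
    also have "\<dots> \<le> m * m * L" using L m by (intro mult_left_mono) auto
    finally show ?thesis by (simp add: power2_eq_square)
  qed
  finally have 1: "ln (fact n) \<le> m\<^sup>2 * L" .
  have "real n * (ln 2 - ln s) \<le> m * (2 * L)"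
  proof (cases "ln 2 - ln s \<ge> 0")
    case True
    then show ?thesis using L ln_2_le_1 by (intro mult_mono) (auto simp: m_def)
  next
    case False
    then have "real n * (ln 2 - ln s) \<le> 0" by (intro mult_nonneg_nonpos) auto
    also have "0 \<le> m * (2 * L)" using L m by simp
    finally show ?thesis .
  qed
  also have "\<dots> \<le> 2 * (m\<^sup>2 * L)"
  proof -
    have "m * L \<le> m * (m * L)" using L m by (intro mult_left_mono) auto
    then show ?thesis by (simp add: power2_eq_square mult_ac)
  qed
  finally have 2: "real n * (ln 2 - ln s) \<le> 2 * (m\<^sup>2 * L)" .
  have 3: "s \<le> S * (m\<^sup>2 * L)"
  proof -
    have "S * 1 \<le> S * (m\<^sup>2 * L)" using mL assms by (intro mult_left_mono) auto
    then show ?thesis using assms by linarith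
  qed
  have "sur ori n s \<le> s + real n * (ln 2 - ln s) + ln (fact n)"
    using sur_upper assms by simp
  also have "\<dots> \<le> S * (m\<^sup>2 * L) + 2 * (m\<^sup>2 * L) + m\<^sup>2 * L"
    using 1 2 3 by linarith
  also have "\<dots> = (S + 3) * m\<^sup>2 * L" by (simp add: algebra_simps)
  finally show ?thesis by (simp add: m_def L_def)
qed

section \<open>Moments of the surprisal, uniformly down to time 0\<close>

definition moment_term :: "orientation \<Rightarrow> nat \<Rightarrow> nat \<Rightarrow> real \<Rightarrow> real" where
  "moment_term ori r n s = mult_abs ori n * cpmf ori (int n) s * sur ori n s ^ r"

definition moment :: "orientation \<Rightarrow> nat \<Rightarrow> real \<Rightarrow> real" where
  "moment ori r s = (\<Sum>n. moment_term ori r n s)"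

text \<open>Dominates \<open>moment_term\<close> after division by \<open>s * ell s ^ r\<close>,
  simultaneously for all \<open>s\<close> in \<open>(0, S]\<close>.\<close>

definition moment_bd :: "nat \<Rightarrow> real \<Rightarrow> nat \<Rightarrow> real" where
  "moment_bd r S n = 2 * (S + 3) ^ r * ((real n + 1) ^ (2 * r) * S ^ n / fact n)"

lemma moment_bd_summable: "S \<ge> 0 \<Longrightarrow> summable (moment_bd r S)"
  unfolding moment_bd_def[abs_def] by (intro summable_mult poly_fact_summable)

lemma moment_term_nonneg: "s \<ge> 0 \<Longrightarrow> moment_term ori r n s \<ge> 0"
  using mult_abs_bounds(1)[of ori n]
  by (auto simp: moment_term_def intro!: mult_nonneg_nonneg cpmf_nonneg sur_nonneg zero_le_power)

text \<open>For \<open>n = 0\<close> the factor \<open>s\<close> comes from the surprisal, otherwise from the probability.\<close>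

lemma moment_term_bound:
  assumes s: "0 < s" "s \<le> S" "1 \<le> S" and r: "r \<ge> 1"
  shows "moment_term ori r n s \<le> s * ell s ^ r * moment_bd r S n"
proof (cases "n = 0")
  case True
  have "mult_abs ori 0 * cpmf ori 0 s \<le> 2 * 1"
    using s mult_abs_bounds[of ori 0] cpmf_nonneg[of s ori 0] cpmf_le_1[of s ori 0]
    by (intro mult_mono) auto
  then have "moment_term ori r n s \<le> 2 * sur ori 0 s ^ r"
    using s by (auto simp: moment_term_def True intro!: mult_right_mono zero_le_power sur_nonneg)
  also have "sur ori 0 s ^ r \<le> s ^ r"
    using s by (intro power_mono sur_0_le sur_nonneg) auto
  also have "s ^ r = s * s ^ (r - 1)" using r by (simp add: power_eq_if)
  also have "s ^ (r - 1) \<le> (S + 3) ^ (r - 1)"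
    using s by (intro power_mono) auto
  also have "(S + 3) ^ (r - 1) \<le> (S + 3) ^ r"
    using s by (intro power_increasing) auto
  also have "(S + 3) ^ r \<le> ell s ^ r * (S + 3) ^ r"
    using s mult_right_mono[OF one_le_power[OF ell_ge_1[of s], of r], of "(S + 3) ^ r"] by simp
  finally show ?thesis using s True by (simp add: moment_bd_def algebra_simps)
next
  case False
  have "moment_term ori r n s \<le> 2 * (s ^ n / fact n) * ((S + 3) * (real n + 1)\<^sup>2 * ell s) ^ r"
    unfolding moment_term_def
    using s mult_abs_bounds[of ori n] cpmf_nonneg[of s ori "int n"] cpmf_upper[of s ori "int n"]
      sur_nonneg[of s ori n] sur_bound[of s S ori n]
    by (intro mult_mono power_mono mult_nonneg_nonneg zero_le_power) auto
  also have "\<dots> = s * ell s ^ r * (2 * (S + 3) ^ r * ((real n + 1) ^ (2 * r) * s ^ (n - 1) / fact n))"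
    using False by (simp add: power_mult_distrib power_mult power_eq_if[of s n])
  also have "\<dots> \<le> s * ell s ^ r * (2 * (S + 3) ^ r * ((real n + 1) ^ (2 * r) * S ^ n / fact n))"
  proof -
    have "s ^ (n - 1) \<le> S ^ (n - 1)" using s by (intro power_mono) auto
    also have "\<dots> \<le> S ^ n" using s by (intro power_increasing) auto
    finally show ?thesis
      using s ell_ge_1[of s] by (intro mult_left_mono divide_right_mono mult_nonneg_nonneg) auto
  qed
  finally show ?thesis by (simp add: moment_bd_def)
qed

lemma moment_summable:
  assumes "s > 0" "r \<ge> 1"
  shows "summable (\<lambda>n. moment_term ori r n s)"
proof (rule summable_comparison_test)
  let ?S = "max 1 s"
  show "\<exists>N. \<forall>n\<ge>N. norm (moment_term ori r n s) \<le> s * ell s ^ r * moment_bd r ?S n"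
    using moment_term_bound[of s ?S r ori] moment_term_nonneg[of s ori r] assms by auto
  show "summable (\<lambda>n. s * ell s ^ r * moment_bd r ?S n)"
    by (intro summable_mult moment_bd_summable) auto
qed

definition moment_const :: "nat \<Rightarrow> real \<Rightarrow> real" where
  "moment_const r S = (\<Sum>n. moment_bd r S n)"

lemma moment_upper:
  assumes "0 < s" "s \<le> S" "1 \<le> S" "r \<ge> 1"
  shows "moment ori r s \<le> moment_const r S * s * ell s ^ r"
proof -
  have "moment ori r s \<le> (\<Sum>n. s * ell s ^ r * moment_bd r S n)"
    unfolding moment_def
    using assms by (intro suminf_le moment_term_bound moment_summable summable_mult moment_bd_summable) auto
  also have "\<dots> = s * ell s ^ r * moment_const r S"
    unfolding moment_const_def using assms by (intro suminf_mult moment_bd_summable) auto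
  finally show ?thesis by (simp add: mult_ac)
qed

lemma moment_nonneg: "s > 0 \<Longrightarrow> r \<ge> 1 \<Longrightarrow> moment ori r s \<ge> 0"
  unfolding moment_def by (intro suminf_nonneg moment_summable moment_term_nonneg) auto

lemma sur_tendsto: "(f \<longlongrightarrow> s) F \<Longrightarrow> s > 0 \<Longrightarrow> ((\<lambda>x. sur ori n (f x)) \<longlongrightarrow> sur ori n s) F"
  unfolding sur_def using cpmf_pos[of s ori n] by (intro tendsto_intros cpmf_tendsto) auto

text \<open>Dominated convergence for series. The domination is asked only on \<open>(0, S]\<close>,
  which is where the normalised terms are controlled.\<close>

lemma series_tendsto:
  fixes f :: "nat \<Rightarrow> real \<Rightarrow> real"
  assumes lim: "\<And>n. ((\<lambda>x. f n x) \<longlongrightarrow> g n) F" and F: "F \<noteq> bot"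
    and ev: "eventually (\<lambda>x. 0 < x \<and> x \<le> S) F"
    and bd: "\<And>n x. 0 < x \<Longrightarrow> x \<le> S \<Longrightarrow> \<bar>f n x\<bar> \<le> M n" and M: "summable M"
  shows "((\<lambda>x. \<Sum>n. f n x) \<longlongrightarrow> (\<Sum>n. g n)) F"
proof -
  have "eventually (\<lambda>(n, x). norm (f n x) \<le> M n) (at_top \<times>\<^sub>F F)"
    unfolding eventually_prod_filter
    using ev bd by (intro exI[of _ "\<lambda>_. True"] exI[of _ "\<lambda>x. 0 < x \<and> x \<le> S"]) auto
  from tannerys_theorem[OF lim this M F] show ?thesis by simp
qed

lemma moment_eq_ratio:
  assumes "s > 0" "r \<ge> 1"
  shows "(\<Sum>n. moment_term ori r n s / (s * ell s ^ r)) = moment ori r s / (s * ell s ^ r)"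
  unfolding moment_def using assms by (intro suminf_divide moment_summable)

lemma moment_ratio_bound:
  assumes "0 < s" "s \<le> S" "1 \<le> S" "r \<ge> 1"
  shows "\<bar>moment_term ori r n s / (s * ell s ^ r)\<bar> \<le> moment_bd r S n"
proof -
  have p: "s * ell s ^ r > 0" using assms ell_pos[of s] by simp
  have "moment_term ori r n s \<le> moment_bd r S n * (s * ell s ^ r)"
    using moment_term_bound[OF assms, of ori n] by (simp add: mult_ac)
  then have "moment_term ori r n s / (s * ell s ^ r) \<le> moment_bd r S n"
    using p by (subst pos_divide_le_eq) auto
  then show ?thesis using moment_term_nonneg[of s ori r n] assms p by simp
qed

text \<open>Dividing by \<open>s * ell s ^ r\<close> before the limit and multiplying back
  afterwards allows the same dominating sequence as at 0.\<close>

lemma moment_isCont: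
  assumes s: "s > 0" and r: "r \<ge> 1"
  shows "isCont (moment ori r) s"
proof -
  let ?S = "max 1 (2 * s)"
  have ev: "\<forall>\<^sub>F x in at s. 0 < x \<and> x < 2 * s"
    using s by (intro eventually_at_in_open'[of "{0 <..< 2 * s}" s, unfolded greaterThanLessThan_iff]) auto
  have "((\<lambda>x. \<Sum>n. moment_term ori r n x / (x * ell x ^ r)) \<longlongrightarrow> (\<Sum>n. moment_term ori r n s / (s * ell s ^ r))) (at s)"
  proof (rule series_tendsto[where S = ?S and M = "moment_bd r ?S"])
    show "((\<lambda>x. moment_term ori r n x / (x * ell x ^ r)) \<longlongrightarrow> moment_term ori r n s / (s * ell s ^ r)) (at s)" for n
      unfolding moment_term_def using s ell_pos[of s]
      by (intro tendsto_intros cpmf_tendsto sur_tendsto ell_tendsto) auto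
    show "\<forall>\<^sub>F x in at s. 0 < x \<and> x \<le> ?S"
      using ev by eventually_elim auto
    show "\<bar>moment_term ori r n x / (x * ell x ^ r)\<bar> \<le> moment_bd r ?S n" if "0 < x" "x \<le> ?S" for n x
      using that r by (intro moment_ratio_bound) auto
    show "summable (moment_bd r ?S)" by (intro moment_bd_summable) auto
  qed simp
  then have "((\<lambda>x. \<Sum>n. moment_term ori r n x / (x * ell x ^ r)) \<longlongrightarrow> moment ori r s / (s * ell s ^ r)) (at s)"
    using s r by (simp only: moment_eq_ratio)
  then have "((\<lambda>x. (\<Sum>n. moment_term ori r n x / (x * ell x ^ r)) * (x * ell x ^ r)) \<longlongrightarrow> moment ori r s / (s * ell s ^ r) * (s * ell s ^ r)) (at s)"
    using s by (intro tendsto_intros ell_tendsto)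
  also have "moment ori r s / (s * ell s ^ r) * (s * ell s ^ r) = moment ori r s"
    using s ell_pos[of s] by simp
  finally have 1: "((\<lambda>x. (\<Sum>n. moment_term ori r n x / (x * ell x ^ r)) * (x * ell x ^ r)) \<longlongrightarrow> moment ori r s) (at s)" .
  have "\<forall>\<^sub>F x in at s. (\<Sum>n. moment_term ori r n x / (x * ell x ^ r)) * (x * ell x ^ r) = moment ori r x"
    using ev
  proof eventually_elim
    case (elim x)
    then show ?case using r ell_pos[of x] by (simp add: moment_eq_ratio)
  qed
  from Lim_transform_eventually[OF 1 this] show ?thesis by (simp add: isCont_def)
qed

text \<open>To leading order \<open>n\<close> is reached by \<open>n\<close> jumps, each of which
  contributes \<open>- ln s\<close> to the surprisal; the bounds above and below differ by terms
  that are negligible against \<open>ell s\<close>.\<close>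

lemma sur_ratio_at_0: "((\<lambda>s. sur ori n s / ell s) \<longlongrightarrow> real n) (at_right 0)"
proof (rule tendsto_sandwich)
  have ev: "\<forall>\<^sub>F s in at_right 0. (s::real) > 0" by (simp add: eventually_at_right_less)
  show "\<forall>\<^sub>F s in at_right 0. (- real n * ln s + ln (fact n)) / ell s \<le> sur ori n s / ell s"
    using ev by eventually_elim (intro divide_right_mono sur_lower, auto simp: ell_pos less_imp_le)
  show "\<forall>\<^sub>F s in at_right 0. sur ori n s / ell s \<le> (s + real n * (ln 2 - ln s) + ln (fact n)) / ell s"
    using ev by eventually_elim (intro divide_right_mono sur_upper, auto simp: ell_pos less_imp_le)
  define c where "c = ln (fact n :: real)"
  have 1: "((\<lambda>s. - ln s / ell s) \<longlongrightarrow> 1) (at_right 0)" unfolding ell_def by real_asymp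
  have 2: "((\<lambda>s. 1 / ell s) \<longlongrightarrow> 0) (at_right 0)" unfolding ell_def by real_asymp
  have 3: "((\<lambda>s. s / ell s) \<longlongrightarrow> 0) (at_right 0)" unfolding ell_def by real_asymp
  have "((\<lambda>s. real n * (- ln s / ell s) + c * (1 / ell s)) \<longlongrightarrow> real n * 1 + c * 0) (at_right 0)"
    by (intro tendsto_intros 1 2)
  then show "((\<lambda>s. (- real n * ln s + ln (fact n)) / ell s) \<longlongrightarrow> real n) (at_right 0)"
    by (simp add: c_def add_divide_distrib diff_divide_distrib)
  have "((\<lambda>s. s / ell s + real n * (ln 2 * (1 / ell s) + (- ln s / ell s)) + c * (1 / ell s)) \<longlongrightarrow> 0 + real n * (ln 2 * 0 + 1) + c * 0) (at_right 0)"
    by (intro tendsto_intros 1 2 3)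
  moreover have "s / ell s + real n * (ln 2 * (1 / ell s) + (- ln s / ell s)) + c * (1 / ell s)
      = (s + real n * (ln 2 - ln s) + ln (fact n)) / ell s" for s
    by (simp add: c_def add_divide_distrib diff_divide_distrib algebra_simps)
  ultimately show "((\<lambda>s. (s + real n * (ln 2 - ln s) + ln (fact n)) / ell s) \<longlongrightarrow> real n) (at_right 0)"
    by simp
qed

lemma mult_jp: "mult_abs ori 1 * jp ori 1 = 1"
  by (cases ori) (auto simp: mult_abs_def jp_simps)

lemma cpmf'_zero: "n \<ge> 1 \<Longrightarrow> cpmf' ori (int n) 0 = (if n = 1 then jp ori 1 else 0)"
  by (auto simp: cpmf'_def cpmf_zero)

text \<open>The quotient tends to the derivative at 0, which the forward equation supplies. Only
  distance 1 is reached at first order in \<open>s\<close>.\<close>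

lemma cpmf_ratio_at_0:
  assumes "n \<ge> 1"
  shows "((\<lambda>s. cpmf ori (int n) s / s) \<longlongrightarrow> (if n = 1 then jp ori 1 else 0)) (at_right 0)"
proof -
  have "((\<lambda>s. (cpmf ori (int n) s - cpmf ori (int n) 0) / (s - 0)) \<longlongrightarrow> cpmf' ori (int n) 0) (at 0)"
    using cpmf_deriv[of ori "int n" 0] by (simp add: has_field_derivative_iff)
  then have "((\<lambda>s. cpmf ori (int n) s / s) \<longlongrightarrow> cpmf' ori (int n) 0) (at 0)"
    using assms by (simp add: cpmf_zero)
  then have "((\<lambda>s. cpmf ori (int n) s / s) \<longlongrightarrow> cpmf' ori (int n) 0) (at_right 0)"
    by (simp only: filterlim_at_split)
  then show ?thesis by (simp only: cpmf'_zero[OF assms])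
qed

lemma at_right_0_le: "(b::real) > 0 \<Longrightarrow> \<forall>\<^sub>F s in at_right 0. 0 < s \<and> s \<le> b"
  using eventually_at_right_less[of 0] eventually_at_right_real[of 0 b]
  by (auto elim!: eventually_elim2)

text \<open>Only \<open>n = 1\<close> survives: it has probability about \<open>s\<close> and
  surprisal about \<open>ell s\<close>. For \<open>n = 0\<close> the surprisal is at most
  \<open>s\<close>, and for \<open>n \<ge> 2\<close> the probability is of smaller order than
  \<open>s\<close>.\<close>

lemma moment_ratio_at_0:
  assumes r: "r \<ge> 1"
  shows "((\<lambda>s. moment ori r s / (s * ell s ^ r)) \<longlongrightarrow> 1) (at_right 0)"
proof -
  have "((\<lambda>x. \<Sum>n. moment_term ori r n x / (x * ell x ^ r)) \<longlongrightarrow> (\<Sum>n. if n = 1 then 1 else (0::real))) (at_right 0)"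
  proof (rule series_tendsto[where S = 1 and M = "moment_bd r 1"])
    fix n
    show "((\<lambda>x. moment_term ori r n x / (x * ell x ^ r)) \<longlongrightarrow> (if n = 1 then 1 else 0)) (at_right 0)"
    proof (cases "n = 0")
      case False
      have "((\<lambda>x. mult_abs ori n * (cpmf ori (int n) x / x) * (sur ori n x / ell x) ^ r) \<longlongrightarrow>
          mult_abs ori n * (if n = 1 then jp ori 1 else 0) * real n ^ r) (at_right 0)"
        using False by (intro tendsto_intros cpmf_ratio_at_0 sur_ratio_at_0) auto
      also have "mult_abs ori n * (if n = 1 then jp ori 1 else 0) * real n ^ r = (if n = 1 then 1 else 0)"
        using mult_jp[of ori] by auto
      finally show ?thesis by (simp add: moment_term_def power_divide)
    next
      case True
      have b: "\<forall>\<^sub>F x in at_right 0. norm (moment_term ori r n x / (x * ell x ^ r)) \<le> 1 / ell x"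
        using at_right_0_le[OF zero_less_one]
      proof eventually_elim
        case (elim x)
        have l: "ell x \<ge> 1" using elim ell_ge_1 by auto
        have "moment_term ori r n x \<le> 1 * 1 * x ^ r"
          unfolding moment_term_def True using elim cpmf_nonneg[of x ori 0] cpmf_le_1[of x ori 0] sur_0_le[of x ori] sur_nonneg[of x ori 0]
          by (intro mult_mono power_mono) (auto simp: mult_abs_def)
        also have "\<dots> = x * x ^ (r - 1)" using r by (simp add: power_eq_if)
        also have "\<dots> \<le> x * ell x ^ (r - 1)"
          using elim l by (intro mult_left_mono power_mono) auto
        also have "\<dots> = (x * ell x ^ r) / ell x" using r l by (simp add: power_eq_if)
        finally have "moment_term ori r n x / (x * ell x ^ r) \<le> 1 / ell x"
          using elim l by (simp add: divide_simps)
        then show ?case using moment_term_nonneg[of x ori r n] elim l by simp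
      qed
      have "((\<lambda>s. 1 / ell s) \<longlongrightarrow> 0) (at_right 0)" unfolding ell_def by real_asymp
      from Lim_null_comparison[OF b this] show ?thesis by (simp add: True)
    qed
    show "\<forall>\<^sub>F x in at_right 0. 0 < x \<and> x \<le> (1::real)" by (rule at_right_0_le) simp
    show "\<bar>moment_term ori r n x / (x * ell x ^ r)\<bar> \<le> moment_bd r 1 n" if "0 < x" "x \<le> 1" for n x
      using that r by (intro moment_ratio_bound) auto
    show "summable (moment_bd r 1)" by (intro moment_bd_summable) auto
  qed simp
  also have "(\<Sum>n. if n = 1 then 1 else (0::real)) = 1"
    using sums_single[of 1 "\<lambda>_. 1::real"] by (simp add: sums_iff)
  finally have 1: "((\<lambda>x. \<Sum>n. moment_term ori r n x / (x * ell x ^ r)) \<longlongrightarrow> 1) (at_right 0)" .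
  have "\<forall>\<^sub>F x in at_right 0. (\<Sum>n. moment_term ori r n x / (x * ell x ^ r)) = moment ori r x / (x * ell x ^ r)"
    using eventually_at_right_less[of 0] by eventually_elim (use r moment_eq_ratio in auto)
  from Lim_transform_eventually[OF 1 this] show ?thesis .
qed

text \<open>Allows for the shift of the index by one that the neighbours in the forward equation and
  in the flux cause.\<close>

lemma power_fact_step:
  fixes S :: real
  assumes "0 \<le> s" "s \<le> S" "1 \<le> S" "m \<le> n + 1" "n \<le> m + 1"
  shows "s ^ m / fact m \<le> S * ((real n + 1) * S ^ n / fact n)"
proof -
  have "s ^ m \<le> S ^ m" using assms by (intro power_mono) auto
  also have "\<dots> \<le> S ^ (n + 1)" using assms by (intro power_increasing) auto
  finally have 1: "s ^ m \<le> S * S ^ n" by simp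
  have "fact n \<le> (real n + 1) * fact m"
  proof (cases "n \<le> m")
    case True
    then have "fact n \<le> (fact m :: real)" by (rule fact_mono)
    also have "\<dots> = 1 * fact m" by simp
    also have "\<dots> \<le> (real n + 1) * fact m" by (intro mult_right_mono) auto
    finally show ?thesis .
  next
    case False
    then have "n = Suc m" using assms by simp
    then show ?thesis by (simp add: algebra_simps)
  qed
  then have "1 / fact m \<le> (real n + 1) / fact n" by (simp add: field_simps)
  with 1 have "s ^ m * (1 / fact m) \<le> S * S ^ n * ((real n + 1) / fact n)"
    using assms by (intro mult_mono) auto
  then show ?thesis by (simp add: mult_ac)
qed

lemma cpmf_neighbour_bound:
  assumes "0 \<le> s" "s \<le> S" "1 \<le> S" "\<bar>x - int n\<bar> \<le> 1"
  shows "cpmf ori x s \<le> S * ((real n + 1) * S ^ n / fact n)"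
proof -
  have "cpmf ori x s \<le> s ^ nat \<bar>x\<bar> / fact (nat \<bar>x\<bar>)" using assms by (intro cpmf_upper)
  also have "\<dots> \<le> S * ((real n + 1) * S ^ n / fact n)"
    using assms by (intro power_fact_step) auto
  finally show ?thesis .
qed

lemma cpmf'_bound:
  assumes "0 \<le> s" "s \<le> S" "1 \<le> S"
  shows "\<bar>cpmf' ori (int n) s\<bar> \<le> S * ((real n + 1) * S ^ n / fact n)" (is "_ \<le> ?B")
proof -
  have b: "0 \<le> cpmf ori x s" "cpmf ori x s \<le> ?B" if "\<bar>x - int n\<bar> \<le> 1" for x
    using cpmf_neighbour_bound[OF assms that] cpmf_nonneg assms by auto
  have "jp ori 1 * cpmf ori (int n - 1) s + jp ori (-1) * cpmf ori (int n + 1) s \<le> jp ori 1 * ?B + jp ori (-1) * ?B"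
    using b by (intro add_mono mult_left_mono) auto
  also have "\<dots> = ?B" using jp_sum[of ori] by (metis distrib_right mult_1)
  finally have "jp ori 1 * cpmf ori (int n - 1) s + jp ori (-1) * cpmf ori (int n + 1) s \<le> ?B" .
  moreover have "0 \<le> jp ori 1 * cpmf ori (int n - 1) s + jp ori (-1) * cpmf ori (int n + 1) s"
    using b by (intro add_nonneg_nonneg mult_nonneg_nonneg) auto
  ultimately show ?thesis using b[of "int n"] unfolding cpmf'_def by (simp add: abs_le_iff)
qed

section \<open>The entropy as a function of time\<close>

text \<open>The derivative of an entropy term without the part coming from the derivative of the
  logarithm. That part is the derivative of a probability and sums to 0.\<close>

definition rate_term :: "orientation \<Rightarrow> nat \<Rightarrow> real \<Rightarrow> real" where
  "rate_term ori n s = mult_abs ori n * cpmf' ori (int n) s * sur ori n s"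

definition entropy_rate :: "orientation \<Rightarrow> real \<Rightarrow> real" where
  "entropy_rate ori s = (\<Sum>n. rate_term ori n s)"

definition rate_bd :: "real \<Rightarrow> nat \<Rightarrow> real" where
  "rate_bd S n = 2 * S * (S + 3) * ((real n + 1) ^ 3 * S ^ n / fact n)"

lemma rate_bd_summable: "S \<ge> 0 \<Longrightarrow> summable (rate_bd S)"
  unfolding rate_bd_def[abs_def] by (intro summable_mult poly_fact_summable)

lemma rate_term_bound_aux:
  assumes s: "0 < s" "s \<le> S" "1 \<le> S" and a: "\<bar>a\<bar> \<le> 2 * (S * ((real n + 1) * S ^ n / fact n))"
  shows "\<bar>a * sur ori n s\<bar> \<le> ell s * rate_bd S n"
proof -
  have "\<bar>a * sur ori n s\<bar> \<le> (2 * (S * ((real n + 1) * S ^ n / fact n))) * ((S + 3) * (real n + 1)\<^sup>2 * ell s)"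
    unfolding abs_mult using s a sur_bound[of s S ori n] sur_nonneg[of s ori n]
    by (intro mult_mono) auto
  also have "\<dots> = ell s * rate_bd S n"
    by (simp add: rate_bd_def power2_eq_square power3_eq_cube)
  finally show ?thesis .
qed

lemma rate_term_bound:
  assumes s: "0 < s" "s \<le> S" "1 \<le> S"
  shows "\<bar>rate_term ori n s\<bar> \<le> ell s * rate_bd S n"
  unfolding rate_term_def
proof (rule rate_term_bound_aux[OF s])
  show "\<bar>mult_abs ori n * cpmf' ori (int n) s\<bar> \<le> 2 * (S * ((real n + 1) * S ^ n / fact n))"
    unfolding abs_mult using cpmf'_bound[of s S ori n] s mult_abs_bounds[of ori n] by (intro mult_mono) auto
qed

lemma rate_summable:
  assumes "s > 0"
  shows "summable (\<lambda>n. rate_term ori n s)"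
proof (rule summable_comparison_test)
  show "\<exists>N. \<forall>n\<ge>N. norm (rate_term ori n s) \<le> ell s * rate_bd (max 1 s) n"
    using rate_term_bound[of s "max 1 s" ori] assms by auto
  show "summable (\<lambda>n. ell s * rate_bd (max 1 s) n)"
    by (intro summable_mult rate_bd_summable) auto
qed

text \<open>The probability flux from absolute value \<open>n\<close> to \<open>n + 1\<close>.\<close>

definition flux :: "orientation \<Rightarrow> nat \<Rightarrow> real \<Rightarrow> real" where
  "flux ori n s = cpmf ori (int n) s - (if ori = Directed then 0 else cpmf ori (int n + 1) s)"

lemma flux_0: "mult_abs ori 0 * cpmf' ori 0 s = - flux ori 0 s"
  using cpmf_undirected_sym[of 1 s] cpmf_directed_neg[of "-1" s]
  by (cases ori) (auto simp: mult_abs_def cpmf'_def flux_def jp_simps)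

lemma flux_Suc: "mult_abs ori (Suc n) * cpmf' ori (int (Suc n)) s = flux ori n s - flux ori (Suc n) s"
  by (cases ori) (auto simp: mult_abs_def cpmf'_def flux_def jp_simps algebra_simps)

lemma flux_sum: "(\<Sum>n<Suc N. mult_abs ori n * cpmf' ori (int n) s) = - flux ori N s"
proof (induction N)
  case (Suc N)
  then show ?case using flux_Suc[of ori N s] by simp
qed (simp add: flux_0)

lemma flux_bound:
  assumes "0 < s" "s \<le> S" "1 \<le> S"
  shows "\<bar>flux ori n s\<bar> \<le> 2 * (S * ((real n + 1) * S ^ n / fact n))"
proof -
  define B where "B = S * ((real n + 1) * S ^ n / fact n)"
  have "0 \<le> cpmf ori x s" "cpmf ori x s \<le> B" if "\<bar>x - int n\<bar> \<le> 1" for x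
    unfolding B_def using assms cpmf_neighbour_bound[OF _ _ _ that, of s S ori] by (auto intro!: cpmf_nonneg simp del: times_divide_eq_right)
  from this[of "int n"] this[of "int n + 1"] show ?thesis
    unfolding B_def[symmetric] by (auto simp: flux_def abs_le_iff)
qed

lemma flux_tendsto_0:
  assumes "s > 0"
  shows "(\<lambda>n. flux ori n s) \<longlonglongrightarrow> 0" "(\<lambda>n. flux ori n s * sur ori n s) \<longlonglongrightarrow> 0"
proof -
  let ?S = "max 1 s"
  have "(\<lambda>n. (real n + 1) ^ 1 * ?S ^ n / fact n) \<longlonglongrightarrow> 0"
    by (intro summable_LIMSEQ_zero poly_fact_summable) auto
  then have l: "(\<lambda>n. 2 * (?S * ((real n + 1) * ?S ^ n / fact n))) \<longlonglongrightarrow> 0"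
    by (intro tendsto_mult_right_zero) simp
  show "(\<lambda>n. flux ori n s) \<longlonglongrightarrow> 0"
    by (rule Lim_null_comparison[OF _ l]) (use flux_bound[of s ?S ori] assms in auto)
  have l: "(\<lambda>n. ell s * rate_bd ?S n) \<longlonglongrightarrow> 0"
    by (intro tendsto_mult_right_zero summable_LIMSEQ_zero rate_bd_summable) auto
  show "(\<lambda>n. flux ori n s * sur ori n s) \<longlonglongrightarrow> 0"
  proof (rule Lim_null_comparison[OF _ l], rule always_eventually, rule allI)
    fix n show "norm (flux ori n s * sur ori n s) \<le> ell s * rate_bd ?S n"
      unfolding real_norm_def using assms by (intro rate_term_bound_aux flux_bound) auto
  qed
qed

text \<open>Conservation of mass: the partial sums telescope to minus the flux through the boundary,
  which vanishes at infinity.\<close>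

lemma cpmf'_sums: "s > 0 \<Longrightarrow> (\<lambda>n. mult_abs ori n * cpmf' ori (int n) s) sums 0"
  unfolding sums_def
  by (subst filterlim_sequentially_Suc[symmetric], simp only: flux_sum)
     (use tendsto_minus[OF flux_tendsto_0(1)] in simp)

text \<open>Termwise differentiation by the Weierstrass test. The interval stays away from 0, so
  that \<open>ell\<close> is bounded there by \<open>ell (s / 2)\<close>.\<close>

lemma entropy_deriv:
  assumes s: "s > 0"
  shows "(moment ori 1 has_field_derivative entropy_rate ori s) (at s)"
proof -
  let ?I = "{s / 2 .. 2 * s}" and ?S = "max 1 (2 * s)"
  let ?f' = "\<lambda>n x. rate_term ori n x - mult_abs ori n * cpmf' ori (int n) x"
  let ?M = "\<lambda>n. ell (s / 2) * rate_bd ?S n + 2 * (?S * ((real n + 1) ^ 1 * ?S ^ n / fact n))"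
  have sumM: "summable ?M"
    by (intro summable_add summable_mult rate_bd_summable poly_fact_summable) auto
  have d: "((\<lambda>x. moment_term ori 1 n x) has_field_derivative ?f' n x) (at x within ?I)" if "x \<in> ?I" for n x
  proof -
    have x: "x > 0" using that s by auto
    have "((\<lambda>x. mult_abs ori n * (cpmf ori (int n) x * - ln (cpmf ori (int n) x))) has_field_derivative
       mult_abs ori n * (cpmf' ori (int n) x * - ln (cpmf ori (int n) x) + (- (1 / cpmf ori (int n) x * cpmf' ori (int n) x)) * cpmf ori (int n) x)) (at x)"
      by (intro DERIV_cmult DERIV_mult DERIV_minus DERIV_chain2[OF DERIV_ln_divide] cpmf_deriv cpmf_pos x)
    also have "mult_abs ori n * (cpmf' ori (int n) x * - ln (cpmf ori (int n) x) + (- (1 / cpmf ori (int n) x * cpmf' ori (int n) x)) * cpmf ori (int n) x) = ?f' n x"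
      using cpmf_pos[OF x, of ori n] by (simp add: rate_term_def sur_def algebra_simps)
    finally show ?thesis
      unfolding moment_term_def sur_def by (simp add: mult_ac has_field_derivative_at_within)
  qed
  have b: "norm (?f' n x) \<le> ?M n" if "x \<in> ?I" for n x
  proof -
    have x: "0 < x" "x \<le> ?S" "s / 2 \<le> x" using that s by auto
    have "\<bar>rate_term ori n x\<bar> \<le> ell x * rate_bd ?S n" using x by (intro rate_term_bound) auto
    also have "\<dots> \<le> ell (s / 2) * rate_bd ?S n"
      using x s by (intro mult_right_mono ell_antimono) (auto simp: rate_bd_def)
    finally have 1: "\<bar>rate_term ori n x\<bar> \<le> ell (s / 2) * rate_bd ?S n" .
    have "\<bar>mult_abs ori n * cpmf' ori (int n) x\<bar> \<le> 2 * (?S * ((real n + 1) * ?S ^ n / fact n))"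
      unfolding abs_mult using cpmf'_bound[of x ?S ori n] x mult_abs_bounds[of ori n] by (intro mult_mono) auto
    then have "\<bar>mult_abs ori n * cpmf' ori (int n) x\<bar> \<le> 2 * (?S * ((real n + 1) ^ 1 * ?S ^ n / fact n))" by simp
    with 1 show ?thesis unfolding real_norm_def by linarith
  qed
  have u: "uniformly_convergent_on ?I (\<lambda>n x. \<Sum>i<n. ?f' i x)"
    by (rule Weierstrass_m_test'[OF b sumM])
  have "((\<lambda>x. \<Sum>n. moment_term ori 1 n x) has_field_derivative (\<Sum>n. ?f' n s)) (at s)"
    by (rule has_field_derivative_series'(2)[OF _ d u, of s]) (use s moment_summable in auto)
  also have "(\<Sum>n. ?f' n s) = entropy_rate ori s - 0"
    unfolding entropy_rate_def
    using sums_diff[OF summable_sums[OF rate_summable[OF s]] cpmf'_sums[OF s, of ori]] by (simp add: sums_iff)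
  finally show ?thesis by (simp add: moment_def[abs_def])
qed

text \<open>The pointwise form of the bound of relative entropy from below by the squared Hellinger
  distance: \<open>ln x \<le> x - 1\<close> at \<open>x = sqrt b / sqrt a\<close>.\<close>

lemma entropy_ineq:
  fixes a b :: real
  assumes "a > 0" "b > 0"
  shows "(sqrt a - sqrt b)\<^sup>2 \<le> a * (ln a - ln b) - a + b"
proof -
  have "ln (sqrt b / sqrt a) \<le> sqrt b / sqrt a - 1" using assms by (intro ln_le_minus_one) simp
  also have "ln (sqrt b / sqrt a) = (ln b - ln a) / 2" using assms by (simp add: ln_div ln_sqrt diff_divide_distrib)
  finally have "a * ((ln b - ln a) / 2) \<le> a * (sqrt b / sqrt a - 1)" using assms by (intro mult_left_mono) auto
  also have "\<dots> = sqrt a * sqrt b - a"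
  proof -
    have "a / sqrt a = sqrt a" using assms by (simp add: real_div_sqrt)
    then show ?thesis by (simp add: right_diff_distrib) (metis mult.commute times_divide_eq_right)
  qed
  finally have "a * (ln a - ln b) \<ge> 2 * a - 2 * sqrt a * sqrt b" by (simp add: field_simps)
  then show ?thesis using assms by (simp add: power2_diff)
qed

text \<open>In the undirected case the inequalities for both orders of the two masses are added and
  their linear terms cancel. In the directed case the linear terms stay, in a form that
  telescopes.\<close>

lemma flux_term_ge:
  assumes "s > 0"
  shows "(sqrt (cpmf ori (int n) s) - sqrt (cpmf ori (int (Suc n)) s))\<^sup>2 \<le> flux ori n s * (sur ori (Suc n) s - sur ori n s)
           + (if ori = Directed then cpmf ori (int (Suc n)) s - cpmf ori (int n) s else 0)"
proof -
  let ?a = "cpmf ori (int n) s" and ?b = "cpmf ori (int (Suc n)) s"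
  have p: "?a > 0" "?b > 0" using assms cpmf_pos by blast+
  note 1 = entropy_ineq[OF p] and 2 = entropy_ineq[OF p(2,1)]
  show ?thesis
  proof (cases ori)
    case Directed
    then show ?thesis using 1 by (simp add: flux_def sur_def)
  next
    case Undirected
    have "0 \<le> (sqrt ?b - sqrt ?a)\<^sup>2" by simp
    with 2 have "0 \<le> ?b * (ln ?b - ln ?a) - ?b + ?a" by linarith
    with 1 have "(sqrt ?a - sqrt ?b)\<^sup>2 \<le> ?a * (ln ?a - ln ?b) + ?b * (ln ?b - ln ?a)" by linarith
    also have "\<dots> = flux ori n s * (sur ori (Suc n) s - sur ori n s)"
      using Undirected by (simp add: flux_def sur_def algebra_simps)
    finally show ?thesis using Undirected by simp
  qed
qed

text \<open>Summation by parts: the entropy rate becomes a sum of fluxes times increments of the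
  surprisal, and those products have a lower bound.\<close>

lemma rate_partial_sum:
  "(\<Sum>n<Suc N. rate_term ori n s) = (\<Sum>n<N. flux ori n s * (sur ori (Suc n) s - sur ori n s)) - flux ori N s * sur ori N s"
proof (induction N)
  case 0
  then show ?case using flux_0[of ori s] by (simp add: rate_term_def)
next
  case (Suc N)
  have "rate_term ori (Suc N) s = (flux ori N s - flux ori (Suc N) s) * sur ori (Suc N) s"
    unfolding rate_term_def flux_Suc ..
  with Suc show ?case by (simp add: algebra_simps)
qed

lemma cpmf_tendsto_0: "s \<ge> 0 \<Longrightarrow> (\<lambda>N. cpmf ori (int N) s) \<longlonglongrightarrow> 0"
proof (rule Lim_null_comparison)
  assume s: "s \<ge> 0"
  show "\<forall>\<^sub>F N in sequentially. norm (cpmf ori (int N) s) \<le> s ^ N / fact N"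
    using cpmf_upper[OF s, of ori "int _"] cpmf_nonneg[OF s] by (intro always_eventually) simp
  show "(\<lambda>n. s ^ n / fact n) \<longlonglongrightarrow> 0"
    using summable_LIMSEQ_zero[OF summable_exp[of s]] by (simp add: divide_inverse mult.commute)
qed

text \<open>Entropy production bounds the squared increments of the square roots of the masses. This
  yields that the entropy is strictly increasing, and in quantitative form that it is
  unbounded.\<close>

lemma entropy_rate_ge:
  assumes s: "s > 0"
  shows "(sqrt (cpmf ori (int i) s) - sqrt (cpmf ori (int (Suc i)) s))\<^sup>2 \<le> entropy_rate ori s"
proof (rule LIMSEQ_le_const)
  have "(\<lambda>N. \<Sum>n<Suc N. rate_term ori n s) \<longlonglongrightarrow> entropy_rate ori s"
    unfolding entropy_rate_def
    by (subst filterlim_sequentially_Suc) (rule summable_LIMSEQ[OF rate_summable[OF s]])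
  moreover have "(\<lambda>N. cpmf ori (int N) s) \<longlonglongrightarrow> 0"
    using cpmf_tendsto_0[of s ori] s by simp
  ultimately have "(\<lambda>N. (\<Sum>n<Suc N. rate_term ori n s) + cpmf ori (int N) s + flux ori N s * sur ori N s) \<longlonglongrightarrow> entropy_rate ori s + 0 + 0"
    using flux_tendsto_0(2)[OF s] by (intro tendsto_add) auto
  then show "(\<lambda>N. (\<Sum>n<Suc N. rate_term ori n s) + cpmf ori (int N) s + flux ori N s * sur ori N s) \<longlonglongrightarrow> entropy_rate ori s" by simp
  let ?g = "\<lambda>n. (sqrt (cpmf ori (int n) s) - sqrt (cpmf ori (int (Suc n)) s))\<^sup>2"
  let ?d = "\<lambda>n. if ori = Directed then cpmf ori (int (Suc n)) s - cpmf ori (int n) s else 0"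
  have "?g i \<le> (\<Sum>n<Suc N. rate_term ori n s) + cpmf ori (int N) s + flux ori N s * sur ori N s" if "i < N" for N
  proof -
    have "?g i \<le> (\<Sum>n<N. ?g n)" using that by (intro member_le_sum) auto
    also have "\<dots> \<le> (\<Sum>n<N. flux ori n s * (sur ori (Suc n) s - sur ori n s) + ?d n)"
      by (intro sum_mono flux_term_ge s)
    also have "\<dots> = (\<Sum>n<Suc N. rate_term ori n s) + flux ori N s * sur ori N s + (\<Sum>n<N. ?d n)"
      by (simp only: sum.distrib rate_partial_sum)
    \<comment> \<open>In the directed case the linear terms telescope to the last mass minus the
      first.\<close>
    also have "(\<Sum>n<N. ?d n) \<le> cpmf ori (int N) s"
    proof (cases "ori = Directed")
      case True
      then show ?thesis using sum_lessThan_telescope[of "\<lambda>n. cpmf ori (int n) s" N] cpmf_nonneg[of s ori 0] s by simp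
    qed (use cpmf_nonneg[of s ori "int N"] s in simp)
    finally show ?thesis by simp
  qed
  then show "\<exists>N. \<forall>n\<ge>N. ?g i \<le> (\<Sum>n<Suc n. rate_term ori n s) + cpmf ori (int n) s + flux ori n s * sur ori n s"
    by (intro exI[of _ "Suc i"]) auto
qed

lemma cpmf_not_const:
  assumes "s > 0"
  shows "\<exists>i. cpmf ori (int i) s \<noteq> cpmf ori (int (Suc i)) s"
proof (rule ccontr)
  assume "\<not> ?thesis"
  then have "cpmf ori (int i) s = cpmf ori (int 0) s" for i by (induction i) auto
  then have "(\<lambda>N. cpmf ori (int N) s) = (\<lambda>N. cpmf ori (int 0) s)" by (intro ext)
  with cpmf_tendsto_0[of s ori] assms have "(\<lambda>N::nat. cpmf ori (int 0) s) \<longlonglongrightarrow> 0" by simp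
  then have "cpmf ori (int 0) s = 0" by (simp only: LIMSEQ_const_iff)
  with cpmf_pos[OF assms, of ori 0] show False by simp
qed

lemma entropy_rate_pos:
  assumes "s > 0"
  shows "entropy_rate ori s > 0"
proof -
  obtain i where i: "cpmf ori (int i) s \<noteq> cpmf ori (int (Suc i)) s" using cpmf_not_const[OF assms] by blast
  have "0 < (sqrt (cpmf ori (int i) s) - sqrt (cpmf ori (int (Suc i)) s))\<^sup>2" using i by simp
  also have "\<dots> \<le> entropy_rate ori s" by (rule entropy_rate_ge[OF assms])
  finally show ?thesis .
qed

lemma rate_ratio_bound:
  assumes "0 < s" "s \<le> S" "1 \<le> S"
  shows "\<bar>rate_term ori n s / ell s\<bar> \<le> rate_bd S n"
proof -
  have "\<bar>rate_term ori n s\<bar> \<le> rate_bd S n * ell s"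
    using rate_term_bound[OF assms, of ori n] by (simp add: mult.commute)
  then have "\<bar>rate_term ori n s\<bar> / ell s \<le> rate_bd S n"
    using ell_pos[OF assms(1)] by (subst pos_divide_le_eq) auto
  then show ?thesis using ell_pos[OF assms(1)] by simp
qed

lemma rate_eq_ratio: "s > 0 \<Longrightarrow> (\<Sum>n. rate_term ori n s / ell s) = entropy_rate ori s / ell s"
  unfolding entropy_rate_def by (intro suminf_divide rate_summable)

lemma cpmf'_tendsto: "(f \<longlongrightarrow> s) F \<Longrightarrow> ((\<lambda>t. cpmf' ori x (f t)) \<longlongrightarrow> cpmf' ori x s) F"
  unfolding cpmf'_def by (intro tendsto_intros cpmf_tendsto)

lemma entropy_rate_isCont:
  assumes s: "s > 0"
  shows "isCont (entropy_rate ori) s"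
proof -
  let ?S = "max 1 (2 * s)"
  have ev: "\<forall>\<^sub>F x in at s. 0 < x \<and> x < 2 * s"
    using s by (intro eventually_at_in_open'[of "{0 <..< 2 * s}" s, unfolded greaterThanLessThan_iff]) auto
  have "((\<lambda>x. \<Sum>n. rate_term ori n x / ell x) \<longlongrightarrow> (\<Sum>n. rate_term ori n s / ell s)) (at s)"
  proof (rule series_tendsto[where S = ?S and M = "rate_bd ?S"])
    show "((\<lambda>x. rate_term ori n x / ell x) \<longlongrightarrow> rate_term ori n s / ell s) (at s)" for n
      unfolding rate_term_def using s ell_pos[of s]
      by (intro tendsto_intros cpmf'_tendsto sur_tendsto ell_tendsto) auto
    show "\<forall>\<^sub>F x in at s. 0 < x \<and> x \<le> ?S"
      using ev by eventually_elim auto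
    show "\<bar>rate_term ori n x / ell x\<bar> \<le> rate_bd ?S n" if "0 < x" "x \<le> ?S" for n x
      using that by (intro rate_ratio_bound) auto
    show "summable (rate_bd ?S)" by (intro rate_bd_summable) auto
  qed simp
  then have "((\<lambda>x. \<Sum>n. rate_term ori n x / ell x) \<longlongrightarrow> entropy_rate ori s / ell s) (at s)"
    using s by (simp only: rate_eq_ratio)
  then have "((\<lambda>x. (\<Sum>n. rate_term ori n x / ell x) * ell x) \<longlongrightarrow> entropy_rate ori s / ell s * ell s) (at s)"
    using s by (intro tendsto_intros ell_tendsto)
  also have "entropy_rate ori s / ell s * ell s = entropy_rate ori s"
    using s ell_pos[of s] by simp
  finally have 1: "((\<lambda>x. (\<Sum>n. rate_term ori n x / ell x) * ell x) \<longlongrightarrow> entropy_rate ori s) (at s)" .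
  have "\<forall>\<^sub>F x in at s. (\<Sum>n. rate_term ori n x / ell x) * ell x = entropy_rate ori x"
    using ev
  proof eventually_elim
    case (elim x)
    then show ?case using ell_pos[of x] by (simp add: rate_eq_ratio)
  qed
  from Lim_transform_eventually[OF 1 this] show ?thesis by (simp add: isCont_def)
qed

lemma entropy_rate_ratio_at_0: "((\<lambda>s. entropy_rate ori s / ell s) \<longlongrightarrow> 1) (at_right 0)"
proof -
  have "((\<lambda>x. \<Sum>n. rate_term ori n x / ell x) \<longlongrightarrow> (\<Sum>n. if n = 1 then 1 else (0::real))) (at_right 0)"
  proof (rule series_tendsto[where S = 1 and M = "rate_bd 1"])
    fix n
    have "((\<lambda>x. mult_abs ori n * cpmf' ori (int n) x * (sur ori n x / ell x)) \<longlongrightarrow>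
        mult_abs ori n * cpmf' ori (int n) 0 * real n) (at_right 0)"
      by (intro tendsto_intros cpmf'_tendsto sur_ratio_at_0 tendsto_ident_at)
    also have "mult_abs ori n * cpmf' ori (int n) 0 * real n = (if n = 1 then 1 else 0)"
      using mult_jp[of ori] cpmf'_zero[of n ori] by (cases "n = 0") auto
    finally show "((\<lambda>x. rate_term ori n x / ell x) \<longlongrightarrow> (if n = 1 then 1 else 0)) (at_right 0)"
      by (simp add: rate_term_def)
    show "\<forall>\<^sub>F x in at_right 0. 0 < x \<and> x \<le> (1::real)" by (rule at_right_0_le) simp
    show "\<bar>rate_term ori n x / ell x\<bar> \<le> rate_bd 1 n" if "0 < x" "x \<le> 1" for n x
      using that by (intro rate_ratio_bound) auto
    show "summable (rate_bd 1)" by (intro rate_bd_summable) auto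
  qed simp
  also have "(\<Sum>n. if n = 1 then 1 else (0::real)) = 1"
    using sums_single[of 1 "\<lambda>_. 1::real"] by (simp add: sums_iff)
  finally have 1: "((\<lambda>x. \<Sum>n. rate_term ori n x / ell x) \<longlongrightarrow> 1) (at_right 0)" .
  have "\<forall>\<^sub>F x in at_right 0. (\<Sum>n. rate_term ori n x / ell x) = entropy_rate ori x / ell x"
    using eventually_at_right_less[of 0] by eventually_elim (use rate_eq_ratio in auto)
  from Lim_transform_eventually[OF 1 this] show ?thesis .
qed

section \<open>Variance and third moment of the surprisal\<close>

abbreviation entropy :: "orientation \<Rightarrow> real \<Rightarrow> real" where "entropy ori \<equiv> moment ori 1"

definition sur_var :: "orientation \<Rightarrow> real \<Rightarrow> real" where
  "sur_var ori s = moment ori 2 s - (entropy ori s)\<^sup>2"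

lemma sur_var_sums:
  assumes s: "s > 0"
  shows "(\<lambda>n. mult_abs ori n * cpmf ori (int n) s * (sur ori n s - entropy ori s)\<^sup>2) sums sur_var ori s"
proof -
  let ?h = "entropy ori s"
  have "(\<lambda>n. moment_term ori 2 n s - 2 * ?h * moment_term ori 1 n s + ?h\<^sup>2 * (mult_abs ori n * cpmf ori (int n) s))
      sums (moment ori 2 s - 2 * ?h * ?h + ?h\<^sup>2 * 1)"
    using s unfolding moment_def[of ori 2] moment_def[of ori 1]
    by (intro sums_add sums_diff sums_mult mult_cpmf_sums summable_sums moment_summable) auto
  also have "(\<lambda>n. moment_term ori 2 n s - 2 * ?h * moment_term ori 1 n s + ?h\<^sup>2 * (mult_abs ori n * cpmf ori (int n) s))
     = (\<lambda>n. mult_abs ori n * cpmf ori (int n) s * (sur ori n s - ?h)\<^sup>2)"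
    by (rule ext) (simp add: moment_term_def power2_diff algebra_simps)
  finally show ?thesis by (simp add: sur_var_def power2_eq_square)
qed

text \<open>The masses are not all equal, so two surprisals differ and one of them is not the
  mean.\<close>

lemma sur_var_pos:
  assumes s: "s > 0"
  shows "sur_var ori s > 0"
proof -
  obtain i where i: "cpmf ori (int i) s \<noteq> cpmf ori (int (Suc i)) s" using cpmf_not_const[OF s] by blast
  then have "sur ori i s \<noteq> sur ori (Suc i) s"
    using cpmf_pos[OF s, of ori] by (metis ln_inj_iff neg_equal_iff_equal sur_def)
  then obtain n where n: "sur ori n s \<noteq> entropy ori s" by metis
  have "0 < mult_abs ori n * cpmf ori (int n) s * (sur ori n s - entropy ori s)\<^sup>2"
    using n cpmf_pos[OF s, of ori n] mult_abs_bounds[of ori n] by (intro mult_pos_pos) auto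
  also have "\<dots> = (\<Sum>k\<in>{n}. mult_abs ori k * cpmf ori (int k) s * (sur ori k s - entropy ori s)\<^sup>2)"
    by simp
  also have "\<dots> \<le> sur_var ori s"
    unfolding sums_unique[OF sur_var_sums[OF s, of ori]]
  proof (rule sum_le_suminf[OF sums_summable[OF sur_var_sums[OF s, of ori]]])
    fix k
    show "0 \<le> mult_abs ori k * cpmf ori (int k) s * (sur ori k s - entropy ori s)\<^sup>2"
      using cpmf_nonneg[of s ori "int k"] mult_abs_bounds(1)[of ori k] s by (intro mult_nonneg_nonneg) auto
  qed simp
  finally show ?thesis .
qed

lemma sur_var_isCont: "s > 0 \<Longrightarrow> isCont (sur_var ori) s"
  unfolding sur_var_def[abs_def] by (intro continuous_intros moment_isCont) auto

text \<open>The squared mean is of order \<open>(s * ell s)\<^sup>2\<close>, smaller by a factor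
  \<open>s\<close> than the second moment.\<close>

lemma sur_var_ratio_at_0: "((\<lambda>s. sur_var ori s / (s * (ell s)\<^sup>2)) \<longlongrightarrow> 1) (at_right 0)"
proof -
  have "((\<lambda>s. moment ori 2 s / (s * (ell s)\<^sup>2) - s * (entropy ori s / (s * ell s ^ 1))\<^sup>2) \<longlongrightarrow> 1 - 0 * 1\<^sup>2) (at_right 0)"
    by (intro tendsto_intros moment_ratio_at_0 tendsto_ident_at) auto
  then have 1: "((\<lambda>s. moment ori 2 s / (s * (ell s)\<^sup>2) - s * (entropy ori s / (s * ell s ^ 1))\<^sup>2) \<longlongrightarrow> 1) (at_right 0)"
    by simp
  have "\<forall>\<^sub>F s in at_right 0. moment ori 2 s / (s * (ell s)\<^sup>2) - s * (entropy ori s / (s * ell s ^ 1))\<^sup>2 = sur_var ori s / (s * (ell s)\<^sup>2)"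
    using eventually_at_right_less[of 0]
  proof eventually_elim
    case (elim s)
    then show ?case using ell_pos[of s] by (simp add: sur_var_def field_simps power2_eq_square)
  qed
  from Lim_transform_eventually[OF 1 this] show ?thesis .
qed

text \<open>Surprisal and mean are nonnegative, so the cube of their distance is at most the sum of
  their cubes. The cube of the mean has two spare factors \<open>s\<close>, which the
  \<open>S\<^sup>2\<close> in the constant absorbs.\<close>

lemma third_moment:
  assumes s: "0 < s" "s \<le> S" "1 \<le> S"
  defines "K \<equiv> moment_const 3 S + (moment_const 1 S) ^ 3 * S\<^sup>2"
  shows "summable (\<lambda>n. mult_abs ori n * cpmf ori (int n) s * \<bar>sur ori n s - entropy ori s\<bar> ^ 3)"
    and "(\<Sum>n. mult_abs ori n * cpmf ori (int n) s * \<bar>sur ori n s - entropy ori s\<bar> ^ 3) \<le> K * (s * ell s ^ 3)"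
proof -
  let ?h = "entropy ori s"
  have h0: "?h \<ge> 0" using moment_nonneg s by simp
  let ?f = "\<lambda>n. mult_abs ori n * cpmf ori (int n) s * \<bar>sur ori n s - entropy ori s\<bar> ^ 3"
  let ?g = "\<lambda>n. moment_term ori 3 n s + ?h ^ 3 * (mult_abs ori n * cpmf ori (int n) s)"
  have m0: "0 \<le> mult_abs ori n * cpmf ori (int n) s" for n
    using cpmf_nonneg[of s ori "int n"] mult_abs_bounds(1)[of ori n] s by simp
  have le: "?f n \<le> ?g n" for n
  proof -
    have q: "sur ori n s \<ge> 0" using s sur_nonneg by simp
    have "\<bar>sur ori n s - ?h\<bar> ^ 3 \<le> (max (sur ori n s) ?h) ^ 3" using q h0 by (intro power_mono) auto
    also have "\<dots> \<le> sur ori n s ^ 3 + ?h ^ 3" using q h0 by (auto simp: max_def)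
    finally have "?f n \<le> mult_abs ori n * cpmf ori (int n) s * (sur ori n s ^ 3 + ?h ^ 3)"
      using m0 by (intro mult_left_mono) auto
    then show ?thesis by (simp add: moment_term_def algebra_simps)
  qed
  have g: "?g sums (moment ori 3 s + ?h ^ 3 * 1)"
    unfolding moment_def[of ori 3] using s
    by (intro sums_add sums_mult mult_cpmf_sums summable_sums moment_summable) auto
  show f: "summable ?f"
    by (rule summable_comparison_test[OF _ sums_summable[OF g]]) (use le m0 in auto)
  have "(\<Sum>n. ?f n) \<le> moment ori 3 s + ?h ^ 3"
    using suminf_le[OF le f sums_summable[OF g]] g by (simp add: sums_iff)
  also have "moment ori 3 s \<le> moment_const 3 S * (s * ell s ^ 3)"
    using moment_upper[OF s, of 3 ori] by (simp add: mult.assoc)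
  also have "?h ^ 3 \<le> (moment_const 1 S * s * ell s) ^ 3"
    using moment_upper[OF s, of 1 ori] h0 by (intro power_mono) auto
  also have "\<dots> = (moment_const 1 S) ^ 3 * (s\<^sup>2 * (s * ell s ^ 3))"
    by (simp add: power_mult_distrib power2_eq_square power3_eq_cube)
  also have "\<dots> \<le> (moment_const 1 S) ^ 3 * (S\<^sup>2 * (s * ell s ^ 3))"
  proof (intro mult_left_mono mult_right_mono power_mono)
    show "0 \<le> moment_const 1 S ^ 3"
      unfolding moment_const_def using s
      by (intro zero_le_power suminf_nonneg moment_bd_summable) (auto simp: moment_bd_def)
  qed (use s ell_pos[of s] in auto)
  finally show "(\<Sum>n. ?f n) \<le> K * (s * ell s ^ 3)"
    by (simp add: K_def algebra_simps)
qed

text \<open>Continuity of \<open>f\<close> on the open half-line gives no uniformity near 0.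
  Extended by 1 at 0, the quotient \<open>f / \<psi>\<close> lives on a compact interval, which
  provides a positive minimum and uniform continuity.\<close>

lemma continuous_ratio_extension:
  fixes f \<psi> :: "real \<Rightarrow> real"
  assumes cont: "\<And>s. s > 0 \<Longrightarrow> isCont f s" "\<And>s. s > 0 \<Longrightarrow> isCont \<psi> s"
    and pos: "\<And>s. s > 0 \<Longrightarrow> f s > 0" "\<And>s. s > 0 \<Longrightarrow> \<psi> s > 0"
    and lim: "((\<lambda>s. f s / \<psi> s) \<longlongrightarrow> 1) (at_right 0)" and S: "S > 0"
  defines "g \<equiv> (\<lambda>s. if s = 0 then 1 else f s / \<psi> s)"
  shows "continuous_on {0..S} g" "\<exists>c>0. \<forall>s\<in>{0..S}. c \<le> g s"
proof -
  show c: "continuous_on {0..S} g"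
    unfolding continuous_on_eq_continuous_within
  proof
    fix s assume s: "s \<in> {0..S}"
    show "continuous (at s within {0..S}) g"
    proof (cases "s = 0")
      case True
      have "((\<lambda>s. g s) \<longlongrightarrow> 1) (at_right 0)"
        by (rule Lim_transform_eventually[OF lim])
          (auto simp: g_def eventually_at_filter)
      then have "(g \<longlongrightarrow> 1) (at 0 within {0..S})"
        by (simp add: at_within_Icc_at_right[OF S])
      then show ?thesis using True by (simp add: continuous_within g_def)
    next
      case False
      then have s0: "s > 0" using s by auto
      have "isCont (\<lambda>s. f s / \<psi> s) s"
        using cont[OF s0] pos(2)[OF s0] by (intro continuous_intros) auto
      moreover have "\<forall>\<^sub>F x in nhds s. f x / \<psi> x = g x"
        by (rule eventually_mono[OF eventually_nhds_in_open[of "{0<..}" s]]) (use s0 in \<open>auto simp: g_def\<close>)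
      ultimately have "isCont g s" using isCont_cong[of "\<lambda>s. f s / \<psi> s" g s] by simp
      then show ?thesis by (rule continuous_at_imp_continuous_within)
    qed
  qed
  have "\<exists>x\<in>{0..S}. \<forall>y\<in>{0..S}. g x \<le> g y"
    by (rule continuous_attains_inf[OF _ _ c]) (use S in auto)
  then obtain x where x: "x \<in> {0..S}" "\<forall>y\<in>{0..S}. g x \<le> g y" by blast
  have "g x > 0" using x(1) pos[of x] by (auto simp: g_def)
  with x(2) show "\<exists>c>0. \<forall>s\<in>{0..S}. c \<le> g s" by blast
qed

lemma ratio_lower_bound:
  fixes f \<psi> :: "real \<Rightarrow> real"
  assumes "\<And>s. s > 0 \<Longrightarrow> isCont f s" "\<And>s. s > 0 \<Longrightarrow> isCont \<psi> s"
    and pos: "\<And>s. s > 0 \<Longrightarrow> f s > 0" "\<And>s. s > 0 \<Longrightarrow> \<psi> s > 0"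
    and "((\<lambda>s. f s / \<psi> s) \<longlongrightarrow> 1) (at_right 0)" and "S > 0"
  obtains c where "c > 0" "\<And>s. 0 < s \<Longrightarrow> s \<le> S \<Longrightarrow> c * \<psi> s \<le> f s"
proof -
  obtain c where c: "c > 0" "\<forall>s\<in>{0..S}. c \<le> (if s = 0 then 1 else f s / \<psi> s)"
    using continuous_ratio_extension(2)[OF assms] by blast
  have "c * \<psi> s \<le> f s" if "0 < s" "s \<le> S" for s
  proof -
    have "c \<le> f s / \<psi> s" using c(2)[rule_format, of s] that by simp
    then show ?thesis using pos(2)[OF that(1)] by (simp add: field_simps)
  qed
  with c(1) that show ?thesis by blast
qed

text \<open>Meant for arguments that may tend to 0: there \<open>f (b N) / f (a N)\<close> is
  compared with the same ratio for the explicit function \<open>\<psi>\<close>, and the quotient of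
  the two ratios is controlled by uniform continuity.\<close>

lemma ratio_tendsto_1:
  fixes f \<psi> :: "real \<Rightarrow> real" and a b :: "nat \<Rightarrow> real"
  assumes cont: "\<And>s. s > 0 \<Longrightarrow> isCont f s" "\<And>s. s > 0 \<Longrightarrow> isCont \<psi> s"
    and pos: "\<And>s. s > 0 \<Longrightarrow> f s > 0" "\<And>s. s > 0 \<Longrightarrow> \<psi> s > 0"
    and lim: "((\<lambda>s. f s / \<psi> s) \<longlongrightarrow> 1) (at_right 0)" and S: "S > 0"
    and ev: "\<forall>\<^sub>F N in sequentially. 0 < a N \<and> a N \<le> S \<and> 0 < b N \<and> b N \<le> S"
    and ab: "(\<lambda>N. b N / a N) \<longlonglongrightarrow> 1" and \<psi>: "(\<lambda>N. \<psi> (b N) / \<psi> (a N)) \<longlonglongrightarrow> 1"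
  shows "(\<lambda>N. f (b N) / f (a N)) \<longlonglongrightarrow> 1"
proof -
  define g where "g = (\<lambda>s. if s = 0 then 1 else f s / \<psi> s)"
  have ext: "continuous_on {0..S} g"
    unfolding g_def by (rule continuous_ratio_extension(1)[OF cont pos lim S])
  obtain c where c: "c > 0" "\<And>s. s \<in> {0..S} \<Longrightarrow> c \<le> g s"
    using continuous_ratio_extension(2)[OF cont pos lim S] unfolding g_def by metis
  have u: "uniformly_continuous_on {0..S} g"
    by (rule compact_uniformly_continuous[OF ext]) simp
  have ab': "(\<lambda>N. S * \<bar>b N / a N - 1\<bar>) \<longlonglongrightarrow> 0"
    using tendsto_mult_right_zero[OF tendsto_rabs_zero[OF LIM_zero[OF ab]], of S] .
  have g: "(\<lambda>N. g (b N) - g (a N)) \<longlonglongrightarrow> 0"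
  proof (rule LIMSEQ_I)
    fix e :: real assume "e > 0"
    then obtain d where d: "d > 0" "\<And>x y. x \<in> {0..S} \<Longrightarrow> y \<in> {0..S} \<Longrightarrow> dist y x < d \<Longrightarrow> dist (g y) (g x) < e"
      using u unfolding uniformly_continuous_on_def by metis
    have "\<forall>\<^sub>F N in sequentially. S * \<bar>b N / a N - 1\<bar> < d"
      using order_tendstoD(2)[OF ab' d(1)] .
    then have "\<forall>\<^sub>F N in sequentially. norm (g (b N) - g (a N) - 0) < e"
      using ev
    proof eventually_elim
      case (elim N)
      have "\<bar>b N - a N\<bar> = a N * \<bar>b N / a N - 1\<bar>"
        using elim by (simp add: abs_if field_simps)
      also have "\<dots> \<le> S * \<bar>b N / a N - 1\<bar>" using elim by (intro mult_right_mono) auto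
      finally have "dist (b N) (a N) < d" using elim by (simp add: dist_real_def)
      then have "dist (g (b N)) (g (a N)) < e" using elim by (intro d(2)) auto
      then show ?case by (simp add: dist_real_def)
    qed
    then show "\<exists>no. \<forall>n\<ge>no. norm (g (b n) - g (a n) - 0) < e" by (simp add: eventually_sequentially)
  qed
  have "(\<lambda>N. g (b N) / g (a N) - 1) \<longlonglongrightarrow> 0"
  proof (rule Lim_null_comparison)
    show "(\<lambda>N. \<bar>g (b N) - g (a N)\<bar> / c) \<longlonglongrightarrow> 0"
      using tendsto_divide_zero[OF tendsto_rabs_zero[OF g], of c] .
    show "\<forall>\<^sub>F N in sequentially. norm (g (b N) / g (a N) - 1) \<le> \<bar>g (b N) - g (a N)\<bar> / c"
      using ev
    proof eventually_elim
      case (elim N)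
      have ga: "g (a N) \<ge> c" using elim by (intro c(2)) auto
      then have "norm (g (b N) / g (a N) - 1) = \<bar>g (b N) - g (a N)\<bar> / g (a N)"
        using c(1) by (simp add: abs_if field_simps)
      also have "\<dots> \<le> \<bar>g (b N) - g (a N)\<bar> / c" using ga c(1) by (intro divide_left_mono) auto
      finally show ?case .
    qed
  qed
  then have "(\<lambda>N. g (b N) / g (a N)) \<longlonglongrightarrow> 1" by (simp add: LIM_zero_iff)
  from tendsto_mult[OF this \<psi>] have 1: "(\<lambda>N. g (b N) / g (a N) * (\<psi> (b N) / \<psi> (a N))) \<longlonglongrightarrow> 1" by simp
  have "\<forall>\<^sub>F N in sequentially. g (b N) / g (a N) * (\<psi> (b N) / \<psi> (a N)) = f (b N) / f (a N)"
    using ev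
  proof eventually_elim
    case (elim N)
    then have "\<psi> (a N) > 0" "\<psi> (b N) > 0" "f (a N) > 0" using pos by auto
    then show ?case using elim by (simp add: g_def)
  qed
  from Lim_transform_eventually[OF 1 this] show ?thesis .
qed

lemma ell_isCont: "s > 0 \<Longrightarrow> isCont ell s"
  unfolding isCont_def by (rule ell_tendsto) auto

text \<open>As a function of \<open>ln s\<close>, \<open>ell\<close> is Lipschitz with constant 1,
  so it does not separate times whose ratio tends to 1.\<close>

lemma ell_diff_le:
  assumes "0 < a" "0 < b"
  shows "\<bar>ell b - ell a\<bar> \<le> \<bar>ln (b / a)\<bar>"
proof -
  have *: "ell x - ell y \<le> ln (y / x) \<and> ell y \<le> ell x" if "0 < x" "x \<le> y" for x y
  proof
    show "ell y \<le> ell x" using that by (intro ell_antimono)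
    have "exp 1 + 1 / x \<le> y / x * (exp 1 + 1 / y)"
    proof -
      have "exp 1 * x \<le> exp 1 * y" using that by simp
      then show ?thesis using that by (simp add: field_simps)
    qed
    moreover have "0 < exp 1 + 1 / x" using that by (intro add_pos_pos) auto
    ultimately have "ln (exp 1 + 1 / x) \<le> ln (y / x * (exp 1 + 1 / y))"
      by (subst ln_le_cancel_iff) linarith+
    also have "\<dots> = ln (y / x) + ln (exp 1 + 1 / y)"
    proof -
      have "0 < exp 1 + 1 / y" using that by (intro add_pos_pos) auto
      then show ?thesis using that by (subst ln_mult) auto
    qed
    finally show "ell x - ell y \<le> ln (y / x)" by (simp add: ell_def)
  qed
  have sym: "ln (a / b) = - ln (b / a)" using assms by (simp add: ln_div)
  show ?thesis
  proof (cases "a \<le> b")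
    case True
    then show ?thesis using *[of a b] assms by (auto simp: abs_le_iff)
  next
    case False
    then show ?thesis using *[of b a] assms sym by (auto simp: abs_le_iff)
  qed
qed

lemma ell_ratio:
  assumes ev: "\<forall>\<^sub>F N in sequentially. 0 < a N \<and> 0 < b N" and ab: "(\<lambda>N. b N / a N) \<longlonglongrightarrow> (1::real)"
  shows "(\<lambda>N. ell (b N) / ell (a N)) \<longlonglongrightarrow> 1"
proof -
  have "(\<lambda>N. ell (b N) / ell (a N) - 1) \<longlonglongrightarrow> 0"
  proof (rule Lim_null_comparison)
    have "(\<lambda>N. ln (b N / a N)) \<longlonglongrightarrow> ln 1" by (intro tendsto_ln ab) simp
    then show "(\<lambda>N. \<bar>ln (b N / a N)\<bar>) \<longlonglongrightarrow> 0" using tendsto_rabs_zero by simp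
    show "\<forall>\<^sub>F N in sequentially. norm (ell (b N) / ell (a N) - 1) \<le> \<bar>ln (b N / a N)\<bar>"
      using ev
    proof eventually_elim
      case (elim N)
      have l: "ell (a N) \<ge> 1" using elim ell_ge_1 by auto
      then have "norm (ell (b N) / ell (a N) - 1) = \<bar>ell (b N) - ell (a N)\<bar> / ell (a N)"
        by (simp add: abs_if field_simps)
      also have "\<dots> \<le> \<bar>ell (b N) - ell (a N)\<bar> / 1" using l by (intro divide_left_mono) auto
      also have "\<dots> \<le> \<bar>ln (b N / a N)\<bar>" using ell_diff_le elim by auto
      finally show ?case .
    qed
  qed
  then show ?thesis by (simp add: LIM_zero_iff)
qed

lemma entropy_rate_ratio:
  assumes "S > 0" and ev: "\<forall>\<^sub>F N in sequentially. 0 < a N \<and> a N \<le> S \<and> 0 < b N \<and> b N \<le> S"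
    and ab: "(\<lambda>N. b N / a N) \<longlonglongrightarrow> 1"
  shows "(\<lambda>N. entropy_rate ori (b N) / entropy_rate ori (a N)) \<longlonglongrightarrow> 1"
proof (rule ratio_tendsto_1[OF entropy_rate_isCont ell_isCont entropy_rate_pos ell_pos entropy_rate_ratio_at_0 assms])
  show "(\<lambda>N. ell (b N) / ell (a N)) \<longlonglongrightarrow> 1"
    by (rule ell_ratio[OF _ ab]) (use ev in eventually_elim, auto)
qed

lemma sur_var_ratio:
  assumes "S > 0" and ev: "\<forall>\<^sub>F N in sequentially. 0 < a N \<and> a N \<le> S \<and> 0 < b N \<and> b N \<le> S"
    and ab: "(\<lambda>N. b N / a N) \<longlonglongrightarrow> 1"
  shows "(\<lambda>N. sur_var ori (b N) / sur_var ori (a N)) \<longlonglongrightarrow> 1"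
proof (rule ratio_tendsto_1[OF sur_var_isCont _ sur_var_pos _ sur_var_ratio_at_0 assms])
  have "(\<lambda>N. ell (b N) / ell (a N)) \<longlonglongrightarrow> 1"
    by (rule ell_ratio[OF _ ab]) (use ev in eventually_elim, auto)
  then have "(\<lambda>N. (b N / a N) * (ell (b N) / ell (a N))\<^sup>2) \<longlonglongrightarrow> 1 * 1\<^sup>2"
    by (intro tendsto_intros ab)
  then show "(\<lambda>N. b N * (ell (b N))\<^sup>2 / (a N * (ell (a N))\<^sup>2)) \<longlonglongrightarrow> 1"
    by (simp add: power_divide)
  show "isCont (\<lambda>s. s * (ell s)\<^sup>2) s" if "s > 0" for s
    using that by (intro continuous_intros ell_isCont)
  show "0 < s * (ell s)\<^sup>2" if "s > 0" for s using ell_pos[OF that] that by simp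
qed

lemma entropy_rate_lower:
  assumes "S > 0"
  obtains c where "c > 0" "\<And>s. 0 < s \<Longrightarrow> s \<le> S \<Longrightarrow> c * ell s \<le> entropy_rate ori s"
  using ratio_lower_bound[OF entropy_rate_isCont ell_isCont entropy_rate_pos ell_pos entropy_rate_ratio_at_0 assms] by blast

lemma sur_var_lower:
  assumes "S > 0"
  obtains c where "c > 0" "\<And>s. 0 < s \<Longrightarrow> s \<le> S \<Longrightarrow> c * (s * (ell s)\<^sup>2) \<le> sur_var ori s"
proof (rule ratio_lower_bound[OF sur_var_isCont _ sur_var_pos _ sur_var_ratio_at_0 assms, of ori])
  show "isCont (\<lambda>s. s * (ell s)\<^sup>2) s" if "s > 0" for s
    using that by (intro continuous_intros ell_isCont)
  show "0 < s * (ell s)\<^sup>2" if "s > 0" for s using ell_pos[OF that] that by simp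
qed (blast intro: that)+

lemma entropy_strict_mono:
  assumes "0 < s" "s < t"
  shows "entropy ori s < entropy ori t"
proof (rule DERIV_pos_imp_increasing[OF assms(2)])
  fix x assume "s \<le> x" "x \<le> t"
  then have "x > 0" using assms by simp
  then show "\<exists>y. DERIV (entropy ori) x :> y \<and> y > 0" using entropy_deriv entropy_rate_pos by blast
qed

lemma entropy_pos: "s > 0 \<Longrightarrow> entropy ori s > 0"
  using entropy_strict_mono[of "s/2" s ori] moment_nonneg[of "s/2" 1 ori] by simp

lemma entropy_at_0: "((entropy ori) \<longlongrightarrow> 0) (at_right 0)"
proof (rule Lim_null_comparison)
  show "\<forall>\<^sub>F s in at_right 0. norm (entropy ori s) \<le> moment_const 1 1 * (s * ell s)"
    using at_right_0_le[OF zero_less_one]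
  proof eventually_elim
    case (elim s)
    then show ?case using moment_upper[of s 1 1 ori] moment_nonneg[of s 1 ori] by (simp add: mult.assoc)
  qed
  have "((\<lambda>s. s * ell s) \<longlongrightarrow> 0) (at_right 0)" unfolding ell_def by real_asymp
  then show "((\<lambda>s. moment_const 1 1 * (s * ell s)) \<longlongrightarrow> 0) (at_right 0)"
    by (rule tendsto_mult_right_zero)
qed

text \<open>If the entropy were bounded by \<open>B\<close>, some atom would always have mass at least
  \<open>exp (- B - 1)\<close>; the masses then drop by a definite amount between two neighbouring atoms,
  which bounds the derivative of the entropy from below.\<close>

lemma entropy_unbounded: "\<exists>s>0. entropy ori s > B"
proof (rule ccontr)
  assume "\<not> ?thesis"
  then have B: "entropy ori s \<le> B" if "s > 0" for s using that by (meson not_le)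
  have "B \<ge> 0" using B[of 1] entropy_pos[of 1 ori] by simp
  define \<delta> where "\<delta> = exp (- B - 1)"
  \<comment> \<open>Since \<open>L * (\<delta> / 4) > 1\<close>, a run of \<open>L\<close>
    consecutive atoms cannot have masses all at least \<open>\<delta> / 4\<close>.\<close>
  define L where "L = nat \<lceil>4 / \<delta>\<rceil> + 1"
  have \<delta>: "\<delta> > 0" by (simp add: \<delta>_def)
  have L: "real L * (\<delta> / 4) > 1" "L > 0"
  proof -
    have "real L > 4 / \<delta>" unfolding L_def by linarith
    then show "real L * (\<delta> / 4) > 1" using \<delta> by (simp add: field_simps)
  qed (simp add: L_def)
  \<comment> \<open>A fall of the square root of the mass by \<open>sqrt \<delta> / 2\<close> within
    at most \<open>L\<close> steps contains a single step of at least
    \<open>sqrt \<delta> / 2 / L\<close>, and its square bounds the entropy rate.\<close>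
  define \<kappa> where "\<kappa> = (sqrt \<delta> / 2 / real L)\<^sup>2"
  have \<kappa>: "\<kappa> > 0" using \<delta> L by (simp add: \<kappa>_def)
  have rate: "entropy_rate ori s \<ge> \<kappa>" if s: "s > 0" for s
  proof -
    let ?p = "\<lambda>n. cpmf ori (int n) s"
    have p0: "0 \<le> ?p n" for n using cpmf_nonneg s by simp
    \<comment> \<open>Otherwise the mean surprisal would be at least \<open>B + 1\<close>.\<close>
    have "\<exists>n. sur ori n s \<le> B + 1"
    proof (rule ccontr)
      assume "\<not> ?thesis"
      then have q: "B + 1 \<le> sur ori n s" for n by (simp add: not_le less_imp_le)
      have "(B + 1) * (mult_abs ori n * ?p n) \<le> moment_term ori 1 n s" for n
      proof -
        have "0 \<le> mult_abs ori n * ?p n" using p0[of n] mult_abs_bounds(1)[of ori n] by simp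
        from mult_right_mono[OF q[of n] this] show ?thesis by (simp add: moment_term_def mult_ac)
      qed
      from sums_le[OF this sums_mult[OF mult_cpmf_sums] summable_sums[OF moment_summable]] s
      have "(B + 1) * 1 \<le> entropy ori s" by (simp add: moment_def)
      with B[OF s] show False by simp
    qed
    then obtain n where n: "sur ori n s \<le> B + 1" by blast
    then have "ln (?p n) \<ge> ln \<delta>" by (simp add: sur_def \<delta>_def)
    then have pn: "?p n \<ge> \<delta>" using \<delta> cpmf_pos[OF s, of ori n] by (simp add: ln_le_cancel_iff)
    have "\<exists>m\<in>{n..<n + L}. ?p m < \<delta> / 4"
    proof (rule ccontr)
      assume "\<not> ?thesis"
      then have "(\<Sum>m\<in>{n..<n + L}. \<delta> / 4) \<le> (\<Sum>m\<in>{n..<n + L}. mult_abs ori m * ?p m)"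
      proof (intro sum_mono)
        fix m assume "\<not> (\<exists>m\<in>{n..<n + L}. ?p m < \<delta> / 4)" "m \<in> {n..<n + L}"
        then have "\<delta> / 4 \<le> 1 * ?p m" by (auto simp: not_less)
        also have "\<dots> \<le> mult_abs ori m * ?p m" using mult_abs_bounds p0 by (intro mult_right_mono)
        finally show "\<delta> / 4 \<le> mult_abs ori m * ?p m" .
      qed
      also have "\<dots> \<le> (\<Sum>m. mult_abs ori m * ?p m)"
      proof (rule sum_le_suminf)
        show "summable (\<lambda>m. mult_abs ori m * ?p m)" using mult_cpmf_sums[of s ori] s by (simp add: sums_iff)
        show "0 \<le> mult_abs ori m * ?p m" for m using p0[of m] mult_abs_bounds(1)[of ori m] by simp
      qed simp
      also have "\<dots> = 1" using mult_cpmf_sums[of s ori] s by (simp add: sums_iff)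
      finally show False using L by simp
    qed
    then obtain m where m: "n \<le> m" "m < n + L" "?p m < \<delta> / 4" by auto
    have "sqrt (?p m) \<le> sqrt (\<delta> / 4)" using m(3) by simp
    also have "\<dots> = sqrt \<delta> / 2" by (simp add: real_sqrt_divide)
    finally have gap: "sqrt \<delta> / 2 \<le> sqrt (?p n) - sqrt (?p m)" 
      using real_sqrt_le_mono[OF pn] by linarith
    have "\<exists>i\<in>{n..<m}. sqrt \<delta> / 2 / real L \<le> sqrt (?p i) - sqrt (?p (Suc i))"
    proof (rule ccontr)
      assume neg: "\<not> ?thesis"
      have pos: "sqrt \<delta> / 2 > 0" using \<delta> by simp
      have "n \<noteq> m" using gap pos by auto
      have "sqrt (?p n) - sqrt (?p m) = (\<Sum>i\<in>{n..<m}. sqrt (?p i) - sqrt (?p (Suc i)))"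
        using sum_Suc_diff'[OF m(1), of "\<lambda>i. - sqrt (?p i)"] by simp
      also have "\<dots> < (\<Sum>i\<in>{n..<m}. sqrt \<delta> / 2 / real L)"
        using neg \<open>n \<noteq> m\<close> m(1) by (intro sum_strict_mono) (auto simp: not_le)
      also have "\<dots> = real (m - n) * (sqrt \<delta> / 2 / real L)" by simp
      also have "\<dots> \<le> real L * (sqrt \<delta> / 2 / real L)" using m pos by (intro mult_right_mono) auto
      also have "\<dots> = sqrt \<delta> / 2" using L by simp
      finally show False using gap by simp
    qed
    then obtain i where "sqrt \<delta> / 2 / real L \<le> sqrt (?p i) - sqrt (?p (Suc i))" by blast
    then have "\<kappa> \<le> (sqrt (?p i) - sqrt (?p (Suc i)))\<^sup>2"
      unfolding \<kappa>_def using \<delta> by (intro power_mono) auto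
    with entropy_rate_ge[OF s, of ori i] show ?thesis by simp
  qed
  \<comment> \<open>Over a time \<open>T\<close> the entropy grows by at least
    \<open>T * \<kappa> = B + \<kappa>\<close>, more than the bound \<open>B\<close>
    permits.\<close>
  define T where "T = B / \<kappa> + 1"
  have "T > 0" using \<kappa> \<open>B \<ge> 0\<close> by (simp add: T_def add_nonneg_pos)
  have "\<exists>z>1. z < 1 + T \<and> entropy ori (1 + T) - entropy ori 1 = (1 + T - 1) * entropy_rate ori z"
    using \<open>T > 0\<close> by (intro MVT2 entropy_deriv) auto
  then obtain z where z: "z > 1" "entropy ori (1 + T) - entropy ori 1 = T * entropy_rate ori z" by auto
  have "T * \<kappa> \<le> T * entropy_rate ori z" using rate[of z] z \<open>T > 0\<close> by (intro mult_left_mono) auto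
  moreover have "T * \<kappa> = B + \<kappa>" using \<kappa> by (simp add: T_def field_simps)
  ultimately show False using z B[of "1 + T"] entropy_pos[of 1 ori] \<open>T > 0\<close> \<kappa> by linarith
qed

lemma entropy_surj:
  assumes "y > 0"
  shows "\<exists>s>0. entropy ori s = y"
proof -
  obtain b where b: "b > 0" "entropy ori b > y" using entropy_unbounded by blast
  have "\<forall>\<^sub>F s in at_right 0. entropy ori s < y" using order_tendstoD(2)[OF entropy_at_0 assms] .
  then have "\<forall>\<^sub>F s in at_right 0. entropy ori s < y \<and> 0 < s \<and> s \<le> b"
    using at_right_0_le[OF b(1)] by eventually_elim auto
  then obtain a where a: "entropy ori a < y" "0 < a" "a \<le> b"
    using eventually_happens'[OF trivial_limit_at_right_real] by blast
  have "\<exists>x\<ge>a. x \<le> b \<and> entropy ori x = y"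
    using a b by (intro IVT) (auto intro!: moment_isCont)
  then obtain x where "x \<ge> a" "entropy ori x = y" by blast
  then show ?thesis using a(2) by (intro exI[of _ x]) auto
qed

section \<open>A central limit theorem for triangular arrays\<close>

text \<open>The \<open>k\<close>-th powers of two numbers in the unit disc differ by at most
  \<open>k\<close> times the difference of the numbers, and a third order Taylor bound controls the
  latter. The condition \<open>t\<^sup>2 / 4 \<le> k\<close> puts
  \<open>1 - t\<^sup>2 / (2 * k)\<close> into the disc.\<close>

lemma triangular_clt_char:
  fixes p :: "'b pmf" and f :: "'b \<Rightarrow> real" and k :: nat and \<sigma> t :: real
  assumes k: "k > 0" "t\<^sup>2 / 4 \<le> k" and \<sigma>: "\<sigma> > 0"
    and i1: "integrable p f" and i2: "integrable p (\<lambda>x. (f x)\<^sup>2)" and i3: "integrable p (\<lambda>x. \<bar>f x\<bar> ^ 3)"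
    and m1: "measure_pmf.expectation p f = 0" and m2: "measure_pmf.expectation p (\<lambda>x. (f x)\<^sup>2) = \<sigma>\<^sup>2"
  shows "cmod (char (distr (Pi_pmf {..<k} d (\<lambda>_. p)) borel (\<lambda>w. (\<Sum>i<k. f (w i)) / (\<sigma> * sqrt k))) t
            - (1 + (-(t^2) / 2) / k) ^ k)
         \<le> \<bar>t\<bar> ^ 3 / 6 * (measure_pmf.expectation p (\<lambda>x. \<bar>f x\<bar> ^ 3) / (\<sigma> ^ 3 * sqrt k))"
proof -
  let ?P = "Pi_pmf {..<k} d (\<lambda>_. p)"
  let ?u = "t / (\<sigma> * sqrt k)"
  let ?\<psi> = "char (distr p borel f) ?u"
  interpret pf: real_distribution "distr p borel f" by (rule prob_space.real_distribution_distr[OF measure_pmf.prob_space_axioms]) simp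
  have \<phi>: "char (distr ?P borel (\<lambda>w. (\<Sum>i<k. f (w i)) / (\<sigma> * sqrt k))) t = ?\<psi> ^ k"
  proof -
    have "char (distr ?P borel (\<lambda>w. (\<Sum>i<k. f (w i)) / (\<sigma> * sqrt k))) t
       = char (distr ?P borel (\<lambda>w. \<Sum>i<k. f (w i) / (\<sigma> * sqrt k))) t"
      by (simp add: sum_divide_distrib)
    also have "\<dots> = (\<Prod>i<k. char (distr ?P borel (\<lambda>w. f (w i) / (\<sigma> * sqrt k))) t)"
    proof (rule prob_space.char_distr_sum[OF measure_pmf.prob_space_axioms])
      show "prob_space.indep_vars ?P (\<lambda>_. borel) (\<lambda>i w. f (w i) / (\<sigma> * sqrt k)) {..<k}"
        by (rule prob_space.indep_vars_compose2[OF measure_pmf.prob_space_axioms indep_vars_Pi_pmf, where Y="\<lambda>_ x. f x / (\<sigma> * sqrt k)"]) auto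
    qed
    also have "\<dots> = (\<Prod>i<k. ?\<psi>)"
    proof (rule prod.cong[OF refl])
      fix i assume i: "i \<in> {..<k}"
      have "char (distr ?P borel (\<lambda>w. f (w i) / (\<sigma> * sqrt k))) t = (CLINT w|?P. iexp (t * (f (w i) / (\<sigma> * sqrt k))))"
        by (simp add: char_def integral_distr)
      also have "\<dots> = (CLINT x|map_pmf (\<lambda>w. w i) ?P. iexp (t * (f x / (\<sigma> * sqrt k))))"
        by simp
      also have "map_pmf (\<lambda>w. w i) ?P = p"
        using i by (subst Pi_pmf_component) auto
      also have "(CLINT x|p. iexp (t * (f x / (\<sigma> * sqrt k)))) = ?\<psi>"
        by (simp add: char_def integral_distr)
      finally show "char (distr ?P borel (\<lambda>w. f (w i) / (\<sigma> * sqrt k))) t = ?\<psi>" .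
    qed
    finally show ?thesis by simp
  qed
  have sq: "?u\<^sup>2 = t\<^sup>2 / (\<sigma>\<^sup>2 * k)" by (simp add: power_divide power_mult_distrib)
  have "cmod (?\<psi> - (1 - ?u^2 * \<sigma>\<^sup>2 / 2)) \<le> (?u\<^sup>2 / 6) * measure_pmf.expectation p (\<lambda>x. min (6 * (f x)^2) (\<bar>?u\<bar> * \<bar>f x\<bar>^3))"
    using i1 i2 m1 m2 by (intro prob_space.char_approx3'[OF measure_pmf.prob_space_axioms]) (auto)
  also have "\<dots> \<le> (?u\<^sup>2 / 6) * measure_pmf.expectation p (\<lambda>x. \<bar>?u\<bar> * \<bar>f x\<bar>^3)"
    using i2 i3 by (intro mult_left_mono integral_mono) auto
  also have "measure_pmf.expectation p (\<lambda>x. \<bar>?u\<bar> * \<bar>f x\<bar>^3) = \<bar>?u\<bar> * measure_pmf.expectation p (\<lambda>x. \<bar>f x\<bar>^3)"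
    by simp
  also have "1 - ?u^2 * \<sigma>\<^sup>2 / 2 = 1 + (-(t^2) / 2) / k"
    using \<sigma> k by (simp add: sq)
  finally have A: "cmod (?\<psi> - (1 + (-(t^2) / 2) / k)) \<le> ?u\<^sup>2 / 6 * (\<bar>?u\<bar> * measure_pmf.expectation p (\<lambda>x. \<bar>f x\<bar>^3))"
    by simp
  have "cmod (?\<psi> ^ k - complex_of_real (1 + (-(t^2) / 2) / k) ^ k) \<le> k * cmod (?\<psi> - complex_of_real (1 + (-(t^2) / 2) / k))"
    using k
    by (intro norm_power_diff pf.cmod_char_le_1)
      (auto intro!: abs_leI simp del: of_real_diff simp: of_real_diff[symmetric] divide_le_eq)
  also have "\<dots> \<le> k * (?u\<^sup>2 / 6 * (\<bar>?u\<bar> * measure_pmf.expectation p (\<lambda>x. \<bar>f x\<bar>^3)))"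
    using A by (intro mult_left_mono) auto
  also have "\<dots> = \<bar>t\<bar> ^ 3 / 6 * (measure_pmf.expectation p (\<lambda>x. \<bar>f x\<bar> ^ 3) / (\<sigma> ^ 3 * sqrt k))"
  proof -
    have "\<bar>?u\<bar> = \<bar>t\<bar> / (\<sigma> * sqrt k)" using \<sigma> by (simp add: abs_mult)
    moreover have "real k = sqrt k * sqrt k" by simp
    ultimately show ?thesis
      using \<sigma> k unfolding sq by (simp add: field_simps power2_eq_square power3_eq_cube)
  qed
  finally show ?thesis unfolding \<phi> by simp
qed

text \<open>The law of a summand changes with \<open>N\<close>, as the rescaled time does, so
  Lyapunov's condition takes the place of a fixed distribution with finite variance.\<close>

lemma triangular_clt:
  fixes p :: "nat \<Rightarrow> 'b pmf" and f :: "nat \<Rightarrow> 'b \<Rightarrow> real" and k :: "nat \<Rightarrow> nat" and \<sigma> :: "nat \<Rightarrow> real"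
  assumes k: "filterlim k at_top sequentially"
    and \<sigma>: "\<And>N. \<sigma> N > 0"
    and i1: "\<And>N. integrable (p N) (f N)"
    and i2: "\<And>N. integrable (p N) (\<lambda>x. (f N x)\<^sup>2)"
    and i3: "\<And>N. integrable (p N) (\<lambda>x. \<bar>f N x\<bar> ^ 3)"
    and m1: "\<And>N. measure_pmf.expectation (p N) (f N) = 0"
    and m2: "\<And>N. measure_pmf.expectation (p N) (\<lambda>x. (f N x)\<^sup>2) = (\<sigma> N)\<^sup>2"
    and lyapunov: "(\<lambda>N. measure_pmf.expectation (p N) (\<lambda>x. \<bar>f N x\<bar> ^ 3) / (\<sigma> N ^ 3 * sqrt (k N))) \<longlonglongrightarrow> 0"
  shows "weak_conv_m (\<lambda>N. distr (Pi_pmf {..<k N} d (\<lambda>_. p N)) borel (\<lambda>w. (\<Sum>i<k N. f N (w i)) / (\<sigma> N * sqrt (k N))))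
           std_normal_distribution"
proof (rule levy_continuity)
  fix t :: real
  let ?\<phi> = "\<lambda>N. char (distr (Pi_pmf {..<k N} d (\<lambda>_. p N)) borel (\<lambda>w. (\<Sum>i<k N. f N (w i)) / (\<sigma> N * sqrt (k N)))) t"
  have "filterlim (\<lambda>N. real (k N)) at_top sequentially"
    using filterlim_compose[OF filterlim_real_sequentially k] .
  then have "eventually (\<lambda>N. real (k N) \<ge> t\<^sup>2 / 4 \<and> real (k N) \<ge> 1) sequentially"
    unfolding filterlim_at_top by (intro eventually_conj) blast+
  then have main: "\<forall>\<^sub>F N in sequentially. cmod (?\<phi> N - complex_of_real ((1 + (-(t^2) / 2) / k N) ^ k N)) \<le>
      \<bar>t\<bar> ^ 3 / 6 * (measure_pmf.expectation (p N) (\<lambda>x. \<bar>f N x\<bar> ^ 3) / (\<sigma> N ^ 3 * sqrt (k N)))"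
  proof (rule eventually_mono)
    fix N assume "real (k N) \<ge> t\<^sup>2 / 4 \<and> real (k N) \<ge> 1"
    then show "cmod (?\<phi> N - complex_of_real ((1 + (-(t^2) / 2) / k N) ^ k N)) \<le>
      \<bar>t\<bar> ^ 3 / 6 * (measure_pmf.expectation (p N) (\<lambda>x. \<bar>f N x\<bar> ^ 3) / (\<sigma> N ^ 3 * sqrt (k N)))"
      using triangular_clt_char[of "k N" t "\<sigma> N" "p N" "f N" d] \<sigma> i1 i2 i3 m1 m2 by simp
  qed
  have "(\<lambda>N. \<bar>t\<bar> ^ 3 / 6 * (measure_pmf.expectation (p N) (\<lambda>x. \<bar>f N x\<bar> ^ 3) / (\<sigma> N ^ 3 * sqrt (k N)))) \<longlonglongrightarrow> 0"
    by (rule tendsto_mult_right_zero[OF lyapunov])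
  note lim = Lim_null_comparison[OF main this]
  have "(\<lambda>n. complex_of_real ((1 + (-(t^2) / 2) / n)^n)) \<longlonglongrightarrow> complex_of_real (exp (-(t^2) / 2))"
    by (rule isCont_tendsto_compose [OF _ tendsto_exp_limit_sequentially]) auto
  from filterlim_compose[OF this k] lim
  have "?\<phi> \<longlonglongrightarrow> complex_of_real (exp (-(t^2) / 2))"
    by (rule Lim_transform)
  then show "?\<phi> \<longlonglongrightarrow> char std_normal_distribution t"
    by (simp add: char_std_normal_distribution)
qed (auto intro!: real_dist_normal_dist prob_space.real_distribution_distr[OF measure_pmf.prob_space_axioms])

section \<open>The Gaussian tail and moving thresholds\<close>

abbreviation normal_cdf :: "real \<Rightarrow> real" where "normal_cdf \<equiv> cdf std_normal_distribution"

interpretation std_normal: real_distribution std_normal_distribution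
  by (rule real_dist_normal_dist)

lemma measure_std_normal:
  assumes "A \<in> sets borel"
  shows "measure std_normal_distribution A = (LBINT x:A. std_normal_density x)"
    "set_integrable lborel A std_normal_density"
proof -
  show i: "set_integrable lborel A std_normal_density"
    unfolding set_integrable_def using assms by (intro integrable_mult_indicator) auto
  have "emeasure std_normal_distribution A = (\<integral>\<^sup>+x. ennreal (std_normal_density x) * indicator A x \<partial>lborel)"
    using assms by (subst emeasure_density) auto
  also have "\<dots> = (\<integral>\<^sup>+x. ennreal (indicator A x *\<^sub>R std_normal_density x) \<partial>lborel)"
    by (intro nn_integral_cong) (auto split: split_indicator)
  also have "\<dots> = ennreal (LBINT x:A. std_normal_density x)"
    unfolding set_lebesgue_integral_def using i
    by (intro nn_integral_eq_integral) (auto simp: set_integrable_def)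
  finally show "measure std_normal_distribution A = (LBINT x:A. std_normal_density x)"
    by (simp add: measure_def set_lebesgue_integral_def)
qed

lemma Psi_eq_measure: "Psi \<alpha> = measure std_normal_distribution {\<alpha>..}"
proof -
  have "measure std_normal_distribution {\<alpha>..} = (LBINT x:{\<alpha>..}. std_normal_density x)"
    by (rule measure_std_normal) simp
  also have "\<dots> = (LBINT x:{\<alpha>..}. 1 / sqrt (2 * pi) * exp (- x\<^sup>2 / 2))"
    unfolding std_normal_density_def ..
  also have "\<dots> = Psi \<alpha>" unfolding Psi_def by (rule set_integral_mult_right)
  finally show ?thesis by simp
qed

lemma Psi_eq_cdf: "Psi \<alpha> = normal_cdf (- \<alpha>)"
proof -
  have "Psi \<alpha> = (\<integral>x. indicator {\<alpha>..} x *\<^sub>R std_normal_density x \<partial>lborel)"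
    unfolding Psi_eq_measure by (subst measure_std_normal) (auto simp: set_lebesgue_integral_def)
  also have "\<dots> = \<bar>-1\<bar> *\<^sub>R (\<integral>x. indicator {\<alpha>..} (0 + (-1) * x) *\<^sub>R std_normal_density (0 + (-1) * x) \<partial>lborel)"
    by (rule lborel_integral_real_affine) simp
  also have "\<dots> = (\<integral>x. indicator {..- \<alpha>} x *\<^sub>R std_normal_density x \<partial>lborel)"
    by (simp, intro Bochner_Integration.integral_cong) (auto simp: std_normal_density_def split: split_indicator)
  also have "\<dots> = normal_cdf (- \<alpha>)"
    unfolding cdf_def by (subst measure_std_normal) (auto simp: set_lebesgue_integral_def)
  finally show ?thesis .
qed

lemma normal_cdf_isCont: "isCont normal_cdf x"
proof -
  have "measure std_normal_distribution {x} = (LBINT y:{x}. std_normal_density y)"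
    by (rule measure_std_normal) simp
  also have "\<dots> = 0"
    unfolding set_lebesgue_integral_def
    by (rule integral_eq_zero_AE, rule AE_mp[OF AE_lborel_singleton[of x]]) auto
  finally show ?thesis by (simp add: std_normal.isCont_cdf)
qed

lemma normal_cdf_strict_mono:
  assumes "a < b"
  shows "normal_cdf a < normal_cdf b"
proof -
  define c where "c = std_normal_density (max \<bar>a\<bar> \<bar>b\<bar>)"
  have c: "c > 0" by (simp add: c_def normal_density_pos)
  have "c * (b - a) = (LBINT x:{a<..b}. c)" using assms by (simp add: set_lebesgue_integral_def)
  also have "\<dots> \<le> (LBINT x:{a<..b}. std_normal_density x)"
  proof (rule set_integral_mono)
    show "set_integrable lborel {a<..b} (\<lambda>x. c)"
      unfolding set_integrable_def using assms by (intro integrable_scaleR_left integrable_real_indicator) auto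
    show "set_integrable lborel {a<..b} std_normal_density" by (rule measure_std_normal) simp
    fix x assume "x \<in> {a<..b}"
    then have "\<bar>x\<bar> \<le> \<bar>max \<bar>a\<bar> \<bar>b\<bar>\<bar>" by auto
    then have "x\<^sup>2 \<le> (max \<bar>a\<bar> \<bar>b\<bar>)\<^sup>2" by (simp only: abs_le_square_iff)
    then show "c \<le> std_normal_density x" by (simp add: c_def std_normal_density_def divide_right_mono)
  qed
  also have "\<dots> = measure std_normal_distribution {a<..b}" by (rule measure_std_normal(1)[symmetric]) simp
  also have "\<dots> = normal_cdf b - normal_cdf a" using assms by (intro std_normal.cdf_diff_eq[symmetric])
  finally have "c * (b - a) \<le> normal_cdf b - normal_cdf a" .
  moreover have "c * (b - a) > 0" using c assms by simp
  ultimately show ?thesis by linarith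
qed

lemma Psi_strict_antimono: "a < b \<Longrightarrow> Psi b < Psi a"
  by (simp add: Psi_eq_cdf normal_cdf_strict_mono)

lemma inj_Psi: "inj Psi"
  by (rule injI) (metis Psi_strict_antimono less_irrefl neqE)

lemma Psi_0: "Psi 0 = 1 / 2"
proof -
  have "Psi 0 = 1 - normal_cdf 0"
  proof -
    have "measure std_normal_distribution {0..} = measure std_normal_distribution ({0<..} \<union> {0})"
      by (rule arg_cong[where f="measure _"]) auto
    also have "\<dots> = measure std_normal_distribution {0<..} + measure std_normal_distribution {0}"
      by (rule std_normal.finite_measure_Union) auto
    also have "measure std_normal_distribution {0} = 0" using normal_cdf_isCont[of 0] by (simp add: std_normal.isCont_cdf)
    also have "measure std_normal_distribution {0<..} = 1 - measure std_normal_distribution {..0}"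
      using std_normal.prob_compl[of "{..0}"] by (simp add: Compl_eq_Diff_UNIV[symmetric] flip: Compl_atMost)
    finally show ?thesis by (simp add: Psi_eq_measure cdf_def)
  qed
  then show ?thesis using Psi_eq_cdf[of 0] by simp
qed

text \<open>Makes \<open>the_inv Psi\<close> a true inverse on the open unit interval, where the
  profile uses it.\<close>

lemma Psi_surj:
  assumes "0 < \<epsilon>" "\<epsilon> < 1"
  shows "Psi (the_inv Psi \<epsilon>) = \<epsilon>"
proof -
  have "\<forall>\<^sub>F x in at_top. normal_cdf x > \<epsilon>" using order_tendstoD(1)[OF std_normal.cdf_lim_at_top_prob] assms by auto
  then obtain b where b: "normal_cdf b > \<epsilon>" by (metis eventually_at_top_linorder order_refl)
  have "\<forall>\<^sub>F x in at_bot. normal_cdf x < \<epsilon>" using order_tendstoD(2)[OF std_normal.cdf_lim_at_bot] assms by auto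
  then obtain a where a: "normal_cdf a < \<epsilon>" by (metis eventually_at_bot_linorder order_refl)
  have "a < b" using a b normal_cdf_strict_mono[of b a] by (cases a b rule: linorder_cases) auto
  have "\<exists>x\<ge>a. x \<le> b \<and> normal_cdf x = \<epsilon>"
    using a b \<open>a < b\<close> by (intro IVT) (auto intro: normal_cdf_isCont)
  then obtain x where "Psi (- x) = \<epsilon>" by (auto simp: Psi_eq_cdf)
  then have "\<epsilon> \<in> range Psi" by blast
  then show ?thesis by (rule f_the_inv_into_f[OF inj_Psi])
qed

text \<open>The thresholds move with \<open>N\<close>: they contain \<open>gap\<close> and the ratio
  of two standard deviations. Monotonicity of the distribution functions and continuity of the limit
  reduce this to fixed thresholds on either side.\<close>

lemma weak_conv_m_threshold:
  assumes w: "weak_conv_m M std_normal_distribution" and M: "\<And>n. real_distribution (M n)"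
    and x: "x \<longlonglongrightarrow> \<xi>"
  shows "(\<lambda>n. measure (M n) {..x n}) \<longlonglongrightarrow> normal_cdf \<xi>"
proof (rule LIMSEQ_I)
  have lim: "(\<lambda>n. cdf (M n) y) \<longlonglongrightarrow> normal_cdf y" for y
    using w normal_cdf_isCont unfolding weak_conv_m_def weak_conv_def by auto
  fix e :: real assume e: "e > 0"
  have "\<exists>d>0. \<forall>y. y \<noteq> \<xi> \<and> norm (y - \<xi>) < d \<longrightarrow> norm (normal_cdf y - normal_cdf \<xi>) < e / 2"
    by (rule normal_cdf_isCont[of \<xi>, unfolded isCont_def LIM_eq, rule_format]) (use e in simp)
  then obtain d where d: "d > 0" "\<And>y. y \<noteq> \<xi> \<Longrightarrow> \<bar>y - \<xi>\<bar> < d \<Longrightarrow> \<bar>normal_cdf y - normal_cdf \<xi>\<bar> < e / 2"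
    by auto
  let ?a = "\<xi> - d / 2" and ?b = "\<xi> + d / 2"
  have "\<forall>\<^sub>F n in sequentially. \<bar>cdf (M n) ?a - normal_cdf ?a\<bar> < e / 2"
    using tendstoD[OF lim[of ?a], of "e / 2"] e by (simp add: dist_real_def)
  moreover have "\<forall>\<^sub>F n in sequentially. \<bar>cdf (M n) ?b - normal_cdf ?b\<bar> < e / 2"
    using tendstoD[OF lim[of ?b], of "e / 2"] e by (simp add: dist_real_def)
  moreover have "\<forall>\<^sub>F n in sequentially. ?a < x n \<and> x n < ?b"
    using order_tendstoD(1)[OF x, of ?a] order_tendstoD(2)[OF x, of ?b] d(1) by (intro eventually_conj) auto
  ultimately have "\<forall>\<^sub>F n in sequentially. norm (measure (M n) {..x n} - normal_cdf \<xi>) < e"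
  proof eventually_elim
    case (elim n)
    interpret real_distribution "M n" by (rule M)
    have "cdf (M n) ?a \<le> cdf (M n) (x n)" "cdf (M n) (x n) \<le> cdf (M n) ?b"
      using elim by (auto intro: cdf_nondecreasing)
    moreover have "\<bar>normal_cdf ?a - normal_cdf \<xi>\<bar> < e / 2" "\<bar>normal_cdf ?b - normal_cdf \<xi>\<bar> < e / 2"
      using d by auto
    moreover have "measure (M n) {..x n} = cdf (M n) (x n)" by (simp add: cdf_def)
    ultimately show ?case using elim unfolding real_norm_def by linarith
  qed
  then show "\<exists>no. \<forall>n\<ge>no. norm (measure (M n) {..x n} - normal_cdf \<xi>) < e" by (simp add: eventually_sequentially)
qed

section \<open>Random words in a finite Abelian group\<close>

definition word :: "'a monoid \<Rightarrow> nat \<Rightarrow> (nat \<Rightarrow> 'a) \<Rightarrow> (nat \<Rightarrow> int) \<Rightarrow> 'a" where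
  "word G k Z w = finprod G (\<lambda>i. Z i [^]\<^bsub>G\<^esub> w i) {..<k}"

lemma Bezout_family: "\<exists>u. (\<Sum>i<k. u i * v i) = Gcd (v ` {..<k})" for v :: "nat \<Rightarrow> int"
proof (induction k)
  case (Suc k)
  then obtain u where u: "(\<Sum>i<k. u i * v i) = Gcd (v ` {..<k})" by blast
  obtain a b where ab: "a * Gcd (v ` {..<k}) + b * v k = gcd (Gcd (v ` {..<k})) (v k)"
    using bezout_int by blast
  have "(\<Sum>i<Suc k. (if i = k then b else a * u i) * v i) = a * (\<Sum>i<k. u i * v i) + b * v k"
    by (simp add: sum_distrib_left mult.assoc)
  also have "\<dots> = Gcd (v ` {..<Suc k})"
    using ab by (simp add: u lessThan_Suc gcd.commute)
  finally show ?case by (intro exI[of _ "\<lambda>i. if i = k then b else a * u i"])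
qed auto

locale finite_comm_group = comm_group G for G :: "'a monoid" (structure) +
  assumes finite_carrier: "finite (carrier G)"
begin

lemma word_closed: "Z \<in> {..<k} \<rightarrow> carrier G \<Longrightarrow> word G k Z w \<in> carrier G"
  unfolding word_def by (intro finprod_closed) auto

lemma word_zero: "word G k Z (\<lambda>_. 0) = \<one>"
  unfolding word_def by (simp add: finprod_one_eqI)

lemma word_add:
  assumes "Z \<in> {..<k} \<rightarrow> carrier G"
  shows "word G k Z (\<lambda>i. w i + w' i) = word G k Z w \<otimes> word G k Z w'"
proof -
  have "word G k Z w \<otimes> word G k Z w' = finprod G (\<lambda>i. Z i [^] w i \<otimes> Z i [^] w' i) {..<k}"
    unfolding word_def using assms by (intro finprod_multf[symmetric]) auto
  also have "\<dots> = word G k Z (\<lambda>i. w i + w' i)"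
    unfolding word_def using assms by (intro finprod_cong') (auto simp: int_pow_mult Pi_iff)
  finally show ?thesis by simp
qed

lemma word_single:
  assumes "Z \<in> {..<k} \<rightarrow> carrier G" "i < k"
  shows "word G k Z (\<lambda>j. if j = i then \<sigma> else 0) = Z i [^] \<sigma>"
proof -
  have "word G k Z (\<lambda>j. if j = i then \<sigma> else 0) = finprod G (\<lambda>j. if i = j then Z j [^] \<sigma> else \<one>) {..<k}"
    unfolding word_def using assms by (intro finprod_cong') (auto simp: Pi_iff)
  also have "\<dots> = Z i [^] \<sigma>" using assms by (intro finprod_singleton) (auto simp: Pi_iff)
  finally show ?thesis .
qed

lemma word_step:
  assumes "Z \<in> {..<k} \<rightarrow> carrier G" "i < k"
  shows "word G k Z (w(i := w i + \<sigma>)) = word G k Z w \<otimes> Z i [^] \<sigma>"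
proof -
  have "w(i := w i + \<sigma>) = (\<lambda>j. w j + (if j = i then \<sigma> else 0))" by auto
  then show ?thesis using word_add[OF assms(1)] word_single[OF assms] by simp
qed

text \<open>In an Abelian group the position depends only on how often each generator has been used,
  so \<open>word\<close> carries every step of the lattice chain to a step of the Cayley
  chain.\<close>

lemma map_chain_law_word:
  assumes Z: "Z \<in> {..<k} \<rightarrow> carrier G" and k: "k > 0"
  shows "map_pmf (word G k Z) (chain_law (lattice_step ori k) n (return_pmf (\<lambda>_. 0)))
           = chain_law (cayley_step ori G k Z) n (return_pmf \<one>)"
proof (induction n)
  case 0
  then show ?case by (simp add: word_zero)
next
  case (Suc n)
  have step: "map_pmf (word G k Z) (lattice_step ori k w) = cayley_step ori G k Z (word G k Z w)" for w
    unfolding lattice_step_def cayley_step_def map_bind_pmf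
    by (rule bind_pmf_cong[OF refl])
      (use k in \<open>auto simp: map_pmf_comp word_step[OF Z] lessThan_empty_iff intro!: map_pmf_cong\<close>)
  have "map_pmf (word G k Z) (chain_law (lattice_step ori k) (Suc n) (return_pmf (\<lambda>_. 0)))
     = bind_pmf (map_pmf (word G k Z) (chain_law (lattice_step ori k) n (return_pmf (\<lambda>_. 0)))) (cayley_step ori G k Z)"
    unfolding chain_law_Suc map_bind_pmf step bind_map_pmf ..
  then show ?case by (simp add: Suc chain_law_Suc)
qed

lemma cayley_law_word:
  assumes "Z \<in> {..<k} \<rightarrow> carrier G" "k > 0"
  shows "cayley_law ori G k Z t = map_pmf (word G k Z) (lattice_law ori k t)"
  unfolding cayley_law_def lattice_law_def ct_walk_chain_law map_bind_pmf map_chain_law_word[OF assms] ..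

lemma word_eq_iff:
  assumes "Z \<in> {..<k} \<rightarrow> carrier G"
  shows "word G k Z w = word G k Z w' \<longleftrightarrow> word G k Z (\<lambda>i. w i - w' i) = \<one>"
proof -
  have "word G k Z w = word G k Z (\<lambda>i. (w i - w' i) + w' i)" by simp
  also have "\<dots> = word G k Z (\<lambda>i. w i - w' i) \<otimes> word G k Z w'"
    by (rule word_add[OF assms])
  finally show ?thesis using word_closed[OF assms] by (metis l_one one_closed right_cancel)
qed

lemma word_translate:
  assumes Z: "Z \<in> {..<k} \<rightarrow> carrier G" and x: "x \<in> carrier G"
  shows "word G k (\<lambda>i. if i < k then Z i \<otimes> x [^] u i else d) v
           = word G k Z v \<otimes> x [^] (\<Sum>i<k. u i * (v i :: int))"
proof -
  have "word G k (\<lambda>i. if i < k then Z i \<otimes> x [^] u i else d) v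
     = finprod G (\<lambda>i. Z i [^] v i \<otimes> x [^] (u i * v i)) {..<k}"
    unfolding word_def using assms by (intro finprod_cong') (auto simp: int_pow_distrib int_pow_pow Pi_iff)
  also have "\<dots> = word G k Z v \<otimes> finprod G (\<lambda>i. x [^] (u i * v i)) {..<k}"
    unfolding word_def using assms by (intro finprod_multf) auto
  also have "finprod G (\<lambda>i. x [^] (u i * v i)) {..<k} = x [^] (\<Sum>i<k. u i * v i)"
  proof -
    have "finprod G (\<lambda>i. x [^] (f i :: int)) A = x [^] (\<Sum>i\<in>A. f i)" if "finite A" for f :: "nat \<Rightarrow> int" and A
      using that by (induction A rule: finite_induct) (use x in \<open>auto simp: int_pow_mult\<close>)
    then show ?thesis by simp
  qed
  finally show ?thesis .
qed

text \<open>By Bezout's identity, translating \<open>Z\<close> by suitable powers of \<open>x\<close> multiplies the word by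
  \<open>x\<close> to the power of the gcd; so every gcd-th power is as likely a value of the word as \<open>\<one>\<close>.\<close>

lemma prob_word_trivial_le:
  fixes v :: "nat \<Rightarrow> int" and k :: nat
  defines "g \<equiv> Gcd (v ` {..<k})"
  shows "measure_pmf.prob (iid_generators G k) {Z. word G k Z v = \<one>} * card ((\<lambda>x. x [^] g) ` carrier G) \<le> 1"
proof -
  define \<Omega> where "\<Omega> = PiE_dflt {..<k} (undefined::'a) (\<lambda>_. carrier G)"
  have ne: "carrier G \<noteq> {}" by blast
  have iid: "iid_generators G k = pmf_of_set \<Omega>"
    unfolding iid_generators_def \<Omega>_def using finite_carrier ne by (intro Pi_pmf_of_set) auto
  have fin\<Omega>: "finite \<Omega>" and ne\<Omega>: "\<Omega> \<noteq> {}" unfolding \<Omega>_def using finite_carrier ne by auto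
  define C where "C y = {Z\<in>\<Omega>. word G k Z v = y}" for y
  obtain u where u: "(\<Sum>i<k. u i * v i) = g" unfolding g_def using Bezout_family by blast
  have card_le: "card (C \<one>) \<le> card (C (x [^] g))" if x: "x \<in> carrier G" for x
  proof (rule card_inj_on_le)
    let ?T = "\<lambda>Z i. if i < k then Z i \<otimes> x [^] u i else (undefined :: 'a)"
    show "inj_on ?T (C \<one>)"
    proof (rule inj_onI)
      fix Z Z' assume Z: "Z \<in> C \<one>" "Z' \<in> C \<one>" and eq: "?T Z = ?T Z'"
      show "Z = Z'"
      proof
        fix i
        show "Z i = Z' i"
        proof (cases "i < k")
          case True
          then have "Z i \<otimes> x [^] u i = Z' i \<otimes> x [^] u i" using fun_cong[OF eq, of i] by simp
          then show ?thesis using Z True x by (auto simp: C_def \<Omega>_def PiE_dflt_def)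
        qed (use Z in \<open>auto simp: C_def \<Omega>_def PiE_dflt_def\<close>)
      qed
    qed
    show "?T ` C \<one> \<subseteq> C (x [^] g)"
    proof
      fix Y assume "Y \<in> ?T ` C \<one>"
      then obtain Z where Z: "Z \<in> C \<one>" "Y = ?T Z" by blast
      then have Z': "Z \<in> {..<k} \<rightarrow> carrier G" by (auto simp: C_def \<Omega>_def PiE_dflt_def)
      have "word G k Y v = x [^] g"
        unfolding Z(2) word_translate[OF Z' x] u using Z(1) x by (simp add: C_def)
      moreover have "Y \<in> \<Omega>" using Z x by (auto simp: C_def \<Omega>_def PiE_dflt_def)
      ultimately show "Y \<in> C (x [^] g)" by (simp add: C_def)
    qed
    show "finite (C (x [^] g))" using fin\<Omega> by (simp add: C_def)
  qed
  have "card (C \<one>) * card ((\<lambda>x. x [^] g) ` carrier G) = (\<Sum>y\<in>(\<lambda>x. x [^] g) ` carrier G. card (C \<one>))" by simp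
  also have "\<dots> \<le> (\<Sum>y\<in>(\<lambda>x. x [^] g) ` carrier G. card (C y))" by (intro sum_mono) (auto intro: card_le)
  also have "\<dots> = card (\<Union>y\<in>(\<lambda>x. x [^] g) ` carrier G. C y)"
    using finite_carrier fin\<Omega> by (intro card_UN_disjoint[symmetric]) (auto simp: C_def)
  also have "\<dots> \<le> card \<Omega>" using fin\<Omega> by (intro card_mono) (auto simp: C_def)
  finally have "real (card (C \<one>)) * card ((\<lambda>x. x [^] g) ` carrier G) \<le> card \<Omega>"
    by (metis of_nat_le_iff of_nat_mult)
  moreover have "measure_pmf.prob (iid_generators G k) {Z. word G k Z v = \<one>} = card (C \<one>) / card \<Omega>"
    unfolding iid using fin\<Omega> ne\<Omega> by (subst measure_pmf_of_set) (auto simp: C_def Int_def)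
  moreover have "card \<Omega> > 0" using fin\<Omega> ne\<Omega> by (simp add: card_gt_0_iff)
  ultimately show ?thesis by (simp add: divide_le_eq_1)
qed

lemma generate_int_powers:
  assumes A: "A \<subseteq> carrier G" "finite A" and x: "x \<in> generate G A"
  shows "\<exists>z :: 'a \<Rightarrow> int. x = finprod G (\<lambda>a. a [^] z a) A"
  using x
proof (induction rule: generate.induct)
  case one
  then show ?case by (intro exI[of _ "\<lambda>_. 0"]) (simp add: finprod_one_eqI)
next
  case (incl h)
  have "finprod G (\<lambda>a. a [^] (if a = h then 1 else 0 :: int)) A = finprod G (\<lambda>a. if h = a then a else \<one>) A"
    using A by (intro finprod_cong') auto
  also have "\<dots> = h" using A incl by (intro finprod_singleton) auto
  finally show ?case by metis
next
  case (inv h)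
  have "finprod G (\<lambda>a. a [^] (if a = h then -1 else 0 :: int)) A = finprod G (\<lambda>a. if h = a then inv a else \<one>) A"
    using A by (intro finprod_cong') (auto simp: int_pow_neg)
  also have "\<dots> = inv h" using A inv by (intro finprod_singleton) auto
  finally show ?case by metis
next
  case (eng h1 h2)
  then obtain z1 z2 :: "'a \<Rightarrow> int" where z: "h1 = finprod G (\<lambda>a. a [^] z1 a) A" "h2 = finprod G (\<lambda>a. a [^] z2 a) A" by blast
  have "h1 \<otimes> h2 = finprod G (\<lambda>a. a [^] z1 a \<otimes> a [^] z2 a) A"
    unfolding z using A by (intro finprod_multf[symmetric]) auto
  also have "\<dots> = finprod G (\<lambda>a. a [^] (z1 a + z2 a)) A"
    using A by (intro finprod_cong') (auto simp: int_pow_mult subset_iff)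
  finally show ?case by (intro exI[of _ "\<lambda>a. z1 a + z2 a"])
qed

text \<open>Division with remainder in the exponents: every element is a \<open>g\<close>-th power
  times a product of generators with exponents below \<open>g\<close>, and there are
  \<open>g ^ card A\<close> such products.\<close>

lemma card_le_powers:
  fixes g :: nat
  assumes A: "A \<subseteq> carrier G" "finite A" "generate G A = carrier G" and g: "g > 0"
  shows "card (carrier G) \<le> g ^ card A * card ((\<lambda>x. x [^] int g) ` carrier G)"
proof -
  let ?P = "(\<lambda>x. x [^] int g) ` carrier G" and ?E = "PiE A (\<lambda>_. {0..<int g})"
  let ?f = "\<lambda>(e, y). y \<otimes> finprod G (\<lambda>a. a [^] (e a :: int)) A"
  have "carrier G \<subseteq> ?f ` (?E \<times> ?P)"
  proof
    fix x assume "x \<in> carrier G"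
    then have "x \<in> generate G A" using A by simp
    then obtain z :: "'a \<Rightarrow> int" where z: "x = finprod G (\<lambda>a. a [^] z a) A"
      using generate_int_powers A by blast
    define y where "y = finprod G (\<lambda>a. a [^] (z a div int g)) A"
    have yc: "y \<in> carrier G" unfolding y_def using A by (intro finprod_closed) auto
    have pow: "finprod G (\<lambda>a. (f a) [^] int g) B = (finprod G f B) [^] int g" if "finite B" "f \<in> B \<rightarrow> carrier G" for f B
      using that by (induction B rule: finite_induct) (auto simp: int_pow_distrib Pi_iff)
    define e where "e = restrict (\<lambda>a. z a mod int g) A"
    have "x = finprod G (\<lambda>a. (a [^] (z a div int g)) [^] int g \<otimes> a [^] e a) A"
      unfolding z
    proof (rule finprod_cong')
      fix a assume a: "a \<in> A"
      then have ac: "a \<in> carrier G" using A by blast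
      have "a [^] z a = a [^] ((z a div int g) * int g + z a mod int g)" by simp
      also have "\<dots> = a [^] ((z a div int g) * int g) \<otimes> a [^] (z a mod int g)"
        by (rule int_pow_mult[OF ac])
      also have "a [^] ((z a div int g) * int g) = (a [^] (z a div int g)) [^] int g"
        by (rule int_pow_pow[OF ac, symmetric])
      finally show "a [^] z a = (a [^] (z a div int g)) [^] int g \<otimes> a [^] e a" using a by (simp add: e_def)
    qed (use A in auto)
    also have "\<dots> = finprod G (\<lambda>a. (a [^] (z a div int g)) [^] int g) A \<otimes> finprod G (\<lambda>a. a [^] e a) A"
      using A by (intro finprod_multf) auto
    also have "finprod G (\<lambda>a. (a [^] (z a div int g)) [^] int g) A = y [^] int g"
      unfolding y_def using A by (intro pow) auto
    finally have "x = ?f (e, y [^] int g)" by simp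
    moreover have "(e, y [^] int g) \<in> ?E \<times> ?P" using yc g by (auto simp: e_def)
    ultimately show "x \<in> ?f ` (?E \<times> ?P)" by (rule image_eqI)
  qed
  then have "card (carrier G) \<le> card (?E \<times> ?P)"
    using finite_carrier A by (intro surj_card_le finite_cartesian_product finite_PiE finite_imageI) auto
  also have "\<dots> = g ^ card A * card ?P" using A by (simp add: card_cartesian_product card_PiE)
  finally show ?thesis .
qed

lemma min_gen_size_attained:
  obtains A where "A \<subseteq> carrier G" "finite A" "card A = min_gen_size G" "generate G A = carrier G"
proof -
  let ?P = "\<lambda>r. \<exists>A. A \<subseteq> carrier G \<and> finite A \<and> card A = r \<and> generate G A = carrier G"
  have "generate G (carrier G) = carrier G"
    by (intro equalityI generate_incl generate.incl subsetI) auto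
  then have "?P (card (carrier G))" using finite_carrier by blast
  then have "?P (min_gen_size G)" unfolding min_gen_size_def by (rule LeastI)
  then show ?thesis using that by blast
qed

lemma prob_word_trivial:
  assumes g: "Gcd (v ` {..<k}) = int g" "g > 0"
  shows "card (carrier G) * measure_pmf.prob (iid_generators G k) {Z. word G k Z v = \<one>} \<le> real g ^ min_gen_size G"
proof -
  obtain A where A: "A \<subseteq> carrier G" "finite A" "card A = min_gen_size G" "generate G A = carrier G"
    using min_gen_size_attained by blast
  let ?p = "measure_pmf.prob (iid_generators G k) {Z. word G k Z v = \<one>}"
  have "real (card (carrier G)) \<le> real g ^ min_gen_size G * card ((\<lambda>x. x [^] int g) ` carrier G)"
    using card_le_powers[OF A(1,2,4) g(2)] A(3) by (metis of_nat_le_iff of_nat_mult of_nat_power)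
  then have "card (carrier G) * ?p \<le> real g ^ min_gen_size G * card ((\<lambda>x. x [^] int g) ` carrier G) * ?p"
    by (intro mult_right_mono) auto
  also have "\<dots> = real g ^ min_gen_size G * (?p * card ((\<lambda>x. x [^] int g) ` carrier G))" by simp
  also have "\<dots> \<le> real g ^ min_gen_size G * 1"
    using prob_word_trivial_le[of k v] g by (intro mult_left_mono) auto
  finally show ?thesis by simp
qed

end

section \<open>Total variation distance\<close>

lemma tv_dist_ge: "\<bar>measure_pmf.prob p A - measure_pmf.prob q A\<bar> \<le> tv_dist p q"
  unfolding tv_dist_def
proof (rule cSUP_upper)
  have "\<bar>measure_pmf.prob p A - measure_pmf.prob q A\<bar> \<le> 1" for A
    using measure_pmf.prob_le_1[of p A] measure_pmf.prob_le_1[of q A] measure_nonneg[of p A] measure_nonneg[of q A] by linarith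
  then show "bdd_above (range (\<lambda>A. \<bar>measure_pmf.prob p A - measure_pmf.prob q A\<bar>))"
    by (intro bdd_aboveI2)
qed simp

lemma tv_dist_le: "(\<And>A. \<bar>measure_pmf.prob p A - measure_pmf.prob q A\<bar> \<le> B) \<Longrightarrow> tv_dist p q \<le> B"
  unfolding tv_dist_def by (rule cSUP_least) auto

text \<open>Replacing \<open>f\<close> by the indicator of the points where \<open>p\<close> exceeds
  \<open>q\<close> can only increase the difference.\<close>

lemma expectation_diff_le_tv:
  fixes f :: "'a \<Rightarrow> real"
  assumes C: "finite C" "set_pmf p \<subseteq> C" "set_pmf q \<subseteq> C" and f: "\<And>x. 0 \<le> f x" "\<And>x. f x \<le> 1"
  shows "measure_pmf.expectation p f - measure_pmf.expectation q f \<le> tv_dist p q"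
proof -
  let ?A = "{x\<in>C. pmf q x < pmf p x}"
  have e: "measure_pmf.expectation r f = (\<Sum>x\<in>C. f x * pmf r x)" if "set_pmf r \<subseteq> C" for r
    using that C by (intro integral_measure_pmf_real) auto
  have "measure_pmf.expectation p f - measure_pmf.expectation q f = (\<Sum>x\<in>C. f x * (pmf p x - pmf q x))"
    using C by (simp add: e sum_subtractf right_diff_distrib)
  also have "\<dots> \<le> (\<Sum>x\<in>C. if pmf q x < pmf p x then pmf p x - pmf q x else 0)"
    using f by (intro sum_mono) (auto simp: mult_left_le_one_le mult_nonneg_nonpos)
  also have "\<dots> = (\<Sum>x\<in>?A. pmf p x - pmf q x)"
    using C by (simp add: sum.inter_filter)
  also have "\<dots> = measure_pmf.prob p ?A - measure_pmf.prob q ?A"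
    using C by (simp add: measure_measure_pmf_finite sum_subtractf)
  also have "\<dots> \<le> tv_dist p q" using tv_dist_ge[of p ?A q] by linarith
  finally show ?thesis .
qed

lemma tv_dist_commute: "tv_dist p q = tv_dist q p"
  by (simp add: tv_dist_def abs_minus_commute)

lemma tv_dist_bind_le:
  assumes C: "finite C" "set_pmf p \<subseteq> C" "set_pmf q \<subseteq> C"
  shows "tv_dist (bind_pmf p F) (bind_pmf q F) \<le> tv_dist p q"
proof (rule tv_dist_le)
  fix A
  let ?f = "\<lambda>x. measure_pmf.prob (F x) A"
  have "measure_pmf.expectation p ?f - measure_pmf.expectation q ?f \<le> tv_dist p q"
    by (rule expectation_diff_le_tv[OF C]) auto
  moreover have "measure_pmf.expectation q ?f - measure_pmf.expectation p ?f \<le> tv_dist p q"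
    using expectation_diff_le_tv[OF C(1,3,2), of ?f] by (simp add: tv_dist_commute)
  ultimately show "\<bar>measure_pmf.prob (bind_pmf p F) A - measure_pmf.prob (bind_pmf q F) A\<bar> \<le> tv_dist p q"
    by (simp add: prob_bind_pmf abs_le_iff)
qed

lemma large_atoms:
  assumes "c > 0"
  shows "finite {x. c \<le> pmf p x}" "card {x. c \<le> pmf p x} \<le> 1 / c"
proof -
  have b: "card F \<le> 1 / c" if "finite F" "F \<subseteq> {x. c \<le> pmf p x}" for F
  proof -
    have "card F * c = (\<Sum>x\<in>F. c)" by simp
    also have "\<dots> \<le> (\<Sum>x\<in>F. pmf p x)" using that by (intro sum_mono) auto
    also have "\<dots> = measure_pmf.prob p F" using that by (simp add: measure_measure_pmf_finite)
    also have "\<dots> \<le> 1" by simp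
    finally show ?thesis using assms by (simp add: field_simps)
  qed
  show "finite {x. c \<le> pmf p x}"
  proof (rule ccontr)
    assume "infinite {x. c \<le> pmf p x}"
    then obtain F where F: "F \<subseteq> {x. c \<le> pmf p x}" "finite F" "card F = nat \<lfloor>1 / c\<rfloor> + 1"
      using infinite_arbitrarily_large by blast
    with b[of F] show False by linarith
  qed
  then show "card {x. c \<le> pmf p x} \<le> 1 / c" by (intro b) auto
qed

text \<open>\<open>T\<close> is the set of typical points, and \<open>m\<close> its mass. Off \<open>T\<close> the trivial bound is used; on \<open>T\<close>
  Cauchy-Schwarz bounds the \<open>L1\<close> distance by the collision probability.\<close>

lemma tv_dist_collision:
  fixes \<mu> :: "'b pmf" and \<phi> :: "'b \<Rightarrow> 'a"
  assumes C: "finite C" "C \<noteq> {}" and T: "finite T" "\<phi> ` T \<subseteq> C"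
  defines "m \<equiv> measure_pmf.prob \<mu> T"
  defines "X \<equiv> card C * (\<Sum>w\<in>T. \<Sum>w'\<in>T. pmf \<mu> w * pmf \<mu> w' * of_bool (\<phi> w = \<phi> w')) - m\<^sup>2"
  shows "0 \<le> X" "tv_dist (map_pmf \<phi> \<mu>) (pmf_of_set C) \<le> 1 - m + sqrt X"
proof -
  let ?n = "real (card C)"
  have n: "?n > 0" using C by (simp add: card_gt_0_iff)
  define \<nu> where "\<nu> x = (\<Sum>w\<in>T. pmf \<mu> w * of_bool (\<phi> w = x))" for x
  have sum_\<nu>: "(\<Sum>x\<in>B. \<nu> x) = measure_pmf.prob \<mu> (\<phi> -` B \<inter> T)" if "B \<subseteq> C" for B
  proof -
    have fB: "finite B" using that C finite_subset by blast
    have "(\<Sum>x\<in>B. \<nu> x) = (\<Sum>w\<in>T. \<Sum>x\<in>B. pmf \<mu> w * of_bool (\<phi> w = x))"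
      unfolding \<nu>_def by (rule sum.swap)
    also have "\<dots> = (\<Sum>w\<in>T. if \<phi> w \<in> B then pmf \<mu> w else 0)"
      using fB by (intro sum.cong) (auto simp: of_bool_def if_distrib sum.delta' cong: if_cong)
    also have "\<dots> = (\<Sum>w\<in>{w\<in>T. \<phi> w \<in> B}. pmf \<mu> w)" using T by (simp add: sum.inter_filter)
    also have "{w\<in>T. \<phi> w \<in> B} = \<phi> -` B \<inter> T" by auto
    finally show ?thesis using T by (simp add: measure_measure_pmf_finite)
  qed
  have m: "(\<Sum>x\<in>C. \<nu> x) = m"
    using sum_\<nu>[of C] T(2) by (simp add: m_def Int_absorb1 image_subset_iff_subset_vimage)
  have sq: "(\<Sum>x\<in>C. (\<nu> x)\<^sup>2) = (\<Sum>w\<in>T. \<Sum>w'\<in>T. pmf \<mu> w * pmf \<mu> w' * of_bool (\<phi> w = \<phi> w'))"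
  proof -
    have "(\<Sum>x\<in>C. (\<nu> x)\<^sup>2) = (\<Sum>x\<in>C. \<Sum>w\<in>T. \<Sum>w'\<in>T. pmf \<mu> w * pmf \<mu> w' * (of_bool (\<phi> w = x) * of_bool (\<phi> w' = x)))"
      unfolding \<nu>_def power2_eq_square sum_product by (simp add: mult_ac)
    also have "\<dots> = (\<Sum>w\<in>T. \<Sum>w'\<in>T. \<Sum>x\<in>C. pmf \<mu> w * pmf \<mu> w' * (of_bool (\<phi> w = x) * of_bool (\<phi> w' = x)))"
      by (subst sum.swap, intro sum.cong refl, rule sum.swap)
    also have "\<dots> = (\<Sum>w\<in>T. \<Sum>w'\<in>T. pmf \<mu> w * pmf \<mu> w' * of_bool (\<phi> w = \<phi> w'))"
    proof (intro sum.cong refl)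
      fix w w' assume w: "w \<in> T" "w' \<in> T"
      have "(\<Sum>x\<in>C. of_bool (\<phi> w = x) * of_bool (\<phi> w' = x)) = (\<Sum>x\<in>C. if x = \<phi> w then of_bool (\<phi> w = \<phi> w') else (0::real))"
        by (intro sum.cong) auto
      also have "\<dots> = of_bool (\<phi> w = \<phi> w')" using w T C by (subst sum.delta) auto
      finally show "(\<Sum>x\<in>C. pmf \<mu> w * pmf \<mu> w' * (of_bool (\<phi> w = x) * of_bool (\<phi> w' = x))) = pmf \<mu> w * pmf \<mu> w' * of_bool (\<phi> w = \<phi> w')"
        by (simp only: sum_distrib_left[symmetric])
    qed
    finally show ?thesis .
  qed
  \<comment> \<open>The excess \<open>X\<close> is \<open>card C\<close> times a squared L2
    distance, that between the image of the restricted law and the uniform measure of the same mass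
    \<open>m\<close>. This shows that it is nonnegative, which Markov's inequality requires later
    on.\<close>
  have dev: "?n * (\<Sum>x\<in>C. (\<nu> x - m / ?n)\<^sup>2) = X"
  proof -
    have "(\<Sum>x\<in>C. (\<nu> x - m / ?n)\<^sup>2) = (\<Sum>x\<in>C. (\<nu> x)\<^sup>2) - 2 * (m / ?n) * (\<Sum>x\<in>C. \<nu> x) + ?n * (m / ?n)\<^sup>2"
    proof -
      have "(\<Sum>x\<in>C. (\<nu> x - m / ?n)\<^sup>2) = (\<Sum>x\<in>C. (\<nu> x)\<^sup>2 - 2 * (m / ?n) * \<nu> x + (m / ?n)\<^sup>2)"
        by (intro sum.cong refl) (simp add: power2_diff)
      then show ?thesis
        by (simp only: sum.distrib sum_subtractf sum_distrib_left[symmetric] sum_constant)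
    qed
    moreover have "?n * (q - 2 * (m / ?n) * m + ?n * (m / ?n)\<^sup>2) = ?n * q - m\<^sup>2" for q
      using n by (simp add: field_simps power2_eq_square)
    ultimately show ?thesis by (simp only: m sq X_def)
  qed
  show X: "0 \<le> X" unfolding dev[symmetric] using n by (intro mult_nonneg_nonneg sum_nonneg) auto
  have l1: "(\<Sum>x\<in>C. \<bar>\<nu> x - m / ?n\<bar>) \<le> sqrt X"
  proof (rule real_le_rsqrt)
    have "(\<Sum>x\<in>C. \<bar>\<nu> x - m / ?n\<bar>)\<^sup>2 \<le> ?n * (\<Sum>x\<in>C. \<bar>\<nu> x - m / ?n\<bar>\<^sup>2)"
      using sum_squared_le_sum_of_squares[of "\<lambda>x. \<bar>\<nu> x - m / ?n\<bar>" C] by (simp add: mult.commute)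
    then show "(\<Sum>x\<in>C. \<bar>\<nu> x - m / ?n\<bar>)\<^sup>2 \<le> X" using dev by simp
  qed
  show "tv_dist (map_pmf \<phi> \<mu>) (pmf_of_set C) \<le> 1 - m + sqrt X"
  proof (rule tv_dist_le)
    fix A
    let ?r = "measure_pmf.prob \<mu> (\<phi> -` A - T)" and ?u = "measure_pmf.prob (pmf_of_set C) A"
    have u: "?u = card (C \<inter> A) / ?n" using C by (simp add: measure_pmf_of_set)
    have "measure_pmf.prob \<mu> (\<phi> -` A) = measure_pmf.prob \<mu> (\<phi> -` A \<inter> T) + ?r"
      by (subst measure_pmf.finite_measure_Union[symmetric]) (auto intro!: arg_cong[where f="measure_pmf.prob \<mu>"])
    also have "\<phi> -` A \<inter> T = \<phi> -` (C \<inter> A) \<inter> T" using T by auto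
    also have "measure_pmf.prob \<mu> (\<phi> -` (C \<inter> A) \<inter> T) = (\<Sum>x\<in>C \<inter> A. \<nu> x)" by (subst sum_\<nu>) auto
    also have "(\<Sum>x\<in>C \<inter> A. \<nu> x) = (\<Sum>x\<in>C \<inter> A. \<nu> x - m / ?n) + m * ?u"
      by (simp add: sum_subtractf u)
    finally have eq: "measure_pmf.prob (map_pmf \<phi> \<mu>) A - ?u = (\<Sum>x\<in>C \<inter> A. \<nu> x - m / ?n) + (?r - (1 - m) * ?u)"
      by (simp add: algebra_simps)
    have "\<bar>\<Sum>x\<in>C \<inter> A. \<nu> x - m / ?n\<bar> \<le> (\<Sum>x\<in>C \<inter> A. \<bar>\<nu> x - m / ?n\<bar>)" by (rule sum_abs)
    also have "\<dots> \<le> (\<Sum>x\<in>C. \<bar>\<nu> x - m / ?n\<bar>)" using C by (intro sum_mono2) auto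
    finally have 1: "\<bar>\<Sum>x\<in>C \<inter> A. \<nu> x - m / ?n\<bar> \<le> sqrt X" using l1 by linarith
    have m1: "0 \<le> 1 - m" by (simp add: m_def)
    have "?r \<le> measure_pmf.prob \<mu> (- T)" by (intro measure_pmf.finite_measure_mono) auto
    also have "\<dots> = 1 - m" unfolding m_def using measure_pmf.prob_compl[of T \<mu>] by (simp add: Compl_eq_Diff_UNIV)
    finally have r: "0 \<le> ?r" "?r \<le> 1 - m" by auto
    \<comment> \<open>Both quantities lie between 0 and \<open>1 - m\<close>, so their difference
      costs \<open>1 - m\<close> and not twice as much; with a factor 2 the limit profile would be
      lost.\<close>
    have "0 \<le> (1 - m) * ?u" by (rule mult_nonneg_nonneg[OF m1]) simp
    moreover have "(1 - m) * ?u \<le> 1 - m" by (rule mult_left_le[OF _ m1]) simp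
    ultimately have 2: "\<bar>?r - (1 - m) * ?u\<bar> \<le> 1 - m" using r by linarith
    show "\<bar>measure_pmf.prob (map_pmf \<phi> \<mu>) A - ?u\<bar> \<le> 1 - m + sqrt X"
      unfolding eq using 1 2 by linarith
  qed
qed

section \<open>Distance of the Cayley walk from uniform\<close>

context finite_comm_group
begin

lemma set_cayley_law: "Z \<in> {..<k} \<rightarrow> carrier G \<Longrightarrow> k > 0 \<Longrightarrow> set_pmf (cayley_law ori G k Z t) \<subseteq> carrier G"
  by (auto simp: cayley_law_word word_closed)

lemma uniform_stationary:
  assumes Z: "Z \<in> {..<k} \<rightarrow> carrier G" and k: "k > 0"
  shows "bind_pmf (pmf_of_set (carrier G)) (\<lambda>y. ct_walk (cayley_step ori G k Z) y t) = pmf_of_set (carrier G)"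
proof -
  let ?U = "pmf_of_set (carrier G)"
  have "map_pmf (\<lambda>g. g \<otimes> a) ?U = ?U" if "a \<in> carrier G" for a
  proof (rule map_pmf_of_set_bij_betw)
    show "bij_betw (\<lambda>g. g \<otimes> a) (carrier G) (carrier G)"
    proof (rule bij_betwI[where g = "\<lambda>g. g \<otimes> inv a"])
    qed (use that in \<open>auto simp: m_assoc\<close>)
  qed (use finite_carrier in auto)
  then have inv: "map_pmf (\<lambda>g. g \<otimes> Z i [^] (\<sigma>::int)) ?U = ?U" if "i < k" for i \<sigma>
    using Z that by (auto simp: Pi_iff)
  have "bind_pmf ?U (cayley_step ori G k Z) = bind_pmf (pmf_of_set {..<k}) (\<lambda>i. bind_pmf (jump_sign ori)
      (\<lambda>\<sigma>. map_pmf (\<lambda>g. g \<otimes> Z i [^] \<sigma>) ?U))"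
    unfolding cayley_step_def map_pmf_def
    by (subst bind_commute_pmf, subst (2) bind_commute_pmf) simp
  also have "\<dots> = bind_pmf (pmf_of_set {..<k}) (\<lambda>i. bind_pmf (jump_sign ori) (\<lambda>\<sigma>. ?U))"
    using k by (intro bind_pmf_cong refl) (auto simp: inv lessThan_empty_iff)
  finally have step: "bind_pmf ?U (cayley_step ori G k Z) = ?U" by simp
  have chain: "chain_law (cayley_step ori G k Z) n ?U = ?U" for n
    by (induction n) (simp_all add: chain_law_Suc step)
  have "bind_pmf ?U (\<lambda>y. ct_walk (cayley_step ori G k Z) y t)
     = bind_pmf (jump_count t) (\<lambda>n. bind_pmf ?U (\<lambda>y. chain_law (cayley_step ori G k Z) n (return_pmf y)))"
    unfolding ct_walk_chain_law by (rule bind_commute_pmf)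
  also have "\<dots> = ?U"
    by (simp add: chain_law_bind[symmetric] bind_return_pmf' chain)
  finally show ?thesis .
qed

text \<open>Both laws are sent through the same transition kernel, which fixes the uniform law and
  cannot increase the distance.\<close>

lemma cayley_dist_antimono:
  assumes Z: "Z \<in> {..<k} \<rightarrow> carrier G" and k: "k > 0" and t: "0 \<le> s" "s \<le> t"
  shows "cayley_dist ori G k Z t \<le> cayley_dist ori G k Z s"
proof -
  let ?F = "\<lambda>y. ct_walk (cayley_step ori G k Z) y (t - s)"
  have "cayley_law ori G k Z t = bind_pmf (cayley_law ori G k Z s) ?F"
    unfolding cayley_law_def using ct_walk_add[of s "t - s" "cayley_step ori G k Z" \<one>] t by simp
  then have "cayley_dist ori G k Z t = tv_dist (bind_pmf (cayley_law ori G k Z s) ?F) (bind_pmf (pmf_of_set (carrier G)) ?F)"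
    unfolding cayley_dist_def uniform_stationary[OF Z k] by simp
  also have "\<dots> \<le> cayley_dist ori G k Z s"
    unfolding cayley_dist_def
    using finite_carrier set_cayley_law[OF Z k] set_pmf_of_set[of "carrier G"]
    by (intro tv_dist_bind_le[of "carrier G"]) blast+
  finally show ?thesis .
qed

text \<open>The distinguishing set is the image of the heavy points. There are at most
  \<open>exp (- \<omega>)\<close> times the group order of them, and no choice of \<open>Z\<close>
  can make their image larger.\<close>

lemma cayley_dist_lower:
  assumes Z: "Z \<in> {..<k} \<rightarrow> carrier G" and k: "k > 0"
  shows "measure_pmf.prob (lattice_law ori k t) {w. exp \<omega> / card (carrier G) \<le> pmf (lattice_law ori k t) w} - exp (- \<omega>)
           \<le> cayley_dist ori G k Z t"
proof -
  let ?\<mu> = "lattice_law ori k t" and ?n = "real (card (carrier G))"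
  have n: "?n > 0" using finite_carrier by (simp add: card_gt_0_iff) blast
  let ?S = "{w. exp \<omega> / ?n \<le> pmf ?\<mu> w}"
  let ?A = "word G k Z ` ?S"
  have c: "exp \<omega> / ?n > 0" using n by simp
  have "card ?A \<le> card ?S" using large_atoms(1)[OF c] by (rule card_image_le)
  also have "real (card ?S) \<le> 1 / (exp \<omega> / ?n)" by (rule large_atoms(2)[OF c])
  also have "\<dots> = ?n * exp (- \<omega>)" by (simp add: exp_minus field_simps)
  finally have cA: "card ?A / ?n \<le> exp (- \<omega>)" using n by (simp add: field_simps)
  have "measure_pmf.prob (pmf_of_set (carrier G)) ?A = card (carrier G \<inter> ?A) / ?n"
    using finite_carrier n by (intro measure_pmf_of_set) auto
  also have "\<dots> \<le> card ?A / ?n"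
    using n large_atoms(1)[OF c] by (intro divide_right_mono) (auto intro!: card_mono)
  finally have u: "measure_pmf.prob (pmf_of_set (carrier G)) ?A \<le> exp (- \<omega>)" using cA by linarith
  have "measure_pmf.prob ?\<mu> ?S \<le> measure_pmf.prob ?\<mu> (word G k Z -` ?A)"
    by (intro measure_pmf.finite_measure_mono) auto
  also have "\<dots> = measure_pmf.prob (cayley_law ori G k Z t) ?A"
    unfolding cayley_law_word[OF Z k] by simp
  finally show ?thesis
    using u tv_dist_ge[of "cayley_law ori G k Z t" ?A "pmf_of_set (carrier G)"] unfolding cayley_dist_def by linarith
qed

text \<open>Typical points lie in a box so that only the moduli up to \<open>2 * L\<close> occur and
  the sum over moduli is short.\<close>

lemma gcd_difference:
  fixes w w' :: "nat \<Rightarrow> int"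
  assumes w: "\<forall>i\<ge>k. w i = 0" "\<forall>i<k. \<bar>w i\<bar> \<le> int L" and w': "\<forall>i\<ge>k. w' i = 0" "\<forall>i<k. \<bar>w' i\<bar> \<le> int L"
    and ne: "w \<noteq> w'"
  obtains g where "g > 0" "g \<le> 2 * L" "Gcd ((\<lambda>i. w i - w' i) ` {..<k}) = int g" "\<forall>i<k. int g dvd w i - w' i"
proof -
  let ?g = "Gcd ((\<lambda>i. w i - w' i) ` {..<k})"
  obtain i where "w i \<noteq> w' i" using ne by blast
  with w w' have i: "i < k" "w i - w' i \<noteq> 0" by (metis not_less, simp)
  have dvd: "?g dvd w j - w' j" if "j < k" for j using that by (intro Gcd_dvd) auto
  have "?g \<noteq> 0"
  proof
    assume "?g = 0"
    with dvd[OF i(1)] have "0 dvd w i - w' i" by (simp only:)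
    with i(2) show False by simp
  qed
  then have pos: "?g > 0" by (simp only: less_le Gcd_int_greater_eq_0) simp
  have "?g \<le> \<bar>w i - w' i\<bar>" using dvd_imp_le_int[OF i(2) dvd[OF i(1)]] by simp
  also have "\<dots> \<le> 2 * int L" using w(2)[rule_format, OF i(1)] w'(2)[rule_format, OF i(1)] by linarith
  finally have le: "?g \<le> 2 * int L" .
  have eq: "?g = int (nat ?g)" using pos by simp
  show ?thesis
  proof (rule that[of "nat ?g"])
    show "0 < nat ?g" using pos by simp
    show "nat ?g \<le> 2 * L" using le by linarith
    show "?g = int (nat ?g)" by (rule eq)
    show "\<forall>i<k. int (nat ?g) dvd w i - w' i" using dvd unfolding eq[symmetric] by blast
  qed
qed

lemma set_iid_generators: "Z \<in> set_pmf (iid_generators G k) \<Longrightarrow> Z \<in> {..<k} \<rightarrow>\<^sub>E carrier G"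
proof -
  assume "Z \<in> set_pmf (iid_generators G k)"
  moreover have "carrier G \<noteq> {}" by blast
  ultimately show ?thesis
    unfolding iid_generators_def using finite_carrier
    by (auto simp: set_Pi_pmf PiE_dflt_def PiE_def extensional_def)
qed

text \<open>Markov's inequality for the collision excess, averaged over the generators. Subtracting
  \<open>m\<^sup>2\<close> takes 1 off the weight of every pair, which cancels the pairs whose
  difference has gcd 1. What remains are the equal pairs, with weight the group order, and the pairs
  congruent modulo some \<open>\<gamma> \<ge> 2\<close>.\<close>

lemma prob_cayley_dist_large:
  fixes k L :: nat and ori :: orientation and t :: real
  assumes k: "k > 0" and T: "finite T" "\<And>w. w \<in> T \<Longrightarrow> (\<forall>i\<ge>k. w i = 0) \<and> (\<forall>i<k. \<bar>w i\<bar> \<le> int L)"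
    and \<eta>: "\<eta> > 0"
  defines "\<mu> \<equiv> lattice_law ori k t"
  shows "measure_pmf.prob (iid_generators G k) {Z. cayley_dist ori G k Z t > 1 - measure_pmf.prob \<mu> T + sqrt \<eta>}
     \<le> (card (carrier G) * (\<Sum>w\<in>T. (pmf \<mu> w)\<^sup>2) + (\<Sum>\<gamma>=2..2*L. real \<gamma> ^ min_gen_size G *
           (\<Sum>w\<in>T. pmf \<mu> w * (\<Sum>w'\<in>{w'\<in>T. \<forall>i<k. int \<gamma> dvd w i - w' i}. pmf \<mu> w')))) / \<eta>"
proof -
  let ?n = "real (card (carrier G))" and ?I = "iid_generators G k" and ?d = "min_gen_size G"
  define m where "m = measure_pmf.prob \<mu> T"
  define eqv where "eqv Z w w' = (of_bool (word G k Z w = word G k Z w') :: real)" for Z w w'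
  define X where "X Z = ?n * (\<Sum>w\<in>T. \<Sum>w'\<in>T. pmf \<mu> w * pmf \<mu> w' * eqv Z w w') - m\<^sup>2" for Z
  \<comment> \<open>All common divisors are summed, not just the gcd. This overcounts, but
    congruence modulo a given \<open>\<gamma>\<close> is a condition on each coordinate separately,
    so that the mass of the pairs will factorise.\<close>
  define W where "W w w' = (if w = w' then ?n else 0) +
     (\<Sum>\<gamma>=2..2*L. real \<gamma> ^ ?d * of_bool (\<forall>i<k. int \<gamma> dvd w i - w' i))" for w w' :: "nat \<Rightarrow> int"
  have n: "?n > 0" using finite_carrier by (simp add: card_gt_0_iff) blast
  have ne: "carrier G \<noteq> {}" by blast
  have Zc: "Z \<in> {..<k} \<rightarrow> carrier G" if "Z \<in> set_pmf ?I" for Z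
    using set_iid_generators[OF that] by (auto simp: PiE_def)
  have fI: "finite (set_pmf ?I)"
  proof (rule finite_subset)
    show "set_pmf ?I \<subseteq> {..<k} \<rightarrow>\<^sub>E carrier G" using set_iid_generators by blast
  qed (use finite_carrier in \<open>auto intro: finite_PiE\<close>)
  have int: "integrable ?I f" for f :: "_ \<Rightarrow> real" using fI by (rule integrable_measure_pmf_finite)
  have X: "0 \<le> X Z" "cayley_dist ori G k Z t \<le> 1 - m + sqrt (X Z)" if "Z \<in> set_pmf ?I" for Z
  proof -
    have "word G k Z ` T \<subseteq> carrier G" using word_closed[OF Zc[OF that]] by auto
    note c = tv_dist_collision[OF finite_carrier ne T(1) this, of \<mu>]
    show "0 \<le> X Z" using c(1) by (simp add: X_def eqv_def m_def)
    show "cayley_dist ori G k Z t \<le> 1 - m + sqrt (X Z)"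
      using c(2) unfolding cayley_dist_def cayley_law_word[OF Zc[OF that] k] \<mu>_def[symmetric]
      by (simp add: X_def eqv_def m_def)
  qed
  have eqvE: "?n * measure_pmf.expectation ?I (\<lambda>Z. eqv Z w w') - 1 \<le> W w w'" if w: "w \<in> T" "w' \<in> T" for w w'
  proof (cases "w = w'")
    case True
    then have "measure_pmf.expectation ?I (\<lambda>Z. eqv Z w w') = 1" by (simp add: eqv_def)
    moreover have "W w w' \<ge> ?n" unfolding W_def using True by (auto intro!: sum_nonneg)
    ultimately show ?thesis by simp
  next
    case False
    obtain g where g: "g > 0" "g \<le> 2 * L" "Gcd ((\<lambda>i. w i - w' i) ` {..<k}) = int g" "\<forall>i<k. int g dvd w i - w' i"
      using gcd_difference[OF T(2)[OF w(1), THEN conjunct1] T(2)[OF w(1), THEN conjunct2]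
          T(2)[OF w(2), THEN conjunct1] T(2)[OF w(2), THEN conjunct2] False] by blast
    have "measure_pmf.expectation ?I (\<lambda>Z. eqv Z w w') = measure_pmf.expectation ?I (indicator {Z. word G k Z (\<lambda>i. w i - w' i) = \<one>})"
      by (intro integral_cong_AE) (auto simp: AE_measure_pmf_iff eqv_def word_eq_iff[OF Zc] indicator_def)
    then have "measure_pmf.expectation ?I (\<lambda>Z. eqv Z w w') = measure_pmf.prob ?I {Z. word G k Z (\<lambda>i. w i - w' i) = \<one>}"
      by simp
    then have b: "?n * measure_pmf.expectation ?I (\<lambda>Z. eqv Z w w') \<le> real g ^ ?d"
      using prob_word_trivial[OF g(3,1)] by simp
    have nn: "0 \<le> real \<gamma> ^ ?d * of_bool (\<forall>i<k. int \<gamma> dvd w i - w' i)" for \<gamma> by simp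
    show ?thesis
    proof (cases "g = 1")
      \<comment> \<open>The difference has gcd 1, so its word is trivial with probability at most
        one over the group order, and the subtracted 1 compensates for it.\<close>
      case True
      have "0 \<le> W w w'" unfolding W_def using n nn by (intro add_nonneg_nonneg sum_nonneg) auto
      then show ?thesis using b True by simp
    next
      case False
      then have "g \<in> {2..2*L}" using g by auto
      then have "real g ^ ?d * of_bool (\<forall>i<k. int g dvd w i - w' i) \<le> (\<Sum>\<gamma>=2..2*L. real \<gamma> ^ ?d * of_bool (\<forall>i<k. int \<gamma> dvd w i - w' i))"
        by (intro member_le_sum nn) auto
      then have "real g ^ ?d \<le> W w w'" unfolding W_def using g(4) \<open>w \<noteq> w'\<close> by simp
      then show ?thesis using b by linarith
    qed
  qed
  have inner: "(\<Sum>w'\<in>T. if P w' then a * pmf \<mu> w' else 0) = a * (\<Sum>w'\<in>{w'\<in>T. P w'}. pmf \<mu> w')" for P a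
    unfolding sum_distrib_left by (simp add: sum.inter_filter[OF T(1)])
  have m2: "m\<^sup>2 = (\<Sum>w\<in>T. \<Sum>w'\<in>T. pmf \<mu> w * pmf \<mu> w')"
    unfolding m_def using T by (simp add: measure_measure_pmf_finite power2_eq_square sum_product)
  have "measure_pmf.expectation ?I X = ?n * (\<Sum>w\<in>T. \<Sum>w'\<in>T. pmf \<mu> w * pmf \<mu> w' * measure_pmf.expectation ?I (\<lambda>Z. eqv Z w w')) - m\<^sup>2"
    unfolding X_def by (simp add: int Bochner_Integration.integral_diff Bochner_Integration.integral_sum)
  also have "\<dots> = (\<Sum>w\<in>T. \<Sum>w'\<in>T. pmf \<mu> w * pmf \<mu> w' * (?n * measure_pmf.expectation ?I (\<lambda>Z. eqv Z w w') - 1))"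
    unfolding m2 by (simp add: sum_distrib_left sum_subtractf right_diff_distrib mult_ac)
  also have "\<dots> \<le> (\<Sum>w\<in>T. \<Sum>w'\<in>T. pmf \<mu> w * pmf \<mu> w' * W w w')"
    by (intro sum_mono mult_left_mono eqvE) auto
  also have "\<dots> = (\<Sum>w\<in>T. \<Sum>w'\<in>T. if w = w' then ?n * (pmf \<mu> w * pmf \<mu> w') else 0) + (\<Sum>w\<in>T. \<Sum>w'\<in>T. \<Sum>\<gamma>=2..2*L. real \<gamma> ^ ?d *
       (if \<forall>i<k. int \<gamma> dvd w i - w' i then pmf \<mu> w * pmf \<mu> w' else 0))"
    unfolding sum.distrib[symmetric]
  proof (intro sum.cong refl)
    fix w w'
    have "(\<Sum>\<gamma>=2..2*L. real \<gamma> ^ ?d * (if \<forall>i<k. int \<gamma> dvd w i - w' i then pmf \<mu> w * pmf \<mu> w' else 0))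
       = pmf \<mu> w * pmf \<mu> w' * (\<Sum>\<gamma>=2..2*L. real \<gamma> ^ ?d * of_bool (\<forall>i<k. int \<gamma> dvd w i - w' i))"
      unfolding sum_distrib_left by (intro sum.cong refl) simp
    then show "pmf \<mu> w * pmf \<mu> w' * W w w' = (if w = w' then ?n * (pmf \<mu> w * pmf \<mu> w') else 0) +
       (\<Sum>\<gamma>=2..2*L. real \<gamma> ^ ?d * (if \<forall>i<k. int \<gamma> dvd w i - w' i then pmf \<mu> w * pmf \<mu> w' else 0))"
      by (simp add: W_def distrib_left)
  qed
  also have "(\<Sum>w\<in>T. \<Sum>w'\<in>T. if w = w' then ?n * (pmf \<mu> w * pmf \<mu> w') else 0) = ?n * (\<Sum>w\<in>T. (pmf \<mu> w)\<^sup>2)"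
    using T by (simp add: sum_distrib_left power2_eq_square)
  also have "(\<Sum>w\<in>T. \<Sum>w'\<in>T. \<Sum>\<gamma>=2..2*L. real \<gamma> ^ ?d * (if \<forall>i<k. int \<gamma> dvd w i - w' i then pmf \<mu> w * pmf \<mu> w' else 0))
     = (\<Sum>\<gamma>=2..2*L. real \<gamma> ^ ?d * (\<Sum>w\<in>T. pmf \<mu> w * (\<Sum>w'\<in>{w'\<in>T. \<forall>i<k. int \<gamma> dvd w i - w' i}. pmf \<mu> w')))"
  proof -
    have "(\<Sum>w\<in>T. \<Sum>w'\<in>T. \<Sum>\<gamma>=2..2*L. real \<gamma> ^ ?d * (if \<forall>i<k. int \<gamma> dvd w i - w' i then pmf \<mu> w * pmf \<mu> w' else 0))
      = (\<Sum>w\<in>T. \<Sum>\<gamma>=2..2*L. \<Sum>w'\<in>T. real \<gamma> ^ ?d * (if \<forall>i<k. int \<gamma> dvd w i - w' i then pmf \<mu> w * pmf \<mu> w' else 0))"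
      by (intro sum.cong refl sum.swap)
    also have "\<dots> = (\<Sum>\<gamma>=2..2*L. \<Sum>w\<in>T. \<Sum>w'\<in>T. real \<gamma> ^ ?d * (if \<forall>i<k. int \<gamma> dvd w i - w' i then pmf \<mu> w * pmf \<mu> w' else 0))"
      by (rule sum.swap)
    finally show ?thesis
      unfolding sum_distrib_left[symmetric] by (simp only: inner)
  qed
  finally have EX: "measure_pmf.expectation ?I X \<le> ?n * (\<Sum>w\<in>T. (pmf \<mu> w)\<^sup>2) + (\<Sum>\<gamma>=2..2*L. real \<gamma> ^ ?d * (\<Sum>w\<in>T. pmf \<mu> w * (\<Sum>w'\<in>{w'\<in>T. \<forall>i<k. int \<gamma> dvd w i - w' i}. pmf \<mu> w')))" .
  have "measure_pmf.prob ?I {Z. cayley_dist ori G k Z t > 1 - m + sqrt \<eta>} \<le> measure_pmf.prob ?I {Z\<in>space ?I. X Z \<ge> \<eta>}"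
  proof (rule measure_pmf.finite_measure_mono_AE)
    show "AE Z in ?I. Z \<in> {Z. cayley_dist ori G k Z t > 1 - m + sqrt \<eta>} \<longrightarrow> Z \<in> {Z\<in>space ?I. X Z \<ge> \<eta>}"
    proof (intro AE_pmfI impI)
      fix Z assume Z: "Z \<in> set_pmf ?I" "Z \<in> {Z. cayley_dist ori G k Z t > 1 - m + sqrt \<eta>}"
      then have "1 - m + sqrt \<eta> < cayley_dist ori G k Z t" by simp
      with X(2)[OF Z(1)] have "sqrt \<eta> < sqrt (X Z)" by linarith
      then show "Z \<in> {Z\<in>space ?I. X Z \<ge> \<eta>}" by simp
    qed
  qed auto
  also have "\<dots> \<le> measure_pmf.expectation ?I X / \<eta>"
    using X(1) \<eta> by (intro integral_Markov_inequality_measure[where A=UNIV] int) (auto simp: AE_measure_pmf_iff)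
  also have "\<dots> \<le> (?n * (\<Sum>w\<in>T. (pmf \<mu> w)\<^sup>2) + (\<Sum>\<gamma>=2..2*L. real \<gamma> ^ ?d * (\<Sum>w\<in>T. pmf \<mu> w * (\<Sum>w'\<in>{w'\<in>T. \<forall>i<k. int \<gamma> dvd w i - w' i}. pmf \<mu> w')))) / \<eta>"
    using EX \<eta> by (intro divide_right_mono) auto
  finally show ?thesis unfolding m_def by simp
qed

end

section \<open>Coordinates modulo an integer\<close>

definition residue_prob :: "orientation \<Rightarrow> real \<Rightarrow> nat \<Rightarrow> int \<Rightarrow> real" where
  "residue_prob ori s \<gamma> r = measure_pmf.prob (one_law ori s) {x. int \<gamma> dvd r - x}"

lemma residue_prob_bounds: "0 \<le> residue_prob ori s \<gamma> r" "residue_prob ori s \<gamma> r \<le> 1"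
  by (auto simp: residue_prob_def)

lemma pmf_le_residue_prob: "pmf (one_law ori s) x \<le> residue_prob ori s \<gamma> x"
  unfolding residue_prob_def pmf_eq_prob by (intro measure_pmf.finite_measure_mono) auto

text \<open>The class of 0 modulo \<open>\<gamma> \<ge> 2\<close> misses the points of absolute
  value 1.\<close>

lemma residue_prob_zero_le:
  assumes "s \<ge> 0" "\<gamma> \<ge> 2" "int \<gamma> dvd r"
  shows "residue_prob ori s \<gamma> r \<le> 1 - s * exp (- s)"
proof -
  have "int \<gamma> dvd x" if "int \<gamma> dvd r - x" for x using that assms(3) by (metis dvd_diff_right_iff dvd_diff_commute)
  moreover have "\<not> int \<gamma> dvd x" if "\<bar>x\<bar> = 1" for x using that assms(2) by (auto simp: abs_if split: if_splits)
  ultimately have "{x. int \<gamma> dvd r - x} \<subseteq> UNIV - {x. \<bar>x\<bar> = 1}" by blast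
  then have "residue_prob ori s \<gamma> r \<le> measure_pmf.prob (one_law ori s) (UNIV - {x. \<bar>x\<bar> = 1})"
    unfolding residue_prob_def by (intro measure_pmf.finite_measure_mono) auto
  also have "\<dots> = 1 - measure_pmf.prob (one_law ori s) {x. \<bar>x\<bar> = 1}"
    using measure_pmf.prob_compl[of "{x. \<bar>x\<bar> = 1}" "one_law ori s"] by simp
  finally show ?thesis using one_law_unit[OF assms(1), of ori] by linarith
qed

lemma prob_nonzero_le: "s \<ge> 0 \<Longrightarrow> 0 \<notin> A \<Longrightarrow> measure_pmf.prob (one_law ori s) A \<le> 1 - exp (- s)"
proof -
  assume s: "s \<ge> 0" and A: "0 \<notin> A"
  have "measure_pmf.prob (one_law ori s) A \<le> measure_pmf.prob (one_law ori s) (UNIV - {0})"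
    using A by (intro measure_pmf.finite_measure_mono) auto
  also have "\<dots> = 1 - pmf (one_law ori s) 0"
    using measure_pmf.prob_compl[of "{0}" "one_law ori s"] by (simp add: measure_pmf_single)
  finally show ?thesis using cpmf_lower[OF s, of 0 ori] s by (simp add: cpmf_eq)
qed

text \<open>Every residue class misses either 0 or the points of absolute value 1, hence a definite
  amount of mass.\<close>

lemma residue_prob_le:
  assumes "s \<ge> 0" "\<gamma> \<ge> 2"
  shows "residue_prob ori s \<gamma> r \<le> 1 - min (s * exp (- s)) (exp (- s))"
proof (cases "int \<gamma> dvd r")
  case True
  then show ?thesis using residue_prob_zero_le[OF assms True, of ori] by linarith
next
  case False
  then have "residue_prob ori s \<gamma> r \<le> 1 - exp (- s)"
    unfolding residue_prob_def using assms by (intro prob_nonzero_le) auto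
  then show ?thesis by linarith
qed

lemma residue_prob_unit_le:
  assumes "s \<ge> 0" "\<gamma> \<ge> 2" "\<bar>r\<bar> = 1"
  shows "residue_prob ori s \<gamma> r \<le> s"
proof -
  have "\<not> int \<gamma> dvd r" using assms by (auto simp: abs_if split: if_splits)
  then have "int 1 \<le> \<bar>y\<bar>" if "int \<gamma> dvd r - y" for y using that by (cases "y = 0") auto
  then have "residue_prob ori s \<gamma> r \<le> s ^ 1 / fact 1"
    unfolding residue_prob_def using assms(1) by (intro one_law_tail) auto
  then show ?thesis by simp
qed

text \<open>Every other member of the class of \<open>x\<close> is at distance at least
  \<open>\<gamma>\<close> from \<open>x\<close>, so its absolute value is at least
  \<open>\<gamma> - M \<ge> M\<close>.\<close>

lemma residue_prob_large:
  assumes "s \<ge> 0" "\<bar>x\<bar> \<le> int M" "\<gamma> \<ge> 2 * M"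
  shows "residue_prob ori s \<gamma> x \<le> pmf (one_law ori s) x + s ^ M / fact M"
proof -
  let ?P = "measure_pmf.prob (one_law ori s)"
  have "{y. int \<gamma> dvd x - y} \<subseteq> {x} \<union> {y. int \<gamma> dvd x - y \<and> x \<noteq> y}" by auto
  then have "residue_prob ori s \<gamma> x \<le> ?P ({x} \<union> {y. int \<gamma> dvd x - y \<and> x \<noteq> y})"
    unfolding residue_prob_def by (intro measure_pmf.finite_measure_mono) auto
  also have "\<dots> \<le> ?P {x} + ?P {y. int \<gamma> dvd x - y \<and> x \<noteq> y}"
    by (rule measure_Un_le) auto
  also have "?P {y. int \<gamma> dvd x - y \<and> x \<noteq> y} \<le> s ^ M / fact M"
  proof (rule one_law_tail[OF assms(1)])
    fix y assume "y \<in> {y. int \<gamma> dvd x - y \<and> x \<noteq> y}"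
    then have "int \<gamma> \<le> \<bar>x - y\<bar>" using dvd_imp_le_int[of "x - y" "int \<gamma>"] by simp
    then show "int M \<le> \<bar>y\<bar>" using assms by linarith
  qed
  finally show ?thesis by (simp add: measure_pmf_single)
qed

text \<open>What one coordinate contributes to the congruent mass after \<open>powr (1/4)\<close> of
  its probability has been given away. It enters with the power \<open>k\<close>, so 1 is the
  critical value.\<close>

definition tilted_sum :: "orientation \<Rightarrow> real \<Rightarrow> nat \<Rightarrow> nat \<Rightarrow> real" where
  "tilted_sum ori s \<gamma> L = (\<Sum>x\<in>{- int L..int L}. pmf (one_law ori s) x powr (3/4) * residue_prob ori s \<gamma> x)"

definition root_bd :: "real \<Rightarrow> nat \<Rightarrow> real" where
  "root_bd S n = (S ^ n / fact n) powr (3/4)"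

lemma root_bd_nonneg: "root_bd S n \<ge> 0"
  by (simp add: root_bd_def)

lemma root_bd_summable:
  assumes "S \<ge> 0"
  shows "summable (root_bd S)"
proof -
  define m where "m = max 1 S"
  have m: "m \<ge> 1" by (simp add: m_def)
  \<comment> \<open>With 16, the ratio of consecutive terms is at most the square root of
    \<open>1/16\<close>, which is below \<open>1/2\<close>.\<close>
  obtain N :: nat where N: "real N \<ge> m * 16" using real_arch_simple by blast
  show ?thesis
  proof (rule summable_ratio_test[where c = "1/2" and N = N])
    fix n assume n: "n \<ge> N"
    have S16: "S * 16 \<le> real (Suc n)" using N n m_def m by (smt (verit) max.cobounded2 of_nat_Suc of_nat_mono)
    have "root_bd S (Suc n) = (S / real (Suc n) * (S ^ n / fact n)) powr (3/4)"
      unfolding root_bd_def by (simp add: field_simps)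
    also have "\<dots> = (S / real (Suc n)) powr (3/4) * root_bd S n"
      using assms unfolding root_bd_def by (subst powr_mult) auto
    also have "(S / real (Suc n)) powr (3/4) \<le> (1/16) powr (3/4)"
      using assms S16 by (intro powr_mono2) (auto simp: field_simps)
    also have "(1/16::real) powr (3/4) \<le> (1/16) powr (1/2)" by (rule powr_mono') auto
    also have "\<dots> = sqrt (1/16)" by (simp add: powr_half_sqrt)
    also have "\<dots> \<le> 1/2" by (rule real_le_lsqrt) (auto simp: power2_eq_square)
    finally show "norm (root_bd S (Suc n)) \<le> 1/2 * norm (root_bd S n)"
      using root_bd_nonneg[of S n] root_bd_nonneg[of S "Suc n"] by (simp add: mult_right_mono)
  qed simp
qed

lemma pmf_root_le:
  assumes "0 \<le> s" "s \<le> S"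
  shows "pmf (one_law ori s) x powr (3/4) \<le> root_bd S (nat \<bar>x\<bar>)"
proof -
  have "pmf (one_law ori s) x \<le> s ^ nat \<bar>x\<bar> / fact (nat \<bar>x\<bar>)"
    using cpmf_upper[OF assms(1), of ori x] assms by (simp add: cpmf_eq)
  also have "\<dots> \<le> S ^ nat \<bar>x\<bar> / fact (nat \<bar>x\<bar>)" using assms by (intro divide_right_mono power_mono) auto
  finally show ?thesis unfolding root_bd_def by (intro powr_mono2) auto
qed

lemma sum_symmetric_int:
  fixes f :: "int \<Rightarrow> real"
  shows "(\<Sum>x\<in>{- int L..int L}. f x) = f 0 + (\<Sum>n<L. f (int (Suc n)) + f (- int (Suc n)))"
proof (induction L)
  case (Suc L)
  have "{- int (Suc L)..int (Suc L)} = insert (int (Suc L)) (insert (- int (Suc L)) {- int L..int L})" by auto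
  then have "(\<Sum>x\<in>{- int (Suc L)..int (Suc L)}. f x) = f (int (Suc L)) + (f (- int (Suc L)) + (\<Sum>x\<in>{- int L..int L}. f x))"
    by simp
  then show ?case by (simp add: Suc)
qed simp

lemma sum_symmetric_le:
  fixes g :: "nat \<Rightarrow> real"
  assumes "summable g" "\<And>n. g n \<ge> 0"
  shows "(\<Sum>x\<in>{- int L..int L}. g (nat \<bar>x\<bar>)) \<le> 2 * (\<Sum>n. g n)"
proof -
  have "(\<Sum>x\<in>{- int L..int L}. g (nat \<bar>x\<bar>)) = g 0 + 2 * (\<Sum>n<L. g (Suc n))"
    by (subst sum_symmetric_int) (simp add: nat_add_distrib sum_distrib_left)
  also have "\<dots> \<le> 2 * (g 0 + (\<Sum>n<L. g (Suc n)))" using assms(2)[of 0] by simp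
  also have "g 0 + (\<Sum>n<L. g (Suc n)) = (\<Sum>n<Suc L. g n)" by (simp only: sum.lessThan_Suc_shift)
  also have "\<dots> \<le> (\<Sum>n. g n)" using assms by (intro sum_le_suminf) auto
  finally show ?thesis by simp
qed

text \<open>For small \<open>s\<close> the loss of order \<open>s\<close> in the term \<open>x = 0\<close> dominates all the other terms.\<close>

lemma tilted_sum_small:
  obtains \<epsilon> where "\<epsilon> > 0" "\<And>s \<gamma> L. 0 < s \<Longrightarrow> s \<le> \<epsilon> \<Longrightarrow> \<gamma> \<ge> 2 \<Longrightarrow> tilted_sum ori s \<gamma> L \<le> 1"
proof -
  define B where "B = (\<Sum>n. root_bd 1 n)"
  have sm: "summable (root_bd 1)" by (rule root_bd_summable) simp
  have B: "B \<ge> 0" unfolding B_def by (intro suminf_nonneg sm root_bd_nonneg)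
  \<comment> \<open>Chosen such that
    \<open>sqrt s * (2 + 2 * B) \<le> exp (-1) \<le> exp (- s)\<close>: then the terms off the
    origin, at most \<open>s powr (3/2) * (2 + 2 * B)\<close> in total, are covered by the loss
    \<open>s * exp (- s)\<close> at the origin.\<close>
  define \<epsilon> where "\<epsilon> = (exp (-1) / (2 + 2 * B))\<^sup>2"
  have pos: "exp (-1) / (2 + 2 * B) > 0" using B by (intro divide_pos_pos) auto
  have "exp (-1::real) \<le> 1" by simp
  then have "exp (-1) \<le> 2 + 2 * B" using B by linarith
  then have "exp (-1) / (2 + 2 * B) \<le> 1" using B by (simp add: divide_le_eq)
  then have \<epsilon>: "\<epsilon> > 0" "\<epsilon> \<le> 1" using pos by (auto simp: \<epsilon>_def power_le_one)
  have "tilted_sum ori s \<gamma> L \<le> 1" if s: "0 < s" "s \<le> \<epsilon>" and \<gamma>: "\<gamma> \<ge> 2" for s \<gamma> L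
  proof -
    have s1: "s \<le> 1" using s \<epsilon> by simp
    let ?f = "\<lambda>x. pmf (one_law ori s) x powr (3/4) * residue_prob ori s \<gamma> x"
    have f0: "?f 0 \<le> 1 * (1 - s * exp (- s))"
      using residue_prob_zero_le[of s \<gamma> 0 ori] s \<gamma>
      by (intro mult_mono) (auto simp: pmf_le_1 powr_le_one_le residue_prob_bounds intro!: powr_le1)
    \<comment> \<open>The points of absolute value 1 are small twice, through their mass and through
      their residue class, with total power \<open>7/4\<close> of \<open>s\<close>. For
      \<open>\<bar>x\<bar> \<ge> 2\<close> the mass alone gives the power \<open>2 * (3/4)\<close>.
      Both are at least \<open>3/2\<close>.\<close>
    have fx: "?f x \<le> s powr (3/2) * (root_bd 1 (nat \<bar>x\<bar>) + of_bool (\<bar>x\<bar> = 1))" if "x \<noteq> 0" for x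
    proof (cases "\<bar>x\<bar> = 1")
      case True
      have "pmf (one_law ori s) x powr (3/4) \<le> s powr (3/4)"
        using pmf_root_le[of s s ori x] s True by (simp add: root_bd_def)
      then have "?f x \<le> s powr (3/4) * s"
        using residue_prob_unit_le[of s \<gamma> x ori] s \<gamma> True by (intro mult_mono) (auto simp: residue_prob_bounds)
      also have "\<dots> = s powr (3/4) * s powr 1" using s by simp
      also have "\<dots> = s powr (3/4 + 1)" by (rule powr_add[symmetric])
      also have "\<dots> \<le> s powr (3/2)" using s s1 by (intro powr_mono') auto
      also have "\<dots> \<le> s powr (3/2) * (root_bd 1 (nat \<bar>x\<bar>) + 1)"
        using root_bd_nonneg[of 1 "nat \<bar>x\<bar>"] by (simp add: distrib_left)
      finally show ?thesis using True by simp
    next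
      case False
      define n where "n = nat \<bar>x\<bar>"
      have n: "n \<ge> 2" using False that by (simp add: n_def)
      have "?f x \<le> root_bd s n * 1"
        unfolding n_def using pmf_root_le[of s s ori x] s
        by (intro mult_mono) (auto simp: residue_prob_bounds root_bd_nonneg)
      also have "root_bd s n = (s ^ n * (1 / fact n)) powr (3/4)" by (simp add: root_bd_def)
      also have "\<dots> = (s ^ n) powr (3/4) * root_bd 1 n"
        using s by (subst powr_mult) (auto simp: root_bd_def)
      also have "(s ^ n) powr (3/4) \<le> (s ^ 2) powr (3/4)"
        using s s1 n by (intro powr_mono2 power_decreasing) auto
      also have "s ^ 2 = s powr 2" using s by (simp add: powr_numeral)
      also have "(s powr 2) powr (3/4) = s powr (2 * (3/4))" by (rule powr_powr)
      also have "2 * (3/4) = (3/2::real)" by simp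
      finally show ?thesis using False root_bd_nonneg[of 1 n] by (simp add: n_def mult_right_mono)
    qed
    have "tilted_sum ori s \<gamma> L = ?f 0 + (\<Sum>n<L. ?f (int (Suc n)) + ?f (- int (Suc n)))"
      unfolding tilted_sum_def by (rule sum_symmetric_int)
    also have "\<dots> \<le> (1 - s * exp (- s)) + (\<Sum>n<L. s powr (3/2) * (2 * root_bd 1 (Suc n) + 2 * of_bool (n = 0)))"
    proof (intro add_mono sum_mono)
      show "?f 0 \<le> 1 - s * exp (- s)" using f0 by simp
      fix n
      show "?f (int (Suc n)) + ?f (- int (Suc n)) \<le> s powr (3/2) * (2 * root_bd 1 (Suc n) + 2 * of_bool (n = 0))"
        using fx[of "int (Suc n)"] fx[of "- int (Suc n)"] by (simp add: algebra_simps nat_add_distrib)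
    qed
    also have "(\<Sum>n<L. s powr (3/2) * (2 * root_bd 1 (Suc n) + 2 * of_bool (n = 0))) \<le> s powr (3/2) * (2 * B + 2)"
      unfolding sum_distrib_left[symmetric]
    proof (rule mult_left_mono)
      have "(\<Sum>n<L. root_bd 1 (Suc n)) \<le> (\<Sum>n<Suc L. root_bd 1 n)"
        unfolding sum.lessThan_Suc_shift using root_bd_nonneg[of 1 0] by simp
      also have "\<dots> \<le> B" unfolding B_def using root_bd_nonneg by (intro sum_le_suminf sm) auto
      finally have 1: "(\<Sum>n<L. root_bd 1 (Suc n)) \<le> B" .
      have "(\<Sum>n<L. of_bool (n = 0) :: real) \<le> 1" by (induction L) auto
      with 1 show "(\<Sum>n<L. 2 * root_bd 1 (Suc n) + 2 * of_bool (n = 0)) \<le> 2 * B + 2"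
        by (simp add: sum.distrib sum_distrib_left[symmetric])
    qed simp
    also have "s powr (3/2) * (2 * B + 2) \<le> s * exp (- s)"
    proof -
      have "s powr (3/2) = s powr (1 + 1/2)" by simp
      also have "\<dots> = s powr 1 * s powr (1/2)" by (rule powr_add)
      also have "\<dots> = s * sqrt s" using s by (simp add: powr_half_sqrt)
      finally have "s powr (3/2) = s * sqrt s" .
      have "sqrt s \<le> exp (-1) / (2 + 2 * B)"
        using s pos B real_sqrt_le_mono[OF s(2)] by (simp add: \<epsilon>_def)
      then have "sqrt s * (2 * B + 2) \<le> exp (-1)" using B by (simp add: field_simps)
      also have "exp (-1) \<le> exp (- s)" using s1 by simp
      finally have "s * (sqrt s * (2 * B + 2)) \<le> s * exp (- s)" using s by (intro mult_left_mono) auto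
      then show ?thesis unfolding \<open>s powr (3/2) = s * sqrt s\<close> by (simp only: mult.assoc)
    qed
    finally show ?thesis by simp
  qed
  with \<epsilon>(1) that show ?thesis by blast
qed

text \<open>For \<open>s\<close> bounded away from 0 and large \<open>\<gamma>\<close>, reduction modulo \<open>\<gamma>\<close> hardly changes the law, and
  \<open>\<Sum>x. p x powr (7/4)\<close> is bounded away from 1.\<close>

lemma tilted_sum_large:
  assumes S: "0 < \<epsilon>" "\<epsilon> \<le> S"
  obtains \<Gamma> where "\<And>s \<gamma> L. \<epsilon> \<le> s \<Longrightarrow> s \<le> S \<Longrightarrow> \<gamma> \<ge> \<Gamma> \<Longrightarrow> tilted_sum ori s \<gamma> L \<le> 1"
proof -
  \<comment> \<open>For \<open>s\<close> between \<open>\<epsilon>\<close> and \<open>S\<close> no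
    residue class, and so no atom, has mass above \<open>1 - \<delta>\<close>; hence
    \<open>p powr (3/4) * p\<close> is at most \<open>q * p\<close>.\<close>
  define \<delta> where "\<delta> = min (\<epsilon> * exp (- S)) (exp (- S))"
  have \<delta>: "0 < \<delta>" "\<delta> \<le> 1" using S by (auto simp: \<delta>_def min_le_iff_disj)
  define q where "q = (1 - \<delta>) powr (3/4)"
  have q: "q < 1"
  proof (cases "\<delta> = 1")
    case False
    then have "(1 - \<delta>) powr (3/4) < 1 powr (3/4)" using \<delta> by (intro powr_less_mono2) auto
    then show ?thesis by (simp add: q_def)
  qed (simp add: q_def)
  have sm: "summable (root_bd S)" using S by (intro root_bd_summable) simp
  define B where "B = (\<Sum>n. root_bd S n)"
  have l1: "(\<lambda>M. S ^ M / fact M) \<longlonglongrightarrow> 0"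
    using summable_LIMSEQ_zero[OF summable_exp[of S]] by (simp add: divide_inverse mult.commute)
  have l2: "(\<lambda>M. \<Sum>n. root_bd S (n + M)) \<longlonglongrightarrow> 0"
    using suminf_exist_split2[OF sm] by simp
  have "(\<lambda>M. q + (S ^ M / fact M) * (2 * B) + 2 * (\<Sum>n. root_bd S (n + M))) \<longlonglongrightarrow> q + 0 * (2 * B) + 2 * 0"
    by (intro tendsto_intros l1 l2)
  then have "(\<lambda>M. q + (S ^ M / fact M) * (2 * B) + 2 * (\<Sum>n. root_bd S (n + M))) \<longlonglongrightarrow> q" by simp
  \<comment> \<open>The radius \<open>M\<close> makes the mass added by the rest of the residue
    class and the tails beyond \<open>M\<close> together smaller than \<open>1 - q\<close>.\<close>
  from order_tendstoD(2)[OF this q] obtain M where M: "q + (S ^ M / fact M) * (2 * B) + 2 * (\<Sum>n. root_bd S (n + M)) < 1"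
    by (auto simp: eventually_sequentially)
  have "tilted_sum ori s \<gamma> L \<le> 1" if s: "\<epsilon> \<le> s" "s \<le> S" and \<gamma>: "\<gamma> \<ge> max 2 (2 * M)" for s \<gamma> L
  proof -
    let ?p = "pmf (one_law ori s)"
    have s0: "s > 0" using s S by simp
    have tail: "(if n \<ge> M then root_bd S n else 0) \<ge> 0" for n using root_bd_nonneg by simp
    have p\<delta>: "?p x \<le> 1 - \<delta>" for x
    proof -
      have "\<epsilon> * exp (- S) \<le> s * exp (- s)" using s S by (intro mult_mono) auto
      then have "\<delta> \<le> min (s * exp (- s)) (exp (- s))" using s unfolding \<delta>_def by (simp add: min_le_iff_disj)
      with residue_prob_le[of s 2 ori x] pmf_le_residue_prob[of ori s x 2] s0 show ?thesis by linarith
    qed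
    have le: "?p x powr (3/4) * residue_prob ori s \<gamma> x \<le>
       q * ?p x + S ^ M / fact M * root_bd S (nat \<bar>x\<bar>) + (if nat \<bar>x\<bar> \<ge> M then root_bd S (nat \<bar>x\<bar>) else 0)" for x
    proof (cases "nat \<bar>x\<bar> \<ge> M")
      case True
      have "?p x powr (3/4) * residue_prob ori s \<gamma> x \<le> root_bd S (nat \<bar>x\<bar>) * 1"
        using pmf_root_le[of s S ori x] s s0 by (intro mult_mono) (auto simp: residue_prob_bounds root_bd_nonneg)
      moreover have "0 \<le> q * ?p x" by (simp add: q_def)
      moreover have "0 \<le> S ^ M / fact M * root_bd S (nat \<bar>x\<bar>)" using S by (simp add: root_bd_nonneg)
      ultimately show ?thesis using True by simp
    next
      case False
      have "residue_prob ori s \<gamma> x \<le> ?p x + s ^ M / fact M"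
        using False s0 \<gamma> by (intro residue_prob_large) auto
      also have "s ^ M / fact M \<le> S ^ M / fact M" using s s0 by (intro divide_right_mono power_mono) auto
      finally have "?p x powr (3/4) * residue_prob ori s \<gamma> x \<le> ?p x powr (3/4) * (?p x + S ^ M / fact M)"
        by (intro mult_left_mono) auto
      also have "\<dots> = ?p x powr (3/4) * ?p x + S ^ M / fact M * ?p x powr (3/4)" by (simp add: algebra_simps)
      also have "\<dots> \<le> q * ?p x + S ^ M / fact M * root_bd S (nat \<bar>x\<bar>)"
        using p\<delta>[of x] pmf_root_le[of s S ori x] s s0 S
        by (intro add_mono mult_right_mono mult_left_mono) (auto simp: q_def intro!: powr_mono2)
      finally show ?thesis using False by simp
    qed
    have "tilted_sum ori s \<gamma> L \<le> (\<Sum>x\<in>{- int L..int L}. q * ?p x + S ^ M / fact M * root_bd S (nat \<bar>x\<bar>) + (if nat \<bar>x\<bar> \<ge> M then root_bd S (nat \<bar>x\<bar>) else 0))"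
      unfolding tilted_sum_def by (intro sum_mono le)
    also have "\<dots> = q * (\<Sum>x\<in>{- int L..int L}. ?p x) + S ^ M / fact M * (\<Sum>x\<in>{- int L..int L}. root_bd S (nat \<bar>x\<bar>))
       + (\<Sum>x\<in>{- int L..int L}. (if nat \<bar>x\<bar> \<ge> M then root_bd S (nat \<bar>x\<bar>) else 0))"
      by (simp only: sum.distrib sum_distrib_left)
    also have "\<dots> \<le> q * 1 + S ^ M / fact M * (2 * B) + 2 * (\<Sum>n. root_bd S (n + M))"
    proof (intro add_mono mult_left_mono)
      have "(\<Sum>x\<in>{- int L..int L}. ?p x) = measure_pmf.prob (one_law ori s) {- int L..int L}"
        by (simp add: measure_measure_pmf_finite)
      then show "(\<Sum>x\<in>{- int L..int L}. ?p x) \<le> 1" by simp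
      show "(\<Sum>x\<in>{- int L..int L}. root_bd S (nat \<bar>x\<bar>)) \<le> 2 * B"
        unfolding B_def by (intro sum_symmetric_le sm root_bd_nonneg)
      have sm': "summable (\<lambda>n. if n \<ge> M then root_bd S n else 0)"
        by (rule summable_comparison_test'[OF sm]) (auto simp: root_bd_nonneg)
      have "(\<Sum>n. if n \<ge> M then root_bd S n else 0) = (\<Sum>n. root_bd S (n + M))"
        using suminf_minus_initial_segment[OF sm', of M] by simp
      then show "(\<Sum>x\<in>{- int L..int L}. (if nat \<bar>x\<bar> \<ge> M then root_bd S (nat \<bar>x\<bar>) else 0)) \<le> 2 * (\<Sum>n. root_bd S (n + M))"
        using sum_symmetric_le[OF sm' tail, of L] by simp
    qed (use S in \<open>auto simp: q_def\<close>)
    finally show ?thesis using M by simp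
  qed
  then show ?thesis using that by blast
qed

lemma sum_prod_PiE_dflt:
  fixes f :: "'a \<Rightarrow> 'b \<Rightarrow> real"
  assumes "finite A" "finite B"
  shows "(\<Sum>w\<in>PiE_dflt A d (\<lambda>_. B). \<Prod>i\<in>A. f i (w i)) = (\<Prod>i\<in>A. \<Sum>x\<in>B. f i x)"
proof -
  let ?h = "\<lambda>h x. if x \<in> A then h x else d"
  have inj: "inj_on ?h (PiE A (\<lambda>_. B))"
  proof (rule inj_onI, rule ext)
    fix u v x assume u: "u \<in> PiE A (\<lambda>_. B)" and v: "v \<in> PiE A (\<lambda>_. B)" and eq: "?h u = ?h v"
    show "u x = v x"
      using fun_cong[OF eq, of x] PiE_arb[OF u, of x] PiE_arb[OF v, of x] by (cases "x \<in> A") auto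
  qed
  have "(\<Prod>i\<in>A. \<Sum>x\<in>B. f i x) = (\<Sum>h\<in>PiE A (\<lambda>_. B). \<Prod>i\<in>A. f i (h i))"
    using assms by (intro prod_sum_PiE) auto
  also have "\<dots> = (\<Sum>h\<in>PiE A (\<lambda>_. B). \<Prod>i\<in>A. f i (?h h i))" by (intro sum.cong prod.cong) auto
  also have "\<dots> = (\<Sum>w\<in>?h ` PiE A (\<lambda>_. B). \<Prod>i\<in>A. f i (w i))" by (simp add: sum.reindex[OF inj])
  finally show ?thesis by (simp add: dflt_image_PiE)
qed

text \<open>The second bound trades the tilt \<open>\<mu> w powr (1/4)\<close> for a power
  of the cardinality \<open>n\<close>.\<close>

lemma congruent_mass_le:
  fixes T :: "(nat \<Rightarrow> int) set" and L k :: nat and ori :: orientation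
  defines "\<mu> s \<equiv> Pi_pmf {..<k} 0 (\<lambda>_. one_law ori s)"
  assumes T: "finite T" "\<And>w. w \<in> T \<Longrightarrow> (\<forall>i\<ge>k. w i = 0) \<and> (\<forall>i<k. \<bar>w i\<bar> \<le> int L)"
  defines "C s \<gamma> \<equiv> (\<Sum>w\<in>T. pmf (\<mu> s) w * (\<Sum>w'\<in>{w'\<in>T. \<forall>i<k. int \<gamma> dvd w i - w' i}. pmf (\<mu> s) w'))"
  shows "(\<And>r. residue_prob ori s \<gamma> r \<le> \<rho>) \<Longrightarrow> C s \<gamma> \<le> \<rho> ^ k"
    and "n > 0 \<Longrightarrow> (\<And>w. w \<in> T \<Longrightarrow> pmf (\<mu> s) w \<le> 1 / n) \<Longrightarrow> C s \<gamma> \<le> (1 / n) powr (1/4) * tilted_sum ori s \<gamma> L ^ k"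
proof -
  let ?p = "\<lambda>x. pmf (one_law ori s) x" and ?r = "residue_prob ori s \<gamma>"
  have \<mu>: "pmf (\<mu> s) w = (\<Prod>i<k. ?p (w i))" if "w \<in> T" for w
    unfolding \<mu>_def using T(2)[OF that] by (subst pmf_Pi') auto
  have inner: "(\<Sum>w'\<in>{w'\<in>T. \<forall>i<k. int \<gamma> dvd w i - w' i}. pmf (\<mu> s) w') \<le> (\<Prod>i<k. ?r (w i))" for w
  proof -
    have "(\<Sum>w'\<in>{w'\<in>T. \<forall>i<k. int \<gamma> dvd w i - w' i}. pmf (\<mu> s) w') = measure_pmf.prob (\<mu> s) {w'\<in>T. \<forall>i<k. int \<gamma> dvd w i - w' i}"
      using T by (simp add: measure_measure_pmf_finite)
    \<comment> \<open>Dropping the requirement that \<open>w'\<close> be typical leaves a product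
      event.\<close>
    also have "\<dots> \<le> measure_pmf.prob (\<mu> s) (Pi {..<k} (\<lambda>i. {x. int \<gamma> dvd w i - x}))"
      by (intro measure_pmf.finite_measure_mono) auto
    also have "\<dots> = (\<Prod>i<k. ?r (w i))"
      unfolding \<mu>_def residue_prob_def by (intro measure_Pi_pmf_Pi) auto
    finally show ?thesis .
  qed
  have C: "C s \<gamma> \<le> (\<Sum>w\<in>T. pmf (\<mu> s) w * (\<Prod>i<k. ?r (w i)))"
    unfolding C_def by (intro sum_mono mult_left_mono inner) auto
  show "C s \<gamma> \<le> \<rho> ^ k" if \<rho>: "\<And>r. residue_prob ori s \<gamma> r \<le> \<rho>"
  proof -
    have "\<rho> \<ge> 0" using \<rho>[of 0] residue_prob_bounds(1)[of ori s \<gamma> 0] by linarith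
    note C
    also have "(\<Sum>w\<in>T. pmf (\<mu> s) w * (\<Prod>i<k. ?r (w i))) \<le> (\<Sum>w\<in>T. pmf (\<mu> s) w * (\<Prod>i<k. \<rho>))"
      using \<rho> by (intro sum_mono mult_left_mono prod_mono) (auto simp: residue_prob_bounds)
    also have "\<dots> = measure_pmf.prob (\<mu> s) T * \<rho> ^ k"
      using T by (simp add: measure_measure_pmf_finite sum_distrib_right)
    also have "\<dots> \<le> 1 * \<rho> ^ k" using \<open>\<rho> \<ge> 0\<close> by (intro mult_right_mono) auto
    finally show ?thesis by simp
  qed
  show "C s \<gamma> \<le> (1 / n) powr (1/4) * tilted_sum ori s \<gamma> L ^ k"
    if n: "n > 0" and le: "\<And>w. w \<in> T \<Longrightarrow> pmf (\<mu> s) w \<le> 1 / n"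
  proof -
    let ?B = "PiE_dflt {..<k} 0 (\<lambda>_. {- int L..int L})"
    have "T \<subseteq> ?B" using T(2) by (fastforce simp: PiE_dflt_def)
    have tilt: "pmf (\<mu> s) w * (\<Prod>i<k. ?r (w i)) \<le> (1 / n) powr (1/4) * (\<Prod>i<k. ?p (w i) powr (3/4) * ?r (w i))"
      if w: "w \<in> T" for w
    proof -
      have "pmf (\<mu> s) w = pmf (\<mu> s) w powr (1/4) * pmf (\<mu> s) w powr (3/4)"
        by (cases "pmf (\<mu> s) w = 0") (simp_all add: powr_add[symmetric])
      also have "\<dots> \<le> (1 / n) powr (1/4) * pmf (\<mu> s) w powr (3/4)"
        using le[OF w] by (intro mult_right_mono powr_mono2) auto
      also have "pmf (\<mu> s) w powr (3/4) = (\<Prod>i<k. ?p (w i) powr (3/4))"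
        unfolding \<mu>[OF w] by (rule prod_powr_distrib)
      finally have "pmf (\<mu> s) w * (\<Prod>i<k. ?r (w i)) \<le> (1 / n) powr (1/4) * (\<Prod>i<k. ?p (w i) powr (3/4)) * (\<Prod>i<k. ?r (w i))"
        by (intro mult_right_mono prod_nonneg) (auto simp: residue_prob_bounds)
      then show ?thesis by (simp add: prod.distrib mult.assoc)
    qed
    note C
    also have "(\<Sum>w\<in>T. pmf (\<mu> s) w * (\<Prod>i<k. ?r (w i))) \<le> (\<Sum>w\<in>T. (1 / n) powr (1/4) * (\<Prod>i<k. ?p (w i) powr (3/4) * ?r (w i)))"
      by (intro sum_mono tilt)
    also have "\<dots> \<le> (\<Sum>w\<in>?B. (1 / n) powr (1/4) * (\<Prod>i<k. ?p (w i) powr (3/4) * ?r (w i)))"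
      using \<open>T \<subseteq> ?B\<close> by (intro sum_mono2) (auto intro!: mult_nonneg_nonneg prod_nonneg simp: residue_prob_bounds)
    also have "\<dots> = (1 / n) powr (1/4) * (\<Prod>i<k. \<Sum>x\<in>{- int L..int L}. ?p x powr (3/4) * ?r x)"
      unfolding sum_distrib_left[symmetric] by (subst sum_prod_PiE_dflt) auto
    also have "\<dots> = (1 / n) powr (1/4) * tilted_sum ori s \<gamma> L ^ k"
      by (simp add: tilted_sum_def)
    finally show ?thesis .
  qed
qed

text \<open>The constants are arguments and everything else is quantified inside: one choice of
  \<open>\<Gamma>\<close> and \<open>\<delta>\<close> has to serve all members of the sequence of
  groups.\<close>

definition congruent_mass_bound :: "orientation \<Rightarrow> real \<Rightarrow> nat \<Rightarrow> real \<Rightarrow> bool" where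
  "congruent_mass_bound ori S \<Gamma> \<delta> \<longleftrightarrow>
     (\<forall>s k n T L \<gamma>. 0 < s \<longrightarrow> s \<le> S \<longrightarrow> \<gamma> \<ge> 2 \<longrightarrow> n > 0 \<longrightarrow> finite T \<longrightarrow>
        (\<forall>w\<in>T. (\<forall>i\<ge>k. w i = 0) \<and> (\<forall>i<k. \<bar>w i\<bar> \<le> int L)) \<longrightarrow>
        (\<forall>w\<in>T. pmf (Pi_pmf {..<k} 0 (\<lambda>_. one_law ori s)) w \<le> 1 / n) \<longrightarrow>
        (\<Sum>w\<in>T. pmf (Pi_pmf {..<k} 0 (\<lambda>_. one_law ori s)) w *
           (\<Sum>w'\<in>{w'\<in>T. \<forall>i<k. int \<gamma> dvd w i - w' i}. pmf (Pi_pmf {..<k} 0 (\<lambda>_. one_law ori s)) w'))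
        \<le> (1 / n) powr (1/4) + (if \<gamma> \<le> \<Gamma> then (1 - \<delta>) ^ k else 0))"

text \<open>Where \<open>s\<close> is not small and \<open>\<gamma> \<le> \<Gamma>\<close> the
  tilted sum may exceed 1, and there the mass of residue classes is used. That bound is confined to
  bounded moduli on purpose: \<open>k\<close> may be as small as \<open>c * ln n\<close>, and then
  \<open>(1 - \<delta>) ^ k\<close> still beats \<open>\<Gamma> ^ d(G)\<close>, but not necessarily
  \<open>(2 * ln k) ^ d(G)\<close>.\<close>

lemma congruent_mass_uniform:
  assumes S: "S > 0"
  obtains \<Gamma> \<delta> where "0 < \<delta>" "\<delta> < 1" "congruent_mass_bound ori S \<Gamma> \<delta>"
proof -
  obtain \<epsilon>0 where \<epsilon>0: "\<epsilon>0 > 0" "\<And>s \<gamma> L. 0 < s \<Longrightarrow> s \<le> \<epsilon>0 \<Longrightarrow> \<gamma> \<ge> 2 \<Longrightarrow> tilted_sum ori s \<gamma> L \<le> 1"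
    using tilted_sum_small by blast
  define \<epsilon> where "\<epsilon> = min \<epsilon>0 S"
  have \<epsilon>: "0 < \<epsilon>" "\<epsilon> \<le> S" "\<epsilon> \<le> \<epsilon>0" using \<epsilon>0 S by (auto simp: \<epsilon>_def)
  obtain \<Gamma> where \<Gamma>: "\<And>s \<gamma> L. \<epsilon> \<le> s \<Longrightarrow> s \<le> S \<Longrightarrow> \<gamma> \<ge> \<Gamma> \<Longrightarrow> tilted_sum ori s \<gamma> L \<le> 1"
    using tilted_sum_large[OF \<epsilon>(1,2)] by blast
  define \<delta> where "\<delta> = min (1/2) (min (\<epsilon> * exp (- S)) (exp (- S)))"
  have \<delta>: "0 < \<delta>" "\<delta> < 1" using \<epsilon> by (auto simp: \<delta>_def)
  have "congruent_mass_bound ori S \<Gamma> \<delta>"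
    unfolding congruent_mass_bound_def
  proof (intro allI impI)
    fix s :: real and n :: real and k L \<gamma> :: nat and T :: "(nat \<Rightarrow> int) set"
    assume s: "0 < s" "s \<le> S" and \<gamma>: "\<gamma> \<ge> 2" and n: "n > 0" and T: "finite T"
      and T': "\<forall>w\<in>T. (\<forall>i\<ge>k. w i = 0) \<and> (\<forall>i<k. \<bar>w i\<bar> \<le> int L)"
      "\<forall>w\<in>T. pmf (Pi_pmf {..<k} 0 (\<lambda>_. one_law ori s)) w \<le> 1 / n"
    note T = T T'[rule_format]
    let ?C = "\<Sum>w\<in>T. pmf (Pi_pmf {..<k} 0 (\<lambda>_. one_law ori s)) w *
         (\<Sum>w'\<in>{w'\<in>T. \<forall>i<k. int \<gamma> dvd w i - w' i}. pmf (Pi_pmf {..<k} 0 (\<lambda>_. one_law ori s)) w')"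
    have pos: "0 \<le> (1 / n) powr (1/4)" "0 \<le> (if \<gamma> \<le> \<Gamma> then (1 - \<delta>) ^ k else 0)" using \<delta> by auto
    show "?C \<le> (1 / n) powr (1/4) + (if \<gamma> \<le> \<Gamma> then (1 - \<delta>) ^ k else 0)"
    proof (cases "s \<le> \<epsilon> \<or> \<gamma> > \<Gamma>")
      case True
      have "tilted_sum ori s \<gamma> L \<le> 1"
      proof (cases "s \<le> \<epsilon>")
        case True
        then show ?thesis using \<epsilon>0(2) \<epsilon> s \<gamma> by auto
      next
        case False
        then show ?thesis using \<Gamma> True s by auto
      qed
      moreover have "tilted_sum ori s \<gamma> L \<ge> 0"
        unfolding tilted_sum_def by (intro sum_nonneg) (auto simp: residue_prob_bounds)
      ultimately have "tilted_sum ori s \<gamma> L ^ k \<le> 1" by (intro power_le_one)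
      then have "(1 / n) powr (1/4) * tilted_sum ori s \<gamma> L ^ k \<le> (1 / n) powr (1/4)"
        by (intro mult_left_le) auto
      moreover have "?C \<le> (1 / n) powr (1/4) * tilted_sum ori s \<gamma> L ^ k"
        by (rule congruent_mass_le(2)[OF T(1,2) n T(3)])
      ultimately show ?thesis using pos by linarith
    next
      case False
      have "residue_prob ori s \<gamma> r \<le> 1 - \<delta>" for r
      proof -
        have "\<epsilon> * exp (- S) \<le> s * exp (- s)" using s False \<epsilon> by (intro mult_mono) auto
        then have "\<delta> \<le> min (s * exp (- s)) (exp (- s))" using s unfolding \<delta>_def by (simp add: min_le_iff_disj)
        with residue_prob_le[of s \<gamma> ori r] s \<gamma> show ?thesis by linarith
      qed
      from congruent_mass_le(1)[OF T(1,2) this] have "?C \<le> (1 - \<delta>) ^ k" .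
      also have "(1 - \<delta>) ^ k \<le> (1 / n) powr (1/4) + (if \<gamma> \<le> \<Gamma> then (1 - \<delta>) ^ k else 0)"
        using pos False by simp
      finally show ?thesis .
    qed
  qed
  with \<delta> show ?thesis by (rule that)
qed

section \<open>Entropic times\<close>

lemma one_law_surprisal:
  "s > 0 \<Longrightarrow> x \<in> set_pmf (one_law ori s) \<Longrightarrow> - ln (pmf (one_law ori s) x) = sur ori (nat \<bar>x\<bar>) s"
  by (simp add: one_law_set_pmf sur_def)

lemma abs_mult_cpmf: "s \<ge> 0 \<Longrightarrow> \<bar>mult_abs ori n * cpmf ori (int n) s * a\<bar> = mult_abs ori n * cpmf ori (int n) s * \<bar>a\<bar>"
  using mult_abs_bounds(1)[of ori n] cpmf_nonneg[of s ori "int n"] by (simp add: abs_mult)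

lemma one_law_entropy:
  assumes s: "s > 0"
  shows "integrable (one_law ori s) (\<lambda>x. - ln (pmf (one_law ori s) x))"
    "measure_pmf.expectation (one_law ori s) (\<lambda>x. - ln (pmf (one_law ori s) x)) = entropy ori s"
proof -
  have "summable (\<lambda>n. \<bar>mult_abs ori n * cpmf ori (int n) s * sur ori n s\<bar>)"
    using moment_summable[OF s, of 1 ori] s by (simp add: moment_term_def abs_mult_cpmf sur_nonneg)
  note e = one_law_expectation[where g = "\<lambda>n. sur ori n s" and f = "\<lambda>x. - ln (pmf (one_law ori s) x)", OF less_imp_le[OF s] one_law_surprisal[OF s] this]
  show "integrable (one_law ori s) (\<lambda>x. - ln (pmf (one_law ori s) x))" by (rule e(1))
  show "measure_pmf.expectation (one_law ori s) (\<lambda>x. - ln (pmf (one_law ori s) x)) = entropy ori s"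
    using e(2) by (simp add: moment_def moment_term_def)
qed

lemma one_law_variance:
  assumes s: "s > 0"
  shows "integrable (one_law ori s) (\<lambda>x. (- ln (pmf (one_law ori s) x) - entropy ori s)\<^sup>2)"
    "measure_pmf.expectation (one_law ori s) (\<lambda>x. (- ln (pmf (one_law ori s) x) - entropy ori s)\<^sup>2) = sur_var ori s"
proof -
  have "summable (\<lambda>n. \<bar>mult_abs ori n * cpmf ori (int n) s * (sur ori n s - entropy ori s)\<^sup>2\<bar>)"
    using sums_summable[OF sur_var_sums[OF s, of ori]] s by (simp add: abs_mult_cpmf)
  note e = one_law_expectation[where g = "\<lambda>n. (sur ori n s - entropy ori s)\<^sup>2" and f = "\<lambda>x. (- ln (pmf (one_law ori s) x) - entropy ori s)\<^sup>2", OF less_imp_le[OF s] _ this]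
  show "integrable (one_law ori s) (\<lambda>x. (- ln (pmf (one_law ori s) x) - entropy ori s)\<^sup>2)"
    by (rule e(1)) (simp add: one_law_surprisal[OF s])
  have "measure_pmf.expectation (one_law ori s) (\<lambda>x. (- ln (pmf (one_law ori s) x) - entropy ori s)\<^sup>2)
      = (\<Sum>n. mult_abs ori n * cpmf ori (int n) s * (sur ori n s - entropy ori s)\<^sup>2)"
    by (rule e(2)) (simp add: one_law_surprisal[OF s])
  then show "measure_pmf.expectation (one_law ori s) (\<lambda>x. (- ln (pmf (one_law ori s) x) - entropy ori s)\<^sup>2) = sur_var ori s"
    using sur_var_sums[OF s, of ori] by (simp add: sums_iff)
qed

lemma one_law_third:
  assumes s: "0 < s" "s \<le> S" "1 \<le> S"
  shows "integrable (one_law ori s) (\<lambda>x. \<bar>- ln (pmf (one_law ori s) x) - entropy ori s\<bar> ^ 3)"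
    "measure_pmf.expectation (one_law ori s) (\<lambda>x. \<bar>- ln (pmf (one_law ori s) x) - entropy ori s\<bar> ^ 3)
       \<le> (moment_const 3 S + (moment_const 1 S) ^ 3 * S\<^sup>2) * (s * ell s ^ 3)"
proof -
  have "summable (\<lambda>n. \<bar>mult_abs ori n * cpmf ori (int n) s * \<bar>sur ori n s - entropy ori s\<bar> ^ 3\<bar>)"
    using third_moment(1)[OF s, of ori] s by (simp add: abs_mult_cpmf)
  note e = one_law_expectation[where g = "\<lambda>n. \<bar>sur ori n s - entropy ori s\<bar> ^ 3" and f = "\<lambda>x. \<bar>- ln (pmf (one_law ori s) x) - entropy ori s\<bar> ^ 3", OF less_imp_le[OF s(1)] _ this]
  show "integrable (one_law ori s) (\<lambda>x. \<bar>- ln (pmf (one_law ori s) x) - entropy ori s\<bar> ^ 3)"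
    by (rule e(1)) (simp add: one_law_surprisal[OF s(1)])
  have "measure_pmf.expectation (one_law ori s) (\<lambda>x. \<bar>- ln (pmf (one_law ori s) x) - entropy ori s\<bar> ^ 3)
      = (\<Sum>n. mult_abs ori n * cpmf ori (int n) s * \<bar>sur ori n s - entropy ori s\<bar> ^ 3)"
    by (rule e(2)) (simp add: one_law_surprisal[OF s(1)])
  then show "measure_pmf.expectation (one_law ori s) (\<lambda>x. \<bar>- ln (pmf (one_law ori s) x) - entropy ori s\<bar> ^ 3)
       \<le> (moment_const 3 S + (moment_const 1 S) ^ 3 * S\<^sup>2) * (s * ell s ^ 3)"
    using third_moment(2)[OF s, of ori] by simp
qed

section \<open>Entropic times through the inverse of the entropy\<close>

definition entropy_inv :: "orientation \<Rightarrow> real \<Rightarrow> real" where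
  "entropy_inv ori y = (THE s. 0 < s \<and> entropy ori s = y)"

lemma entropy_inj: "0 < s \<Longrightarrow> 0 < s' \<Longrightarrow> entropy ori s = entropy ori s' \<Longrightarrow> s = s'"
  using entropy_strict_mono[of s s' ori] entropy_strict_mono[of s' s ori] by (cases s s' rule: linorder_cases) auto

lemma entropy_inv:
  assumes "y > 0"
  shows "0 < entropy_inv ori y" "entropy ori (entropy_inv ori y) = y"
proof -
  have "\<exists>!s. 0 < s \<and> entropy ori s = y"
    using entropy_surj[OF assms, of ori] entropy_inj by metis
  from theI'[OF this] show "0 < entropy_inv ori y" "entropy ori (entropy_inv ori y) = y"
    by (simp_all add: entropy_inv_def)
qed

lemma entropy_inv_le:
  assumes "0 < y" "y \<le> z"
  shows "entropy_inv ori y \<le> entropy_inv ori z"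
proof (rule ccontr)
  assume "\<not> ?thesis"
  then have "entropy ori (entropy_inv ori z) < entropy ori (entropy_inv ori y)"
    using entropy_inv[of z ori] assms by (intro entropy_strict_mono) auto
  then show False using entropy_inv[of z ori] entropy_inv[of y ori] assms by simp
qed

lemma Q_mean_eq:
  assumes k: "k > 0" and t: "t \<ge> 0"
  shows "Q_mean ori k t = (if t = 0 then 0 else entropy ori (t / k))"
proof (cases "t = 0")
  case True
  have "one_law ori 0 = return_pmf 0"
    by (simp add: one_law_def ct_walk_chain_law jump_count_def bind_return_pmf)
  then show ?thesis using True k by (simp add: Q_mean_def coord_law_one_law)
next
  case False
  then have s: "t / k > 0" using k t by simp
  have "Q_mean ori k t = entropy ori (t / k)"
    unfolding Q_mean_def coord_law_one_law[OF k t] by (rule one_law_entropy(2)[OF s])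
  then show ?thesis using False by simp
qed

lemma Q_var_eq:
  assumes k: "k > 0" and t: "t > 0"
  shows "Q_var ori k t = sur_var ori (t / k)"
proof -
  have s: "t / k > 0" using k t by simp
  show ?thesis
    unfolding Q_var_def coord_law_one_law[OF k less_imp_le[OF t]] one_law_entropy(2)[OF s]
    by (rule one_law_variance(2)[OF s])
qed

lemma the_time:
  assumes k: "k > 0" and y: "y > 0"
  shows "(THE t. 0 \<le> t \<and> Q_mean ori k t = y) = k * entropy_inv ori y"
proof (rule the_equality)
  show "0 \<le> k * entropy_inv ori y \<and> Q_mean ori k (k * entropy_inv ori y) = y"
    using entropy_inv[OF y, of ori] k by (subst Q_mean_eq) auto
  fix t assume t: "0 \<le> t \<and> Q_mean ori k t = y"
  then have "t > 0" "entropy ori (t / k) = y" using Q_mean_eq[OF k, of t ori] y by (auto split: if_splits)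
  have "t / k = entropy_inv ori y"
  proof (rule entropy_inj)
    show "0 < t / k" using \<open>t > 0\<close> k by simp
    show "0 < entropy_inv ori y" by (rule entropy_inv(1)[OF y])
    show "entropy ori (t / k) = entropy ori (entropy_inv ori y)"
      unfolding entropy_inv(2)[OF y] by (rule \<open>entropy ori (t / k) = y\<close>)
  qed
  then show "t = k * entropy_inv ori y" using k by (simp add: field_simps)
qed

lemma entropic_time_0_eq: "k > 0 \<Longrightarrow> n \<ge> 2 \<Longrightarrow> entropic_time_0 ori k n = k * entropy_inv ori (ln n / k)"
  unfolding entropic_time_0_def by (rule the_time) auto

lemma entropic_time_eq:
  assumes "k > 0" "n \<ge> 2" "v = sur_var ori (entropy_inv ori (ln n / k))" "ln n + \<alpha> * sqrt (v * k) > 0"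
  shows "entropic_time ori k n \<alpha> = k * entropy_inv ori ((ln n + \<alpha> * sqrt (v * k)) / k)"
proof -
  have "0 < entropy_inv ori (ln n / k)" using assms by (intro entropy_inv) auto
  then have "Q_var ori k (entropic_time_0 ori k n) = v"
    using assms by (simp add: entropic_time_0_eq Q_var_eq)
  then show ?thesis
    unfolding entropic_time_def Let_def using assms by (simp add: the_time)
qed

lemma entropic_time_at_0: "k > 0 \<Longrightarrow> n \<ge> 2 \<Longrightarrow> entropic_time ori k n 0 = k * entropy_inv ori (ln n / k)"
  using entropic_time_eq[of k n "sur_var ori (entropy_inv ori (ln n / k))" ori 0] by simp

lemma entropy_ratio_at_0: "((\<lambda>s. entropy ori s / (s * ell s)) \<longlongrightarrow> 1) (at_right 0)"
  using moment_ratio_at_0[of 1 ori] by simp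

lemma entropy_lower:
  assumes "S > 0"
  obtains c where "c > 0" "\<And>s. 0 < s \<Longrightarrow> s \<le> S \<Longrightarrow> c * (s * ell s) \<le> entropy ori s"
proof -
  have 1: "\<And>s. s > 0 \<Longrightarrow> isCont (entropy ori) s" by (rule moment_isCont) auto
  have 2: "\<And>s. s > 0 \<Longrightarrow> isCont (\<lambda>s. s * ell s) s" by (intro continuous_intros ell_isCont)
  have 3: "\<And>s. s > 0 \<Longrightarrow> 0 < s * ell s" using ell_pos by simp
  show ?thesis
    using ratio_lower_bound[OF 1 2 entropy_pos 3 entropy_ratio_at_0 assms] that by blast
qed

text \<open>The logarithmic derivative of the entropy with respect to \<open>ln s\<close> is bounded below, so the
  inverse function is Hoelder in logarithmic coordinates.\<close>

lemma entropy_log_holder: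
  assumes S: "S \<ge> 1"
  obtains c where "c > 0" "\<And>a b. 0 < a \<Longrightarrow> a \<le> S \<Longrightarrow> 0 < b \<Longrightarrow> b \<le> S \<Longrightarrow> c * \<bar>ln (b / a)\<bar> \<le> \<bar>ln (entropy ori b / entropy ori a)\<bar>"
proof -
  obtain c1 where c1: "c1 > 0" "\<And>s. 0 < s \<Longrightarrow> s \<le> S \<Longrightarrow> c1 * ell s \<le> entropy_rate ori s"
    using entropy_rate_lower[of S ori] S by auto
  define C where "C = moment_const 1 S"
  have C: "entropy ori s \<le> C * (s * ell s)" if "0 < s" "s \<le> S" for s
    using moment_upper[of s S 1 ori] that S by (simp add: C_def mult.assoc)
  have Cpos: "C > 0"
  proof -
    have "0 < C * (1 * ell 1)" using C[of 1] entropy_pos[of 1 ori] S by linarith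
    then show ?thesis using ell_pos[of 1] by (simp add: zero_less_mult_iff)
  qed
  \<comment> \<open>A lower bound for \<open>s\<close> times the logarithmic derivative: the entropy
    rate is at least \<open>c1 * ell s\<close>, and the entropy is at most
    \<open>C * s * ell s\<close>.\<close>
  define c where "c = c1 / C"
  have c: "c > 0" using c1 Cpos by (simp add: c_def)
  have *: "c * ln (b / a) \<le> ln (entropy ori b / entropy ori a)" if ab: "0 < a" "a \<le> b" "b \<le> S" for a b
  proof -
    let ?g = "\<lambda>s. ln (entropy ori s) - c * ln s"
    have "?g a \<le> ?g b"
    proof (rule DERIV_nonneg_imp_nondecreasing[OF ab(2)])
      fix x assume x: "a \<le> x" "x \<le> b"
      then have x0: "0 < x" "x \<le> S" using ab by auto
      have "(?g has_field_derivative (1 / entropy ori x * entropy_rate ori x - c * (1 / x))) (at x)"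
        using x0 entropy_pos[OF x0(1), of ori]
        by (intro DERIV_diff DERIV_cmult DERIV_ln_divide DERIV_chain2[OF DERIV_ln_divide] entropy_deriv)
      moreover have "0 \<le> 1 / entropy ori x * entropy_rate ori x - c * (1 / x)"
      proof -
        have "c * entropy ori x \<le> c * (C * (x * ell x))" using C[OF x0] c by (intro mult_left_mono) auto
        also have "\<dots> = x * (c1 * ell x)" using Cpos by (simp add: c_def)
        also have "\<dots> \<le> x * entropy_rate ori x" using c1(2)[OF x0] x0 by (intro mult_left_mono) auto
        finally show ?thesis using x0 entropy_pos[OF x0(1), of ori] by (simp add: field_simps)
      qed
      ultimately show "\<exists>y. DERIV ?g x :> y \<and> y \<ge> 0" by blast
    qed
    then show ?thesis
      using ab entropy_pos[of a ori] entropy_pos[of b ori] by (simp add: ln_div algebra_simps)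
  qed
  have "c * \<bar>ln (b / a)\<bar> \<le> \<bar>ln (entropy ori b / entropy ori a)\<bar>"
    if ab: "0 < a" "a \<le> S" "0 < b" "b \<le> S" for a b
  proof -
    have h: "entropy ori a > 0" "entropy ori b > 0" using ab entropy_pos by auto
    show ?thesis
    proof (cases "a \<le> b")
      case True
      then have "\<bar>ln (b / a)\<bar> = ln (b / a)" using ab by (simp add: ln_div)
      then show ?thesis using *[OF ab(1) True ab(4)] by simp
    next
      case False
      then have 1: "\<bar>ln (b / a)\<bar> = ln (a / b)" using ab by (simp add: ln_div)
      have 2: "\<bar>ln (entropy ori b / entropy ori a)\<bar> = \<bar>ln (entropy ori a / entropy ori b)\<bar>"
        using h by (simp add: ln_div)
      have "c * ln (a / b) \<le> ln (entropy ori a / entropy ori b)" using ab False by (intro *) auto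
      then show ?thesis unfolding 1 2 by linarith
    qed
  qed
  with c that show ?thesis by blast
qed

section \<open>Asymptotics of the entropic times\<close>

locale entropic_regime =
  fixes k n :: "nat \<Rightarrow> nat" and c :: real and ori :: orientation
  assumes k_pos: "\<And>N. k N > 0"
    and n_top: "filterlim n at_top sequentially"
    and log_k: "(\<lambda>N. ln (real (k N)) / ln (real (n N))) \<longlonglongrightarrow> 0"
    and c_pos: "c > 0"
    and k_lower: "\<And>N. real (k N) \<ge> c * ln (real (n N))"
begin

definition s0 :: "nat \<Rightarrow> real" where "s0 N = entropy_inv ori (ln (n N) / k N)"

text \<open>Standard deviation of the total surprisal at the time \<open>t\<^sub>0\<close>.\<close>

definition sdev :: "nat \<Rightarrow> real" where "sdev N = sqrt (sur_var ori (s0 N) * k N)"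

text \<open>The rescaled time \<open>t\<^sub>\<alpha> / k\<close>.\<close>

definition sa :: "real \<Rightarrow> nat \<Rightarrow> real" where "sa \<alpha> N = entropy_inv ori ((ln (n N) + \<alpha> * sdev N) / k N)"

text \<open>The entropy level \<open>ln n / k\<close> is at most \<open>1 / c\<close>; the
  additional 1 makes room for the shifted levels that define \<open>sa\<close>. The moment bounds
  ask for a bound of at least 1 on the times.\<close>

definition smax :: real where "smax = max 1 (entropy_inv ori (1 / c + 1))"

lemma smax: "smax \<ge> 1" "smax > 0"
  by (auto simp: smax_def)

lemma n_ge: "\<forall>\<^sub>F N in sequentially. n N \<ge> m"
  using n_top by (simp add: filterlim_at_top)

lemma ln_n_top: "filterlim (\<lambda>N. ln (real (n N))) at_top sequentially"
  by (intro filterlim_compose[OF ln_at_top] filterlim_compose[OF filterlim_real_sequentially n_top])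

lemma ln_n_ge: "\<forall>\<^sub>F N in sequentially. ln (real (n N)) \<ge> B"
  using ln_n_top by (simp add: filterlim_at_top)

lemma real_k_top: "filterlim (\<lambda>N. real (k N)) at_top sequentially"
proof (rule filterlim_at_top_mono)
  show "filterlim (\<lambda>N. c * ln (real (n N))) at_top sequentially"
    by (rule filterlim_tendsto_pos_mult_at_top[OF tendsto_const c_pos ln_n_top])
qed (use k_lower in auto)

lemma k_top: "filterlim k at_top sequentially"
  using real_k_top by (simp add: filterlim_at_top) (metis (mono_tags, lifting) eventually_mono of_nat_le_iff)

lemma s0: "\<forall>\<^sub>F N in sequentially. 0 < s0 N \<and> s0 N \<le> smax \<and> entropy ori (s0 N) = ln (n N) / k N"
  using ln_n_ge[of 1]
proof eventually_elim
  case (elim N)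
  have y: "0 < ln (n N) / k N" using elim k_pos[of N] by (intro divide_pos_pos) auto
  have "ln (n N) / k N \<le> 1 / c" using k_lower[of N] k_pos[of N] c_pos by (simp add: field_simps)
  also have "\<dots> \<le> 1 / c + 1" by simp
  finally have "s0 N \<le> entropy_inv ori (1 / c + 1)" unfolding s0_def by (rule entropy_inv_le[OF y])
  then show ?case using entropy_inv[OF y, of ori] by (simp add: s0_def smax_def)
qed

text \<open>If \<open>t\<^sub>0\<close> stayed below \<open>T\<close>, the total entropy, at most a
  constant times \<open>t * ell (t / k)\<close>, would be of order \<open>ln k + 1\<close>. But it
  equals \<open>ln n\<close>, which has larger order.\<close>

lemma t0_top: "filterlim (\<lambda>N. k N * s0 N) at_top sequentially"
  unfolding filterlim_at_top_gt[where c = 1]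
proof (intro allI impI)
  fix T :: real assume T: "T > 1"
  define C where "C = moment_const 1 smax"
  have C0: "C \<ge> 0" unfolding C_def moment_const_def using smax
    by (intro suminf_nonneg moment_bd_summable) (auto simp: moment_bd_def)
  \<comment> \<open>Collects what does not involve \<open>k\<close>: the 1 bounds
    \<open>- t * ln t\<close>, the rest comes from splitting
    \<open>ln (exp 1 * t + k)\<close>.\<close>
  define A where "A = T * ln (exp 1 * T + 1) + 1"
  have "(\<lambda>N. C * T * (ln (real (k N)) / ln (real (n N))) + C * A * (1 / ln (real (n N)))) \<longlonglongrightarrow> C * T * 0 + C * A * 0"
  proof (intro tendsto_add tendsto_mult tendsto_const log_k)
    show "(\<lambda>N. 1 / ln (real (n N))) \<longlonglongrightarrow> 0"
      by (rule tendsto_divide_0[OF tendsto_const filterlim_at_top_imp_at_infinity[OF ln_n_top]])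
  qed
  then have "(\<lambda>N. C * T * (ln (real (k N)) / ln (real (n N))) + C * A * (1 / ln (real (n N)))) \<longlonglongrightarrow> 0" by simp
  from order_tendstoD(2)[OF this, of 1]
  have "\<forall>\<^sub>F N in sequentially. C * T * (ln (real (k N)) / ln (real (n N))) + C * A * (1 / ln (real (n N))) < 1" by simp
  then show "\<forall>\<^sub>F N in sequentially. T \<le> k N * s0 N"
    using s0 ln_n_ge[of 1]
  proof eventually_elim
    case (elim N)
    show ?case
    proof (rule ccontr)
      assume "\<not> T \<le> k N * s0 N"
      define t where "t = k N * s0 N"
      have k1: "real (k N) \<ge> 1" using k_pos[of N] by simp
      have t: "0 < t" "t \<le> T" using elim k_pos[of N] \<open>\<not> T \<le> k N * s0 N\<close> by (auto simp: t_def)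
      have "t * ell (s0 N) = t * ln (exp 1 + k N / t)"
        using k1 by (simp add: ell_def t_def)
      also have "exp 1 + k N / t = (exp 1 * t + k N) / t" using t by (simp add: field_simps)
      also have "ln ((exp 1 * t + k N) / t) = ln (exp 1 * t + k N) - ln t"
      proof -
        have "0 < exp 1 * t + k N" using t k1 by (intro add_pos_pos) auto
        then show ?thesis using t by (simp add: ln_div)
      qed
      also have "t * (ln (exp 1 * t + k N) - ln t) = t * ln (exp 1 * t + k N) + t * - ln t"
        by (simp add: algebra_simps)
      also have "t * - ln t \<le> 1"
      proof -
        have "- ln t = ln (1 / t)" using t by (simp add: ln_div)
        also have "\<dots> \<le> 1 / t - 1" using t by (intro ln_le_minus_one) simp
        finally have "t * - ln t \<le> t * (1 / t - 1)" using t by (intro mult_left_mono) auto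
        also have "\<dots> = 1 - t" using t by (simp add: algebra_simps)
        finally show ?thesis using t by simp
      qed
      also have "t * ln (exp 1 * t + k N) \<le> T * (ln (k N) + ln (exp 1 * T + 1))"
      proof (rule mult_mono)
        have "exp 1 * t + k N \<le> k N * (exp 1 * T + 1)"
        proof -
          have "exp 1 * t \<le> 1 * (exp 1 * T)" using t by simp
          also have "\<dots> \<le> k N * (exp 1 * T)" using k1 T by (intro mult_right_mono) auto
          finally show ?thesis by (simp add: algebra_simps)
        qed
        moreover have "0 < exp 1 * t + k N" using t k1 by (intro add_pos_pos) auto
        ultimately have "ln (exp 1 * t + k N) \<le> ln (k N * (exp 1 * T + 1))" 
          by (subst ln_le_cancel_iff) linarith+
        also have "\<dots> = ln (k N) + ln (exp 1 * T + 1)" 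
        proof -
          have "0 < exp 1 * T + 1" using T by (intro add_pos_pos) auto
          then show ?thesis using k1 by (simp add: ln_mult)
        qed
        finally show "ln (exp 1 * t + k N) \<le> ln (k N) + ln (exp 1 * T + 1)" .
        show "0 \<le> ln (exp 1 * t + k N)" 
        proof (rule ln_ge_zero)
          have "0 < exp 1 * t" using t by simp
          then show "1 \<le> exp 1 * t + k N" using k1 by linarith
        qed
      qed (use t T in auto)
      finally have "t * ell (s0 N) \<le> T * ln (k N) + A" by (simp add: A_def algebra_simps)
      then have "C * (t * ell (s0 N)) \<le> C * (T * ln (k N) + A)" using C0 by (intro mult_left_mono)
      moreover have "ln (n N) = k N * entropy ori (s0 N)" using elim k1 by simp
      moreover have "k N * entropy ori (s0 N) \<le> k N * (C * s0 N * ell (s0 N))"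
        using moment_upper[of "s0 N" smax 1 ori] elim smax by (intro mult_left_mono) (auto simp: C_def)
      ultimately have "ln (n N) \<le> C * (T * ln (k N) + A)" by (simp add: t_def mult_ac)
      then have "1 \<le> C * (T * ln (k N) + A) / ln (n N)" using elim by (simp add: le_divide_eq)
      also have "\<dots> = C * T * (ln (real (k N)) / ln (real (n N))) + C * A * (1 / ln (real (n N)))"
        by (simp add: add_divide_distrib algebra_simps)
      finally show False using elim by linarith
    qed
  qed
qed

text \<open>The squared deviation is at most of order \<open>k * s * (ell s)\<^sup>2\<close> and
  \<open>ln n\<close> at least of order \<open>k * s * ell s\<close>, so the quotient is at most of
  order \<open>1 / sqrt (k * s)\<close>, where \<open>k * s\<close> is
  \<open>t\<^sub>0\<close>.\<close>

lemma sdev_ratio: "(\<lambda>N. sdev N / ln (real (n N))) \<longlonglongrightarrow> 0"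
proof -
  obtain c1 where c1: "c1 > 0" "\<And>s. 0 < s \<Longrightarrow> s \<le> smax \<Longrightarrow> c1 * (s * ell s) \<le> entropy ori s"
    using entropy_lower[OF smax(2), of ori] by blast
  define C where "C = moment_const 2 smax"
  have "(\<lambda>N. sqrt (C / c1\<^sup>2 * (1 / (k N * s0 N)))) \<longlonglongrightarrow> sqrt (C / c1\<^sup>2 * 0)"
    by (intro tendsto_intros tendsto_divide_0[OF tendsto_const] filterlim_at_top_imp_at_infinity t0_top)
  then have lim: "(\<lambda>N. sqrt (C / c1\<^sup>2 * (1 / (k N * s0 N)))) \<longlonglongrightarrow> 0" by simp
  show ?thesis
  proof (rule Lim_null_comparison[OF _ lim])
    show "\<forall>\<^sub>F N in sequentially. norm (sdev N / ln (real (n N))) \<le> sqrt (C / c1\<^sup>2 * (1 / (k N * s0 N)))"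
      using s0 ln_n_ge[of 1]
    proof eventually_elim
      case (elim N)
      let ?s = "s0 N" and ?k = "real (k N)"
      have s: "0 < ?s" "?s \<le> smax" and k: "?k > 0" using elim k_pos[of N] by auto
      have l: "ell ?s > 0" using ell_pos s by auto
      have "sur_var ori ?s \<le> moment ori 2 ?s" by (simp add: sur_var_def)
      also have "\<dots> \<le> C * ?s * ell ?s ^ 2" unfolding C_def using s smax by (intro moment_upper) auto
      finally have "sdev N \<le> sqrt (C * ?s * (ell ?s)\<^sup>2 * ?k)"
        unfolding sdev_def using k by (intro real_sqrt_le_mono mult_right_mono) auto
      moreover have "ln (n N) \<ge> ?k * (c1 * (?s * ell ?s))"
      proof -
        have "?k * (c1 * (?s * ell ?s)) \<le> ?k * entropy ori ?s" using c1(2)[OF s] k by (intro mult_left_mono) auto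
        also have "\<dots> = ln (n N)" using elim k by simp
        finally show ?thesis .
      qed
      moreover have pos: "0 < ?k * (c1 * (?s * ell ?s))" using k c1 s l by simp
      moreover have "0 \<le> sdev N" by (simp add: sdev_def sur_var_pos s less_imp_le)
      ultimately have "sdev N / ln (n N) \<le> sqrt (C * ?s * (ell ?s)\<^sup>2 * ?k) / (?k * (c1 * (?s * ell ?s)))"
        by (intro frac_le) linarith+
      also have "\<dots> = sqrt (C * ?s * (ell ?s)\<^sup>2 * ?k / (?k * (c1 * (?s * ell ?s)))\<^sup>2)"
        using pos by (simp add: real_sqrt_divide)
      also have "C * ?s * (ell ?s)\<^sup>2 * ?k / (?k * (c1 * (?s * ell ?s)))\<^sup>2 = C / c1\<^sup>2 * (1 / (?k * ?s))"
        using k c1 s l by (simp add: field_simps power2_eq_square)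
      finally show ?case using \<open>0 \<le> sdev N\<close> elim by simp
    qed
  qed
qed

text \<open>Since \<open>ell\<close> is at least 1, the variance at time \<open>t\<^sub>0\<close> is
  at least a constant times \<open>t\<^sub>0\<close>.\<close>

lemma sdev_top: "filterlim sdev at_top sequentially"
proof -
  obtain c1 where c1: "c1 > 0" "\<And>s. 0 < s \<Longrightarrow> s \<le> smax \<Longrightarrow> c1 * (s * (ell s)\<^sup>2) \<le> sur_var ori s"
    using sur_var_lower[OF smax(2), of ori] by blast
  have "filterlim (\<lambda>N. sqrt (c1 * (k N * s0 N))) at_top sequentially"
    by (intro filterlim_compose[OF sqrt_at_top] filterlim_tendsto_pos_mult_at_top[OF tendsto_const c1(1) t0_top])
  then show ?thesis
  proof (rule filterlim_at_top_mono)
    show "\<forall>\<^sub>F N in sequentially. sqrt (c1 * (k N * s0 N)) \<le> sdev N"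
      using s0
    proof eventually_elim
      case (elim N)
      have l: "1 \<le> (ell (s0 N))\<^sup>2" using ell_ge_1[of "s0 N"] elim by (simp add: one_le_power)
      have "c1 * (s0 N * 1) \<le> c1 * (s0 N * (ell (s0 N))\<^sup>2)"
        using c1(1) elim l by (intro mult_left_mono) auto
      also have "\<dots> \<le> sur_var ori (s0 N)" using c1(2) elim by auto
      finally have "c1 * s0 N * k N \<le> sur_var ori (s0 N) * k N" by (intro mult_right_mono) auto
      then show ?case unfolding sdev_def by (simp add: mult_ac)
    qed
  qed
qed

lemma sdev_pos: "\<forall>\<^sub>F N in sequentially. sdev N > 0"
  using sdev_top by (simp add: filterlim_at_top_dense)

lemma level_ratio: "(\<lambda>N. (ln (n N) + \<alpha> * sdev N) / ln (n N)) \<longlonglongrightarrow> 1"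
proof -
  have "(\<lambda>N. 1 + \<alpha> * (sdev N / ln (real (n N)))) \<longlonglongrightarrow> 1 + \<alpha> * 0"
    by (intro tendsto_intros sdev_ratio)
  then have 1: "(\<lambda>N. 1 + \<alpha> * (sdev N / ln (real (n N)))) \<longlonglongrightarrow> 1" by simp
  have "\<forall>\<^sub>F N in sequentially. 1 + \<alpha> * (sdev N / ln (real (n N))) = (ln (n N) + \<alpha> * sdev N) / ln (n N)"
    using ln_n_ge[of 1] by eventually_elim (simp add: add_divide_distrib)
  from Lim_transform_eventually[OF 1 this] show ?thesis .
qed

lemma sa: "\<forall>\<^sub>F N in sequentially. 0 < sa \<alpha> N \<and> sa \<alpha> N \<le> smax \<and>
    entropy ori (sa \<alpha> N) = (ln (n N) + \<alpha> * sdev N) / k N \<and> ln (n N) + \<alpha> * sdev N > 0"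
proof -
  \<comment> \<open>A relative shift of the level by less than \<open>min c 1\<close> keeps it below
    \<open>(1 + c) * ln n\<close>, which is at most \<open>k * (1 / c + 1)\<close>.\<close>
  have q: "min c 1 > 0" "1 + min c 1 > 1" using c_pos by auto
  have 0: "\<forall>\<^sub>F N in sequentially. (ln (n N) + \<alpha> * sdev N) / ln (n N) > 0"
    using order_tendstoD(1)[OF level_ratio] by simp
  have 1: "\<forall>\<^sub>F N in sequentially. (ln (n N) + \<alpha> * sdev N) / ln (n N) < 1 + min c 1"
    using order_tendstoD(2)[OF level_ratio q(2)] .
  show ?thesis using 0 1 ln_n_ge[of 1]
  proof eventually_elim
    case (elim N)
    let ?y = "ln (n N) + \<alpha> * sdev N"
    have l: "ln (n N) > 0" using elim by simp
    have y: "?y > 0" using elim l by (simp add: zero_less_divide_iff)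
    have "?y < (1 + min c 1) * ln (n N)" using elim l by (simp add: divide_less_eq)
    also have "\<dots> \<le> (1 + c) * ln (n N)" using l by (intro mult_right_mono) auto
    also have "\<dots> = c * ln (n N) * (1 / c + 1)" using c_pos by (simp add: field_simps)
    also have "\<dots> \<le> k N * (1 / c + 1)" using k_lower[of N] c_pos by (intro mult_right_mono) auto
    finally have "?y / k N \<le> 1 / c + 1" using k_pos[of N] by (simp add: divide_le_eq mult.commute)
    moreover have y': "?y / k N > 0" using y k_pos[of N] by simp
    ultimately have "sa \<alpha> N \<le> entropy_inv ori (1 / c + 1)" unfolding sa_def by (intro entropy_inv_le)
    then show ?case using entropy_inv[OF y', of ori] y by (simp add: sa_def smax_def)
  qed
qed

text \<open>The ratio of the two entropy levels tends to 1. The times may tend to 0 themselves, so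
  the inverse function has to be controlled in logarithmic coordinates.\<close>

lemma sa_ratio: "(\<lambda>N. sa \<alpha> N / s0 N) \<longlonglongrightarrow> 1"
proof -
  obtain q where q: "q > 0" "\<And>a b. 0 < a \<Longrightarrow> a \<le> smax \<Longrightarrow> 0 < b \<Longrightarrow> b \<le> smax \<Longrightarrow> q * \<bar>ln (b / a)\<bar> \<le> \<bar>ln (entropy ori b / entropy ori a)\<bar>"
    using entropy_log_holder[OF smax(1), of ori] by blast
  have "(\<lambda>N. ln ((ln (n N) + \<alpha> * sdev N) / ln (n N))) \<longlonglongrightarrow> ln 1"
    by (intro tendsto_ln level_ratio) simp
  then have "(\<lambda>N. \<bar>ln ((ln (n N) + \<alpha> * sdev N) / ln (n N))\<bar> / q) \<longlonglongrightarrow> 0"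
    using tendsto_divide_zero tendsto_rabs_zero by (metis ln_one)
  moreover have "\<forall>\<^sub>F N in sequentially. norm (ln (sa \<alpha> N / s0 N)) \<le> \<bar>ln ((ln (n N) + \<alpha> * sdev N) / ln (n N))\<bar> / q"
    using s0 sa[of \<alpha>]
  proof eventually_elim
    case (elim N)
    have "entropy ori (sa \<alpha> N) / entropy ori (s0 N) = (ln (n N) + \<alpha> * sdev N) / ln (n N)"
      using elim k_pos[of N] by simp
    then have "q * \<bar>ln (sa \<alpha> N / s0 N)\<bar> \<le> \<bar>ln ((ln (n N) + \<alpha> * sdev N) / ln (n N))\<bar>"
      using q(2)[of "s0 N" "sa \<alpha> N"] elim by simp
    then show ?case using q(1) by (simp add: field_simps)
  qed
  ultimately have "(\<lambda>N. ln (sa \<alpha> N / s0 N)) \<longlonglongrightarrow> 0" by (rule Lim_null_comparison[rotated])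
  then have "(\<lambda>N. exp (ln (sa \<alpha> N / s0 N))) \<longlonglongrightarrow> exp 0" by (rule tendsto_exp)
  then have 1: "(\<lambda>N. exp (ln (sa \<alpha> N / s0 N))) \<longlonglongrightarrow> 1" by simp
  have "\<forall>\<^sub>F N in sequentially. exp (ln (sa \<alpha> N / s0 N)) = sa \<alpha> N / s0 N"
    using s0 sa[of \<alpha>] by eventually_elim simp
  from Lim_transform_eventually[OF 1 this] show ?thesis .
qed

text \<open>By the mean value theorem the difference of levels,
  \<open>(\<beta> - \<alpha>) * sdev / k\<close>, is divided by the entropy rate at an intermediate
  point. All these points are asymptotic to \<open>s0\<close>, hence so are the rates. In unscaled
  time the window has the unit \<open>sdev / entropy_rate\<close>.\<close>

lemma sa_window:
  "(\<lambda>N. (sa \<beta> N - sa \<alpha> N) * (entropy_rate ori (s0 N) * k N / sdev N)) \<longlonglongrightarrow> \<beta> - \<alpha>"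
proof -
  have ex: "\<exists>\<xi>. (\<forall>\<^sub>F N in sequentially. min (sa \<alpha> N) (sa \<beta> N) \<le> \<xi> N \<and> \<xi> N \<le> max (sa \<alpha> N) (sa \<beta> N) \<and>
      entropy ori (sa \<beta> N) - entropy ori (sa \<alpha> N) = (sa \<beta> N - sa \<alpha> N) * entropy_rate ori (\<xi> N))"
  proof -
    have mvt: "\<exists>\<xi>. min a b \<le> \<xi> \<and> \<xi> \<le> max a b \<and> entropy ori b - entropy ori a = (b - a) * entropy_rate ori \<xi>"
      if ab: "0 < a" "0 < b" for a b
    proof (cases a b rule: linorder_cases)
      case less
      have "\<exists>z>a. z < b \<and> entropy ori b - entropy ori a = (b - a) * entropy_rate ori z"
        using ab less by (intro MVT2 entropy_deriv) auto
      then obtain z where "z > a" "z < b" "entropy ori b - entropy ori a = (b - a) * entropy_rate ori z" by blast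
      then show ?thesis using less by (intro exI[of _ z]) auto
    next
      case equal
      then show ?thesis by auto
    next
      case greater
      have "\<exists>z>b. z < a \<and> entropy ori a - entropy ori b = (a - b) * entropy_rate ori z"
        using ab greater by (intro MVT2 entropy_deriv) auto
      then obtain z where "z > b" "z < a" "entropy ori a - entropy ori b = (a - b) * entropy_rate ori z" by blast
      then show ?thesis using greater by (intro exI[of _ z]) (auto simp: algebra_simps)
    qed
    define \<xi> where "\<xi> N = (SOME x. min (sa \<alpha> N) (sa \<beta> N) \<le> x \<and> x \<le> max (sa \<alpha> N) (sa \<beta> N) \<and>
      entropy ori (sa \<beta> N) - entropy ori (sa \<alpha> N) = (sa \<beta> N - sa \<alpha> N) * entropy_rate ori x)" for N
    have "\<forall>\<^sub>F N in sequentially. min (sa \<alpha> N) (sa \<beta> N) \<le> \<xi> N \<and> \<xi> N \<le> max (sa \<alpha> N) (sa \<beta> N) \<and>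
      entropy ori (sa \<beta> N) - entropy ori (sa \<alpha> N) = (sa \<beta> N - sa \<alpha> N) * entropy_rate ori (\<xi> N)"
      using sa[of \<alpha>] sa[of \<beta>]
    proof eventually_elim
      case (elim N)
      show ?case unfolding \<xi>_def by (rule someI_ex, rule mvt) (use elim in auto)
    qed
    then show ?thesis by blast
  qed
  then obtain \<xi> where \<xi>: "\<forall>\<^sub>F N in sequentially. min (sa \<alpha> N) (sa \<beta> N) \<le> \<xi> N \<and> \<xi> N \<le> max (sa \<alpha> N) (sa \<beta> N) \<and>
      entropy ori (sa \<beta> N) - entropy ori (sa \<alpha> N) = (sa \<beta> N - sa \<alpha> N) * entropy_rate ori (\<xi> N)" by blast
  have \<xi>1: "(\<lambda>N. \<xi> N / s0 N) \<longlonglongrightarrow> 1"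
  proof (rule tendsto_sandwich)
    have "(\<lambda>N. min (sa \<alpha> N / s0 N) (sa \<beta> N / s0 N)) \<longlonglongrightarrow> min 1 1" by (intro tendsto_min sa_ratio)
    then show "(\<lambda>N. min (sa \<alpha> N / s0 N) (sa \<beta> N / s0 N)) \<longlonglongrightarrow> 1" by simp
    have "(\<lambda>N. max (sa \<alpha> N / s0 N) (sa \<beta> N / s0 N)) \<longlonglongrightarrow> max 1 1" by (intro tendsto_max sa_ratio)
    then show "(\<lambda>N. max (sa \<alpha> N / s0 N) (sa \<beta> N / s0 N)) \<longlonglongrightarrow> 1" by simp
    show "\<forall>\<^sub>F N in sequentially. min (sa \<alpha> N / s0 N) (sa \<beta> N / s0 N) \<le> \<xi> N / s0 N"
      using \<xi> s0 by eventually_elim (auto simp: min_le_iff_disj divide_right_mono)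
    show "\<forall>\<^sub>F N in sequentially. \<xi> N / s0 N \<le> max (sa \<alpha> N / s0 N) (sa \<beta> N / s0 N)"
      using \<xi> s0 by eventually_elim (auto simp: le_max_iff_disj divide_right_mono)
  qed
  have "(\<lambda>N. entropy_rate ori (\<xi> N) / entropy_rate ori (s0 N)) \<longlonglongrightarrow> 1"
  proof (rule entropy_rate_ratio[OF smax(2) _ \<xi>1])
    show "\<forall>\<^sub>F N in sequentially. 0 < s0 N \<and> s0 N \<le> smax \<and> 0 < \<xi> N \<and> \<xi> N \<le> smax"
      using \<xi> s0 sa[of \<alpha>] sa[of \<beta>] by eventually_elim linarith
  qed
  then have "(\<lambda>N. inverse (entropy_rate ori (\<xi> N) / entropy_rate ori (s0 N))) \<longlonglongrightarrow> inverse 1"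
    by (rule tendsto_inverse) simp
  then have "(\<lambda>N. (\<beta> - \<alpha>) * inverse (entropy_rate ori (\<xi> N) / entropy_rate ori (s0 N))) \<longlonglongrightarrow> (\<beta> - \<alpha>) * inverse 1"
    by (rule tendsto_mult[OF tendsto_const])
  then have 1: "(\<lambda>N. (\<beta> - \<alpha>) * inverse (entropy_rate ori (\<xi> N) / entropy_rate ori (s0 N))) \<longlonglongrightarrow> \<beta> - \<alpha>"
    by (simp only: inverse_1 mult_1_right)
  have "\<forall>\<^sub>F N in sequentially. (\<beta> - \<alpha>) * inverse (entropy_rate ori (\<xi> N) / entropy_rate ori (s0 N))
      = (sa \<beta> N - sa \<alpha> N) * (entropy_rate ori (s0 N) * k N / sdev N)"
    using \<xi> s0 sa[of \<alpha>] sa[of \<beta>] sdev_pos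
  proof eventually_elim
    case (elim N)
    have \<xi>pos: "\<xi> N > 0" using elim by linarith
    have r: "entropy_rate ori (\<xi> N) > 0" "entropy_rate ori (s0 N) > 0" using entropy_rate_pos \<xi>pos elim by auto
    have "(sa \<beta> N - sa \<alpha> N) * entropy_rate ori (\<xi> N) = entropy ori (sa \<beta> N) - entropy ori (sa \<alpha> N)"
      using elim by (simp only:)
    also have "\<dots> = (ln (n N) + \<beta> * sdev N) / k N - (ln (n N) + \<alpha> * sdev N) / k N"
      using elim by (simp only:)
    also have "\<dots> = (\<beta> - \<alpha>) * sdev N / k N"
      by (simp add: diff_divide_distrib[symmetric] algebra_simps)
    finally have x: "(sa \<beta> N - sa \<alpha> N) * entropy_rate ori (\<xi> N) = (\<beta> - \<alpha>) * sdev N / k N" .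
    have d: "sa \<beta> N - sa \<alpha> N = (\<beta> - \<alpha>) * sdev N / k N / entropy_rate ori (\<xi> N)"
      by (rule iffD2[OF nonzero_eq_divide_eq]) (use r in simp, rule x)
    show ?case unfolding d using r elim k_pos[of N] by (simp add: field_simps)
  qed
  from Lim_transform_eventually[OF 1 this] show ?thesis .
qed

lemma entropic_time_sa:
  "\<forall>\<^sub>F N in sequentially. entropic_time ori (k N) (n N) \<alpha> = k N * sa \<alpha> N \<and> entropic_time ori (k N) (n N) 0 = k N * s0 N"
  using n_ge[of 2] sa[of \<alpha>]
proof eventually_elim
  case (elim N)
  then have "entropic_time ori (k N) (n N) \<alpha> = k N * sa \<alpha> N"
    unfolding sa_def sdev_def s0_def by (intro entropic_time_eq k_pos refl) auto
  moreover have "entropic_time ori (k N) (n N) 0 = k N * s0 N"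
    unfolding s0_def by (intro entropic_time_at_0 k_pos elim)
  ultimately show ?case by simp
qed

section \<open>Gaussian fluctuations of the surprisal and typical points\<close>

definition mu :: "real \<Rightarrow> nat \<Rightarrow> (nat \<Rightarrow> int) pmf" where
  "mu \<alpha> N = Pi_pmf {..<k N} 0 (\<lambda>_. one_law ori (sa \<alpha> N))"

definition surp :: "real \<Rightarrow> nat \<Rightarrow> (nat \<Rightarrow> int) \<Rightarrow> real" where
  "surp \<alpha> N w = (\<Sum>i<k N. - ln (pmf (one_law ori (sa \<alpha> N)) (w i)))"

lemma sa_k_top: "filterlim (\<lambda>N. k N * sa \<alpha> N) at_top sequentially"
proof -
  have "filterlim (\<lambda>N. (sa \<alpha> N / s0 N) * (k N * s0 N)) at_top sequentially"
    by (rule filterlim_tendsto_pos_mult_at_top[OF sa_ratio _ t0_top]) simp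
  moreover have "\<forall>\<^sub>F N in sequentially. (sa \<alpha> N / s0 N) * (k N * s0 N) = k N * sa \<alpha> N"
    using s0 by eventually_elim simp
  ultimately show ?thesis by (simp cong: filterlim_cong)
qed

text \<open>The window is defined with the variance at \<open>t\<^sub>0\<close>, whereas the central
  limit theorem at \<open>t\<^sub>\<alpha>\<close> normalises with the variance there.\<close>

lemma sdev_sa: "(\<lambda>N. sdev N / (sqrt (sur_var ori (sa \<alpha> N)) * sqrt (k N))) \<longlonglongrightarrow> 1"
proof -
  have "(\<lambda>N. s0 N / sa \<alpha> N) \<longlonglongrightarrow> 1"
    using tendsto_inverse[OF sa_ratio[of \<alpha>]] by simp
  then have "(\<lambda>N. sur_var ori (s0 N) / sur_var ori (sa \<alpha> N)) \<longlonglongrightarrow> 1"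
  proof (rule sur_var_ratio[OF smax(2), rotated])
    show "\<forall>\<^sub>F N in sequentially. 0 < sa \<alpha> N \<and> sa \<alpha> N \<le> smax \<and> 0 < s0 N \<and> s0 N \<le> smax"
      using s0 sa[of \<alpha>] by eventually_elim auto
  qed
  from tendsto_real_sqrt[OF this] have 1: "(\<lambda>N. sqrt (sur_var ori (s0 N) / sur_var ori (sa \<alpha> N))) \<longlonglongrightarrow> 1" by simp
  have "\<forall>\<^sub>F N in sequentially. sqrt (sur_var ori (s0 N) / sur_var ori (sa \<alpha> N)) = sdev N / (sqrt (sur_var ori (sa \<alpha> N)) * sqrt (k N))"
    using k_pos by (simp add: sdev_def real_sqrt_divide real_sqrt_mult)
  from Lim_transform_eventually[OF 1 this] show ?thesis .
qed

text \<open>The third moment is at most of order \<open>s * ell s ^ 3\<close>, and the cube of the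
  deviation at least of order \<open>(s * (ell s)\<^sup>2) powr (3/2)\<close>. The powers of
  \<open>ell s\<close> cancel and \<open>1 / sqrt (k * s)\<close> is left.\<close>

lemma lyapunov:
  "(\<lambda>N. measure_pmf.expectation (one_law ori (sa \<alpha> N)) (\<lambda>x. \<bar>- ln (pmf (one_law ori (sa \<alpha> N)) x) - entropy ori (sa \<alpha> N)\<bar> ^ 3)
      / (sqrt (sur_var ori (sa \<alpha> N)) ^ 3 * sqrt (k N))) \<longlonglongrightarrow> 0"
proof -
  obtain c1 where c1: "c1 > 0" "\<And>s. 0 < s \<Longrightarrow> s \<le> smax \<Longrightarrow> c1 * (s * (ell s)\<^sup>2) \<le> sur_var ori s"
    using sur_var_lower[OF smax(2), of ori] by blast
  define K where "K = moment_const 3 smax + (moment_const 1 smax) ^ 3 * smax\<^sup>2"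
  have "(\<lambda>N. K / sqrt c1 ^ 3 * (1 / sqrt (k N * sa \<alpha> N))) \<longlonglongrightarrow> K / sqrt c1 ^ 3 * 0"
    by (intro tendsto_mult tendsto_const tendsto_divide_0[OF tendsto_const] filterlim_at_top_imp_at_infinity
        filterlim_compose[OF sqrt_at_top sa_k_top])
  then have lim: "(\<lambda>N. K / sqrt c1 ^ 3 * (1 / sqrt (k N * sa \<alpha> N))) \<longlonglongrightarrow> 0" by simp
  show ?thesis
  proof (rule Lim_null_comparison[OF _ lim])
    show "\<forall>\<^sub>F N in sequentially. norm (measure_pmf.expectation (one_law ori (sa \<alpha> N)) (\<lambda>x. \<bar>- ln (pmf (one_law ori (sa \<alpha> N)) x) - entropy ori (sa \<alpha> N)\<bar> ^ 3)
      / (sqrt (sur_var ori (sa \<alpha> N)) ^ 3 * sqrt (k N))) \<le> K / sqrt c1 ^ 3 * (1 / sqrt (k N * sa \<alpha> N))"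
      using sa[of \<alpha>]
    proof eventually_elim
      case (elim N)
      let ?s = "sa \<alpha> N" and ?k = "real (k N)"
      let ?E = "measure_pmf.expectation (one_law ori ?s) (\<lambda>x. \<bar>- ln (pmf (one_law ori ?s) x) - entropy ori ?s\<bar> ^ 3)"
      let ?\<sigma> = "sqrt (sur_var ori ?s)"
      have s: "0 < ?s" "?s \<le> smax" and kp: "?k > 0" using elim k_pos[of N] by auto
      have l: "ell ?s > 0" using ell_pos[OF s(1)] .
      have E: "?E \<le> K * (?s * ell ?s ^ 3)" unfolding K_def using one_law_third(2)[OF s smax(1), of ori] by simp
      have E0: "0 \<le> ?E" by (intro Bochner_Integration.integral_nonneg) auto
      have \<sigma>: "sqrt c1 * sqrt ?s * ell ?s \<le> ?\<sigma>"
      proof -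
        have "sqrt c1 * sqrt ?s * ell ?s = sqrt (c1 * (?s * (ell ?s)\<^sup>2))"
          using l by (simp add: real_sqrt_mult)
        also have "\<dots> \<le> ?\<sigma>" using c1(2)[OF s] by simp
        finally show ?thesis .
      qed
      let ?q = "(sqrt c1 * sqrt ?s * ell ?s) ^ 3 * sqrt ?k"
      have q: "0 < ?q" using c1 s l kp by simp
      have "?E / (?\<sigma> ^ 3 * sqrt ?k) \<le> K * (?s * ell ?s ^ 3) / ?q"
        by (rule frac_le[OF order.trans[OF E0 E] E q]) (use \<sigma> c1 s l in \<open>auto intro!: mult_right_mono power_mono\<close>)
      also have "\<dots> = K / sqrt c1 ^ 3 * (1 / sqrt (?k * ?s))"
      proof -
        have "sqrt ?s ^ 3 = ?s * sqrt ?s" using s by (simp add: power3_eq_cube)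
        then have "?q = sqrt c1 ^ 3 * (?s * ell ?s ^ 3) * sqrt (?k * ?s)"
          by (simp add: power_mult_distrib real_sqrt_mult mult_ac)
        then show ?thesis using s l c1 kp by simp
      qed
      finally show ?case using E0 by (simp add: sur_var_pos s less_imp_le)
    qed
  qed
qed

text \<open>By the choice of \<open>sa\<close> the surprisal has mean
  \<open>ln n + \<alpha> * sdev\<close>, and its deviation is asymptotic to \<open>sdev\<close>; so
  the threshold lies about \<open>x - \<alpha>\<close> deviations above the mean.\<close>

lemma surp_limit:
  assumes \<theta>: "(\<lambda>N. \<theta> N / sdev N) \<longlonglongrightarrow> x"
  shows "(\<lambda>N. measure_pmf.prob (mu \<alpha> N) {w. surp \<alpha> N w \<le> ln (n N) + \<theta> N}) \<longlonglongrightarrow> normal_cdf (x - \<alpha>)"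
proof -
  define \<sigma> where "\<sigma> N = sqrt (sur_var ori (sa \<alpha> N))" for N
  define X where "X N = (\<theta> N - \<alpha> * sdev N) / (\<sigma> N * sqrt (k N))" for N
  define f where "f N x = - ln (pmf (one_law ori (sa \<alpha> N)) x) - entropy ori (sa \<alpha> N)" for N x
  have "\<forall>\<^sub>F N in sequentially. 0 < sa \<alpha> N \<and> sa \<alpha> N \<le> smax \<and> sdev N > 0 \<and>
      entropy ori (sa \<alpha> N) = (ln (n N) + \<alpha> * sdev N) / k N"
    using sa[of \<alpha>] sdev_pos by eventually_elim auto
  then obtain M where M: "\<And>N. N \<ge> M \<Longrightarrow> 0 < sa \<alpha> N \<and> sa \<alpha> N \<le> smax \<and> sdev N > 0 \<and>
      entropy ori (sa \<alpha> N) = (ln (n N) + \<alpha> * sdev N) / k N"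
    by (auto simp: eventually_sequentially)
  have \<sigma>: "\<sigma> N > 0" if "N \<ge> M" for N using M[OF that] by (simp add: \<sigma>_def sur_var_pos)
  have X: "X \<longlonglongrightarrow> x - \<alpha>"
  proof -
    have "(\<lambda>N. (\<theta> N / sdev N - \<alpha>) * (sdev N / (\<sigma> N * sqrt (k N)))) \<longlonglongrightarrow> (x - \<alpha>) * 1"
      unfolding \<sigma>_def by (intro tendsto_mult tendsto_diff tendsto_const \<theta> sdev_sa)
    then have 1: "(\<lambda>N. (\<theta> N / sdev N - \<alpha>) * (sdev N / (\<sigma> N * sqrt (k N)))) \<longlonglongrightarrow> x - \<alpha>" by simp
    have "\<forall>\<^sub>F N in sequentially. (\<theta> N / sdev N - \<alpha>) * (sdev N / (\<sigma> N * sqrt (k N))) = X N"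
      using sdev_pos
    proof eventually_elim
      case (elim N)
      then have "\<theta> N / sdev N - \<alpha> = (\<theta> N - \<alpha> * sdev N) / sdev N" by (simp add: diff_divide_distrib)
      then show ?case using elim by (simp add: X_def)
    qed
    from Lim_transform_eventually[OF 1 this] show ?thesis .
  qed
  \<comment> \<open>The positivity and moment conditions hold only from \<open>M\<close> on, so the
    central limit theorem is applied to the shifted sequence.\<close>
  let ?k = "\<lambda>N. k (N + M)" and ?p = "\<lambda>N. one_law ori (sa \<alpha> (N + M))" and ?f = "\<lambda>N. f (N + M)" and ?\<sigma> = "\<lambda>N. \<sigma> (N + M)"
  let ?D = "\<lambda>N. distr (Pi_pmf {..<?k N} 0 (\<lambda>_. ?p N)) borel (\<lambda>w. (\<Sum>i<?k N. ?f N (w i)) / (?\<sigma> N * sqrt (?k N)))"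
  have "weak_conv_m ?D std_normal_distribution"
  proof (rule triangular_clt)
    show "filterlim ?k at_top sequentially"
      by (rule filterlim_compose[OF k_top filterlim_add_const_nat_at_top])
    fix N
    have s: "0 < sa \<alpha> (N + M)" "sa \<alpha> (N + M) \<le> smax" using M[of "N + M"] by auto
    show "?\<sigma> N > 0" by (rule \<sigma>) simp
    show "integrable (?p N) (?f N)" unfolding f_def
      by (intro Bochner_Integration.integrable_diff one_law_entropy(1)[OF s(1)]) simp
    show "integrable (?p N) (\<lambda>x. (?f N x)\<^sup>2)" unfolding f_def by (rule one_law_variance(1)[OF s(1)])
    show "integrable (?p N) (\<lambda>x. \<bar>?f N x\<bar> ^ 3)" unfolding f_def by (rule one_law_third(1)[OF s smax(1)])
    have "measure_pmf.expectation (?p N) (?f N) = measure_pmf.expectation (?p N) (\<lambda>x. - ln (pmf (?p N) x))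
        - measure_pmf.expectation (?p N) (\<lambda>_. entropy ori (sa \<alpha> (N + M)))"
      unfolding f_def by (rule Bochner_Integration.integral_diff[OF one_law_entropy(1)[OF s(1)]]) simp
    also have "\<dots> = 0" unfolding one_law_entropy(2)[OF s(1)] by simp
    finally show "measure_pmf.expectation (?p N) (?f N) = 0" .
    show "measure_pmf.expectation (?p N) (\<lambda>x. (?f N x)\<^sup>2) = (?\<sigma> N)\<^sup>2" unfolding f_def
      by (subst one_law_variance(2)[OF s(1)]) (simp add: \<sigma>_def sur_var_pos[OF s(1)] less_imp_le)
  next
    show "(\<lambda>N. measure_pmf.expectation (?p N) (\<lambda>x. \<bar>?f N x\<bar> ^ 3) / (?\<sigma> N ^ 3 * sqrt (?k N))) \<longlonglongrightarrow> 0"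
      unfolding f_def \<sigma>_def by (rule LIMSEQ_ignore_initial_segment[OF lyapunov])
  qed
  then have "(\<lambda>N. measure (?D N) {..X (N + M)}) \<longlonglongrightarrow> normal_cdf (x - \<alpha>)"
    by (rule weak_conv_m_threshold[OF _ _ LIMSEQ_ignore_initial_segment[OF X]])
      (intro prob_space.real_distribution_distr measure_pmf.prob_space_axioms, simp)
  moreover have "measure (?D N) {..X (N + M)} = measure_pmf.prob (mu \<alpha> (N + M)) {w. surp \<alpha> (N + M) w \<le> ln (n (N + M)) + \<theta> (N + M)}" for N
  proof -
    let ?N = "N + M"
    have p: "0 < \<sigma> ?N * sqrt (k ?N)" using \<sigma>[of ?N] k_pos[of ?N] by simp
    have "(\<Sum>i<k ?N. f ?N (w i)) / (\<sigma> ?N * sqrt (k ?N)) \<le> X ?N \<longleftrightarrow> surp \<alpha> ?N w \<le> ln (n ?N) + \<theta> ?N" for w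
    proof -
      have "(\<Sum>i<k ?N. f ?N (w i)) = surp \<alpha> ?N w - k ?N * entropy ori (sa \<alpha> ?N)"
        by (simp add: f_def surp_def sum_subtractf)
      also have "\<dots> = surp \<alpha> ?N w - (ln (n ?N) + \<alpha> * sdev ?N)"
        using M[of ?N] k_pos[of ?N] by simp
      finally show ?thesis unfolding X_def using p by (simp add: divide_right_mono divide_le_cancel) linarith
    qed
    then show ?thesis by (subst measure_distr) (auto simp: mu_def vimage_def)
  qed
  ultimately have "(\<lambda>N. measure_pmf.prob (mu \<alpha> (N + M)) {w. surp \<alpha> (N + M) w \<le> ln (n (N + M)) + \<theta> (N + M)}) \<longlonglongrightarrow> normal_cdf (x - \<alpha>)"
    by simp
  then show ?thesis by (rule LIMSEQ_offset)
qed

text \<open>Tends to infinity more slowly than \<open>sdev\<close>: \<open>exp (- gap)\<close>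
  vanishes, yet shifting a threshold by \<open>gap\<close> does not change the Gaussian
  limit.\<close>

definition gap :: "nat \<Rightarrow> real" where "gap N = sqrt (sdev N)"

lemma gap_top: "filterlim gap at_top sequentially"
  unfolding gap_def by (rule filterlim_compose[OF sqrt_at_top sdev_top])

lemma gap_ratio: "(\<lambda>N. gap N / sdev N) \<longlonglongrightarrow> 0"
proof -
  have 1: "(\<lambda>N. 1 / gap N) \<longlonglongrightarrow> 0"
    by (rule tendsto_divide_0[OF tendsto_const filterlim_at_top_imp_at_infinity[OF gap_top]])
  have "\<forall>\<^sub>F N in sequentially. 1 / gap N = gap N / sdev N"
    using sdev_pos by eventually_elim (simp add: gap_def divide_simps)
  from Lim_transform_eventually[OF 1 this] show ?thesis .
qed

lemma exp_gap: "(\<lambda>N. exp (- gap N)) \<longlonglongrightarrow> 0"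
  by (intro filterlim_compose[OF exp_at_bot] filterlim_compose[OF filterlim_uminus_at_bot_at_top gap_top])

lemma pmf_mu:
  assumes "w \<in> set_pmf (mu \<alpha> N)"
  shows "pmf (mu \<alpha> N) w = exp (- surp \<alpha> N w)"
proof -
  have w: "\<forall>i. i \<notin> {..<k N} \<longrightarrow> w i = 0" "\<And>i. i < k N \<Longrightarrow> pmf (one_law ori (sa \<alpha> N)) (w i) > 0"
    using assms by (auto simp: mu_def set_Pi_pmf PiE_dflt_def pmf_positive)
  have "pmf (mu \<alpha> N) w = (\<Prod>i<k N. pmf (one_law ori (sa \<alpha> N)) (w i))"
    unfolding mu_def using w(1) by (subst pmf_Pi') auto
  also have "\<dots> = (\<Prod>i<k N. exp (ln (pmf (one_law ori (sa \<alpha> N)) (w i))))"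
    using w(2) by (intro prod.cong) auto
  also have "\<dots> = exp (- surp \<alpha> N w)"
    by (simp add: surp_def exp_sum[symmetric] sum_negf)
  finally show ?thesis .
qed

lemma lower_limit:
  "(\<lambda>N. measure_pmf.prob (mu \<alpha> N) {w. exp (gap N) / n N \<le> pmf (mu \<alpha> N) w} - exp (- gap N)) \<longlonglongrightarrow> Psi \<alpha>"
proof -
  have "(\<lambda>N. - gap N / sdev N) \<longlonglongrightarrow> 0" using tendsto_minus[OF gap_ratio] by simp
  from surp_limit[OF this, of \<alpha>] have "(\<lambda>N. measure_pmf.prob (mu \<alpha> N) {w. surp \<alpha> N w \<le> ln (n N) + - gap N} - exp (- gap N)) \<longlonglongrightarrow> normal_cdf (0 - \<alpha>) - 0"
    by (intro tendsto_diff exp_gap)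
  then have 1: "(\<lambda>N. measure_pmf.prob (mu \<alpha> N) {w. surp \<alpha> N w \<le> ln (n N) + - gap N} - exp (- gap N)) \<longlonglongrightarrow> Psi \<alpha>"
    by (simp add: Psi_eq_cdf)
  have "\<forall>\<^sub>F N in sequentially. measure_pmf.prob (mu \<alpha> N) {w. surp \<alpha> N w \<le> ln (n N) + - gap N} - exp (- gap N)
     = measure_pmf.prob (mu \<alpha> N) {w. exp (gap N) / n N \<le> pmf (mu \<alpha> N) w} - exp (- gap N)"
    using n_ge[of 1]
  proof eventually_elim
    case (elim N)
    have n: "real (n N) > 0" using elim by simp
    have "surp \<alpha> N w \<le> ln (n N) + - gap N \<longleftrightarrow> exp (gap N) / n N \<le> pmf (mu \<alpha> N) w" if "w \<in> set_pmf (mu \<alpha> N)" for w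
    proof -
      have "exp (gap N) / n N = exp (gap N - ln (n N))" using n by (simp add: exp_diff)
      then show ?thesis unfolding pmf_mu[OF that] by (simp only: exp_le_cancel_iff) linarith
    qed
    then have "measure_pmf.prob (mu \<alpha> N) {w. surp \<alpha> N w \<le> ln (n N) + - gap N} = measure_pmf.prob (mu \<alpha> N) {w. exp (gap N) / n N \<le> pmf (mu \<alpha> N) w}"
      by (intro measure_pmf.finite_measure_eq_AE AE_pmfI) auto
    then show ?case by simp
  qed
  from Lim_transform_eventually[OF 1 this] show ?thesis .
qed

text \<open>Of order \<open>ln k\<close>: large enough for a union bound over \<open>k\<close>
  coordinates, because the factorial wins, and small enough that \<open>(2 * radius) ^ d(G)\<close>
  is at most about \<open>|G| powr (1/5)\<close>.\<close>

definition radius :: "nat \<Rightarrow> nat" where "radius N = nat \<lceil>ln (real (k N))\<rceil>"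

lemma radius_ge: "ln (real (k N)) \<le> radius N"
  unfolding radius_def by linarith

lemma radius_top: "filterlim radius at_top sequentially"
proof -
  have "filterlim (\<lambda>N. ln (real (k N))) at_top sequentially"
    by (rule filterlim_compose[OF ln_at_top real_k_top])
  then have "filterlim (\<lambda>N. real (radius N)) at_top sequentially"
    by (rule filterlim_at_top_mono) (simp add: radius_ge)
  then show ?thesis by (simp add: filterlim_at_top) (metis (mono_tags, lifting) eventually_mono of_nat_le_iff)
qed

definition typical :: "real \<Rightarrow> nat \<Rightarrow> (nat \<Rightarrow> int) set" where
  "typical \<alpha> N = {w. (\<forall>i\<ge>k N. w i = 0) \<and> (\<forall>i<k N. \<bar>w i\<bar> \<le> int (radius N)) \<and> pmf (mu \<alpha> N) w \<le> exp (- gap N) / n N}"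

lemma finite_typical: "finite (typical \<alpha> N)"
proof (rule finite_subset)
  show "typical \<alpha> N \<subseteq> PiE_dflt {..<k N} 0 (\<lambda>_. {- int (radius N)..int (radius N)})"
    by (fastforce simp: typical_def PiE_dflt_def)
qed auto

text \<open>The factor \<open>exp 1\<close> pays for the union bound, as
  \<open>k \<le> exp 1 ^ radius\<close>.\<close>

lemma radius_tail: "(\<lambda>N. (exp 1 * smax) ^ radius N / fact (radius N)) \<longlonglongrightarrow> 0"
proof -
  have "(\<lambda>L. (exp 1 * smax) ^ L / fact L) \<longlonglongrightarrow> 0"
    using summable_LIMSEQ_zero[OF summable_exp[of "exp 1 * smax"]] by (simp add: divide_inverse mult.commute)
  then show ?thesis by (rule filterlim_compose[OF _ radius_top])
qed

text \<open>The points that are too heavy have limiting mass \<open>Psi \<alpha>\<close>; leaving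
  the box only adds to the error term.\<close>

lemma prob_not_typical:
  obtains e where "e \<longlonglongrightarrow> 0" "\<forall>\<^sub>F N in sequentially. 1 - measure_pmf.prob (mu \<alpha> N) (typical \<alpha> N) \<le> Psi \<alpha> + e N"
proof -
  define q where "q N = measure_pmf.prob (mu \<alpha> N) {w. surp \<alpha> N w \<le> ln (n N) + gap N}" for N
  have q: "q \<longlonglongrightarrow> Psi \<alpha>"
    using surp_limit[OF gap_ratio, of \<alpha>] by (simp add: q_def[abs_def] Psi_eq_cdf)
  define e where "e N = (q N - Psi \<alpha>) + (exp 1 * smax) ^ radius N / fact (radius N)" for N
  have "e \<longlonglongrightarrow> 0 + 0" unfolding e_def by (intro tendsto_add radius_tail) (use q in \<open>simp add: LIM_zero_iff\<close>)
  moreover have "\<forall>\<^sub>F N in sequentially. 1 - measure_pmf.prob (mu \<alpha> N) (typical \<alpha> N) \<le> Psi \<alpha> + e N"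
    using n_ge[of 1] sa[of \<alpha>]
  proof eventually_elim
    case (elim N)
    let ?P = "measure_pmf.prob (mu \<alpha> N)"
    let ?B = "\<lambda>i. {w :: nat \<Rightarrow> int. int (radius N) < \<bar>w i\<bar>}"
    have n: "real (n N) > 0" using elim by simp
    have "1 - ?P (typical \<alpha> N) = ?P (UNIV - typical \<alpha> N)"
      using measure_pmf.prob_compl[of "typical \<alpha> N" "mu \<alpha> N"] by simp
    also have "\<dots> \<le> ?P ({w. surp \<alpha> N w \<le> ln (n N) + gap N} \<union> (\<Union>i<k N. ?B i))"
    proof (rule measure_pmf.finite_measure_mono_AE)
      show "AE w in measure_pmf (mu \<alpha> N). w \<in> UNIV - typical \<alpha> N \<longrightarrow> w \<in> {w. surp \<alpha> N w \<le> ln (real (n N)) + gap N} \<union> (\<Union>i<k N. ?B i)"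
      proof (intro AE_pmfI impI)
        fix w assume w: "w \<in> set_pmf (mu \<alpha> N)" "w \<in> UNIV - typical \<alpha> N"
        have z: "\<forall>i\<ge>k N. w i = 0" using w(1) by (auto simp: mu_def set_Pi_pmf PiE_dflt_def)
        show "w \<in> {w. surp \<alpha> N w \<le> ln (n N) + gap N} \<union> (\<Union>i<k N. ?B i)"
        proof (cases "\<exists>i<k N. int (radius N) < \<bar>w i\<bar>")
          case False
          then have "\<forall>i<k N. \<bar>w i\<bar> \<le> int (radius N)" by (metis not_le_imp_less)
          then have "exp (- gap N) / n N < pmf (mu \<alpha> N) w" using w(2) z by (simp add: typical_def not_le)
          also have "exp (- gap N) / n N = exp (- gap N - ln (n N))" using n by (simp add: exp_diff)
          finally have "- gap N - ln (n N) < - surp \<alpha> N w" unfolding pmf_mu[OF w(1)] by (simp only: exp_less_cancel_iff)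
          then show ?thesis by simp
        qed auto
      qed
    qed auto
    also have "\<dots> \<le> q N + ?P (\<Union>i<k N. ?B i)" unfolding q_def by (intro measure_Un_le) auto
    also have "?P (\<Union>i<k N. ?B i) \<le> (\<Sum>i<k N. ?P (?B i))"
      by (intro measure_UNION_le) auto
    also have "\<dots> \<le> (\<Sum>i<k N. smax ^ radius N / fact (radius N))"
    proof (rule sum_mono)
      fix i assume i: "i \<in> {..<k N}"
      have "?P (?B i) = measure_pmf.prob (map_pmf (\<lambda>w. w i) (mu \<alpha> N)) {x. int (radius N) < \<bar>x\<bar>}"
        by (simp add: vimage_def)
      also have "map_pmf (\<lambda>w. w i) (mu \<alpha> N) = one_law ori (sa \<alpha> N)"
        unfolding mu_def using i by (subst Pi_pmf_component) auto
      also have "measure_pmf.prob (one_law ori (sa \<alpha> N)) {x. int (radius N) < \<bar>x\<bar>} \<le> sa \<alpha> N ^ radius N / fact (radius N)"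
        using elim by (intro one_law_tail) auto
      also have "\<dots> \<le> smax ^ radius N / fact (radius N)" using elim by (intro divide_right_mono power_mono) auto
      finally show "?P (?B i) \<le> smax ^ radius N / fact (radius N)" .
    qed
    also have "(\<Sum>i<k N. smax ^ radius N / fact (radius N)) = k N * (smax ^ radius N / fact (radius N))" by simp
    also have "\<dots> \<le> exp 1 ^ radius N * (smax ^ radius N / fact (radius N))"
    proof (rule mult_right_mono)
      have "real (k N) = exp (ln (real (k N)))" using k_pos[of N] by simp
      also have "\<dots> \<le> exp (radius N)" using radius_ge by simp
      also have "\<dots> = exp 1 ^ radius N" by (simp add: exp_of_nat_mult[symmetric])
      finally show "real (k N) \<le> exp 1 ^ radius N" .
    qed (use smax in auto)
    finally show ?case by (simp add: e_def power_mult_distrib)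
  qed
  ultimately show ?thesis using that[of e] by simp
qed

end

section \<open>Cutoff\<close>

lemma whpI:
  assumes b: "b \<longlonglongrightarrow> 0" and le: "\<forall>\<^sub>F N in sequentially. measure_pmf.prob (P N) {z. \<not> E N z} \<le> b N"
  shows "whp P E"
  unfolding whp_def
proof (rule tendsto_sandwich[OF _ _ _ tendsto_const])
  show "\<forall>\<^sub>F N in sequentially. 1 - b N \<le> measure_pmf.prob (P N) {z. E N z}"
    using le
  proof eventually_elim
    case (elim N)
    have "{z. E N z} = UNIV - {z. \<not> E N z}" by auto
    then have "measure_pmf.prob (P N) {z. E N z} = 1 - measure_pmf.prob (P N) {z. \<not> E N z}"
      using measure_pmf.prob_compl[of "{z. \<not> E N z}" "P N"] by simp
    with elim show ?case by simp
  qed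
  show "(\<lambda>N. 1 - b N) \<longlonglongrightarrow> 1" using tendsto_diff[OF tendsto_const[of 1] b] by simp
qed auto

locale random_cayley = entropic_regime k "\<lambda>N. card (carrier (G N))" c ori
  for G :: "nat \<Rightarrow> 'a monoid" and k :: "nat \<Rightarrow> nat" and c :: real and ori :: orientation +
  assumes group: "\<And>N. finite_comm_group (G N)"
    and d_upper: "\<And>N. real (min_gen_size (G N))
                     \<le> 1 / 5 * (ln (real (card (carrier (G N)))) / ln (ln (real (k N))))"
begin

abbreviation ord :: "nat \<Rightarrow> nat" where "ord N \<equiv> card (carrier (G N))"
abbreviation d :: "nat \<Rightarrow> nat" where "d N \<equiv> min_gen_size (G N)"
abbreviation gens :: "nat \<Rightarrow> (nat \<Rightarrow> 'a) pmf" where "gens N \<equiv> iid_generators (G N) (k N)"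
abbreviation dist_at :: "nat \<Rightarrow> (nat \<Rightarrow> 'a) \<Rightarrow> real \<Rightarrow> real" where "dist_at N Z \<equiv> cayley_dist ori (G N) (k N) Z"

lemma loglog_top: "filterlim (\<lambda>N. ln (ln (real (k N)))) at_top sequentially"
  by (rule filterlim_compose[OF ln_at_top filterlim_compose[OF ln_at_top real_k_top]])

lemma loglog_ge: "\<forall>\<^sub>F N in sequentially. ln (ln (real (k N))) \<ge> B"
  using loglog_top by (simp add: filterlim_at_top)

lemma exp_neg_ln_n: "a > 0 \<Longrightarrow> (\<lambda>N. exp (- (a * ln (real (ord N))))) \<longlonglongrightarrow> 0"
  by (rule filterlim_compose[OF exp_at_bot filterlim_compose[OF filterlim_uminus_at_bot_at_top
      filterlim_tendsto_pos_mult_at_top[OF tendsto_const _ ln_n_top]]])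

text \<open>The rank is of smaller order than \<open>ln |G|\<close> because \<open>ln (ln k)\<close>
  tends to infinity; so a fixed base raised to the rank is smaller than any positive power of
  \<open>|G|\<close>.\<close>

lemma rank_term_le:
  assumes a: "a > 0" and b: "b \<ge> 0"
  shows "\<forall>\<^sub>F N in sequentially. (real (d N) + 1) * b \<le> a * ln (ord N)"
proof -
  show ?thesis using loglog_ge[of "max 1 (b / a)"] ln_n_ge[of "max 1 (2 * b / a)"]
  proof eventually_elim
    case (elim N)
    let ?l = "ln (ln (real (k N)))" and ?n = "ln (real (ord N))"
    have l: "?l \<ge> 1" "?l \<ge> b / a" and n: "?n \<ge> 1" "?n \<ge> 2 * b / a" using elim by auto
    have "b \<le> a * ?l" using l(2) a by (simp add: field_simps)
    then have "b * ?n \<le> a * ?l * ?n" using n by (intro mult_right_mono) auto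
    then have 1: "?n / ?l * b \<le> a * ?n" using l by (simp add: field_simps)
    have "real (d N) * b \<le> 1 / 5 * (?n / ?l) * b" using d_upper[of N] b by (intro mult_right_mono) auto
    also have "\<dots> \<le> 1 / 5 * (a * ?n)" using 1 by simp
    finally have "real (d N) * b \<le> 1 / 5 * (a * ?n)" .
    moreover have "b \<le> a * ?n / 2" using n(2) a by (simp add: field_simps)
    moreover have "0 \<le> a * ?n" using a n by simp
    ultimately show ?case by (simp add: distrib_right)
  qed
qed

text \<open>The rank hypothesis is tailored to
  \<open>ln (2 * radius) \<le> ln 4 + ln (ln k)\<close>: the power has exponent at most
  \<open>1/5 + 1/100 + 1/200\<close> in units of \<open>ln |G|\<close>. This is below
  \<open>9/40\<close>, so \<open>1/4\<close> wins by \<open>1/40\<close>. The additional 1 in the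
  power counts the moduli.\<close>

lemma radius_term_limit:
  "(\<lambda>N. real (2 * radius N) ^ (d N + 1) * (1 / ord N) powr (1/4)) \<longlonglongrightarrow> 0"
proof (rule Lim_null_comparison)
  show "(\<lambda>N. exp (- (1/40 * ln (real (ord N))))) \<longlonglongrightarrow> 0" by (rule exp_neg_ln_n) simp
  have k: "\<forall>\<^sub>F N in sequentially. ln (real (k N)) / ln (real (ord N)) < 1/200"
    by (rule order_tendstoD(2)[OF log_k]) simp
  note l = loglog_ge[of 1]
  have "(1/100 :: real) > 0" "ln (4::real) \<ge> 0" by auto
  from rank_term_le[OF this] show "\<forall>\<^sub>F N in sequentially. norm (real (2 * radius N) ^ (d N + 1) * (1 / ord N) powr (1/4)) \<le> exp (- (1/40 * ln (real (ord N))))"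
    using k l ln_n_ge[of 1]
  proof eventually_elim
    case (elim N)
    let ?n = "ln (real (ord N))" and ?k = "ln (real (k N))" and ?l = "ln (ln (real (k N)))"
    have n: "?n \<ge> 1" and l: "?l \<ge> 1" using elim by auto
    have kn: "?k \<le> 1/200 * ?n" using elim by (simp add: field_simps)
    have k0: "?k > 0"
    \<comment> \<open>Otherwise \<open>ln k = 0\<close>, and the default value
      \<open>ln 0 = 0\<close> contradicts \<open>ln (ln k) \<ge> 1\<close>.\<close>
    proof (rule ccontr)
      assume "\<not> ?k > 0"
      moreover have "?k \<ge> 0" using k_pos[of N] by simp
      ultimately show False using l by simp
    qed
    then have lk: "?l \<le> ?k - 1" by (intro ln_le_minus_one)
    then have k1: "?k \<ge> 1" using l by simp
    have r0: "radius N > 0" using radius_ge[of N] k0 by linarith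
    have "real (2 * radius N) \<le> 4 * ?k" using k1 unfolding radius_def by linarith
    then have "ln (real (2 * radius N)) \<le> ln (4 * ?k)" using r0 k0 by (subst ln_le_cancel_iff) auto
    also have "\<dots> = ln 4 + ?l" using k0 by (simp add: ln_mult)
    finally have lr: "ln (real (2 * radius N)) \<le> ln 4 + ?l" .
    have "(real (d N) + 1) * ln (real (2 * radius N)) \<le> (real (d N) + 1) * (ln 4 + ?l)"
      using lr by (intro mult_left_mono) auto
    also have "\<dots> = (real (d N) + 1) * ln 4 + real (d N) * ?l + ?l" by (simp add: algebra_simps)
    also have "real (d N) * ?l \<le> 1/5 * ?n" using d_upper[of N] l by (simp add: field_simps)
    finally have e: "(real (d N) + 1) * ln (real (2 * radius N)) \<le> 9/40 * ?n" using elim(1) kn lk n by linarith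
    have "real (2 * radius N) ^ (d N + 1) = exp (ln (real (2 * radius N))) ^ (d N + 1)" using r0 by simp
    also have "\<dots> = exp ((real (d N) + 1) * ln (real (2 * radius N)))"
      by (simp only: exp_of_nat_mult[symmetric]) (simp add: add.commute)
    also have "\<dots> \<le> exp (9/40 * ?n)" using e by simp
    finally have 1: "real (2 * radius N) ^ (d N + 1) \<le> exp (9/40 * ?n)" .
    have o: "real (ord N) > 0" using n by (cases "ord N = 0") auto
    have 2: "(1 / ord N) powr (1/4) = exp (- (1/4 * ?n))"
      using o by (simp add: powr_def ln_div)
    have "real (2 * radius N) ^ (d N + 1) * (1 / ord N) powr (1/4) \<le> exp (9/40 * ?n) * exp (- (1/4 * ?n))"
      unfolding 2 using 1 by (rule mult_right_mono) simp
    also have "\<dots> = exp (- (1/40 * ?n))" by (simp add: exp_add[symmetric])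
    finally show ?case by simp
  qed
qed

text \<open>The decay \<open>exp (- \<delta> * k)\<close> is at most
  \<open>|G| powr (- \<delta> * c)\<close>; half of this exponent is given up to absorb the power of
  \<open>\<Gamma>\<close>.\<close>

lemma constant_term_limit:
  fixes \<Gamma> \<delta> :: real
  assumes \<Gamma>: "\<Gamma> \<ge> 1" and \<delta>: "0 < \<delta>" "\<delta> < 1"
  shows "(\<lambda>N. \<Gamma> ^ (d N + 1) * (1 - \<delta>) ^ k N) \<longlonglongrightarrow> 0"
proof (rule Lim_null_comparison)
  have a: "\<delta> * c / 2 > 0" using \<delta> c_pos by simp
  show "(\<lambda>N. exp (- (\<delta> * c / 2 * ln (real (ord N))))) \<longlonglongrightarrow> 0" by (rule exp_neg_ln_n[OF a])
  have "ln \<Gamma> \<ge> 0" using \<Gamma> by simp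
  from rank_term_le[OF a this] show "\<forall>\<^sub>F N in sequentially. norm (\<Gamma> ^ (d N + 1) * (1 - \<delta>) ^ k N) \<le> exp (- (\<delta> * c / 2 * ln (real (ord N))))"
  proof eventually_elim
    case (elim N)
    have "\<Gamma> ^ (d N + 1) = exp (ln \<Gamma>) ^ (d N + 1)" using \<Gamma> by simp
    also have "\<dots> = exp ((real (d N) + 1) * ln \<Gamma>)"
      by (simp only: exp_of_nat_mult[symmetric]) (simp add: add.commute)
    finally have 1: "\<Gamma> ^ (d N + 1) = exp ((real (d N) + 1) * ln \<Gamma>)" .
    have "(1 - \<delta>) ^ k N \<le> exp (- \<delta>) ^ k N"
      using \<delta> exp_ge_add_one_self[of "- \<delta>"] by (intro power_mono) auto
    also have "\<dots> = exp (- (\<delta> * k N))" by (simp add: exp_of_nat_mult[symmetric] mult.commute)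
    finally have "\<Gamma> ^ (d N + 1) * (1 - \<delta>) ^ k N \<le> exp ((real (d N) + 1) * ln \<Gamma>) * exp (- (\<delta> * k N))"
      unfolding 1 by (intro mult_left_mono) auto
    also have "\<dots> = exp ((real (d N) + 1) * ln \<Gamma> - \<delta> * k N)" by (simp add: exp_diff exp_minus divide_inverse)
    also have "\<dots> \<le> exp (- (\<delta> * c / 2 * ln (real (ord N))))"
    proof -
      have "\<delta> * (c * ln (real (ord N))) \<le> \<delta> * k N" using k_lower[of N] \<delta> by (intro mult_left_mono) auto
      then show ?thesis using elim by simp
    qed
    finally show ?case using \<Gamma> \<delta> by simp
  qed
qed

lemma gens_PiE: "Z \<in> set_pmf (gens N) \<Longrightarrow> Z \<in> {..<k N} \<rightarrow>\<^sub>E carrier (G N)"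
  by (rule finite_comm_group.set_iid_generators[OF group])

lemma lattice_law_mu: "sa \<alpha> N > 0 \<Longrightarrow> lattice_law ori (k N) (k N * sa \<alpha> N) = mu \<alpha> N"
  using k_pos[of N] by (simp add: lattice_law_Pi_pmf mu_def)

text \<open>Only deviations above \<open>Psi \<alpha>\<close> need the randomness of the generators;
  those below are excluded for every choice of \<open>Z\<close>.\<close>

lemma dist_upper:
  assumes \<eta>: "\<eta> > 0"
  shows "(\<lambda>N. measure_pmf.prob (gens N) {Z. dist_at N Z (k N * sa \<alpha> N) > Psi \<alpha> + \<eta>}) \<longlonglongrightarrow> 0"
proof -
  obtain e where e: "e \<longlonglongrightarrow> 0" "\<forall>\<^sub>F N in sequentially. 1 - measure_pmf.prob (mu \<alpha> N) (typical \<alpha> N) \<le> Psi \<alpha> + e N"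
    using prob_not_typical by blast
  obtain \<Gamma> \<delta> where \<delta>: "0 < \<delta>" "\<delta> < 1" and cong: "congruent_mass_bound ori smax \<Gamma> \<delta>"
    using congruent_mass_uniform[OF smax(2), of ori] by blast
  define \<Gamma>' where "\<Gamma>' = max 1 \<Gamma>"
  \<comment> \<open>In this order: equal pairs, pairs congruent modulo any \<open>\<gamma>\<close>
    up to \<open>2 * radius\<close> by the tilt, and pairs congruent modulo a bounded
    \<open>\<gamma>\<close>.\<close>
  define b where "b N = exp (- gap N) + real (2 * radius N) ^ (d N + 1) * (1 / ord N) powr (1/4) + real \<Gamma>' ^ (d N + 1) * (1 - \<delta>) ^ k N" for N
  have "b \<longlonglongrightarrow> 0 + 0 + 0"
    unfolding b_def by (intro tendsto_add exp_gap radius_term_limit constant_term_limit \<delta>) (simp add: \<Gamma>'_def)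
  \<comment> \<open>One half of \<open>\<eta>\<close> goes to the square root of the collision
    excess, the other half absorbs the error in the mass of the typical set.\<close>
  then have "(\<lambda>N. b N / (\<eta> / 2)\<^sup>2) \<longlonglongrightarrow> 0" by (intro tendsto_divide_zero) simp
  moreover have "\<forall>\<^sub>F N in sequentially. norm (measure_pmf.prob (gens N) {Z. dist_at N Z (k N * sa \<alpha> N) > Psi \<alpha> + \<eta>}) \<le> b N / (\<eta> / 2)\<^sup>2"
    using sa[of \<alpha>] e(2) order_tendstoD(2)[OF e(1) half_gt_zero[OF \<eta>]] n_ge[of 1] sdev_pos
  proof eventually_elim
    case (elim N)
    interpret finite_comm_group "G N" by (rule group)
    let ?T = "typical \<alpha> N" and ?\<mu> = "mu \<alpha> N" and ?n = "real (ord N)"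
    have n: "?n > 0" using elim by simp
    have s: "0 < sa \<alpha> N" "sa \<alpha> N \<le> smax" using elim by auto
    have T: "(\<forall>i\<ge>k N. w i = 0) \<and> (\<forall>i<k N. \<bar>w i\<bar> \<le> int (radius N))" if "w \<in> ?T" for w
      using that by (simp add: typical_def)
    have gap: "exp (- gap N) \<le> 1" using elim by (simp add: gap_def)
    have pT: "pmf ?\<mu> w \<le> exp (- gap N) / ?n" if "w \<in> ?T" for w using that by (simp add: typical_def)
    have pT1: "pmf ?\<mu> w \<le> 1 / ?n" if "w \<in> ?T" for w
      using pT[OF that] divide_right_mono[OF gap, of ?n] n by linarith
    have mass: "(\<Sum>w\<in>?T. pmf ?\<mu> w) \<le> 1"
      using finite_typical by (simp add: measure_measure_pmf_finite[symmetric])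
    have sq: "?n * (\<Sum>w\<in>?T. (pmf ?\<mu> w)\<^sup>2) \<le> exp (- gap N)"
    proof -
      have "(\<Sum>w\<in>?T. (pmf ?\<mu> w)\<^sup>2) \<le> (\<Sum>w\<in>?T. exp (- gap N) / ?n * pmf ?\<mu> w)"
        unfolding power2_eq_square by (intro sum_mono mult_right_mono pT) auto
      also have "\<dots> = exp (- gap N) / ?n * (\<Sum>w\<in>?T. pmf ?\<mu> w)" by (simp only: sum_distrib_left)
      also have "\<dots> \<le> exp (- gap N) / ?n * 1" using mass n by (intro mult_left_mono) auto
      finally show ?thesis using n by (simp add: field_simps)
    qed
    let ?C = "\<lambda>\<gamma>. \<Sum>w\<in>?T. pmf ?\<mu> w * (\<Sum>w'\<in>{w'\<in>?T. \<forall>i<k N. int \<gamma> dvd w i - w' i}. pmf ?\<mu> w')"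
    have C: "?C \<gamma> \<le> (1 / ?n) powr (1/4) + (if \<gamma> \<le> \<Gamma> then (1 - \<delta>) ^ k N else 0)" if "\<gamma> \<ge> 2" for \<gamma>
      unfolding mu_def
      by (rule cong[unfolded congruent_mass_bound_def, rule_format, OF s that n finite_typical])
        (use T pT1[unfolded mu_def] in blast)+
    have "(\<Sum>\<gamma>=2..2 * radius N. real \<gamma> ^ d N * ?C \<gamma>) \<le> (\<Sum>\<gamma>=2..2 * radius N. real \<gamma> ^ d N * ((1 / ?n) powr (1/4) + (if \<gamma> \<le> \<Gamma> then (1 - \<delta>) ^ k N else 0)))"
      by (intro sum_mono mult_left_mono C) auto
    also have "\<dots> = (\<Sum>\<gamma>=2..2 * radius N. real \<gamma> ^ d N * (1 / ?n) powr (1/4)) + (\<Sum>\<gamma>=2..2 * radius N. if \<gamma> \<le> \<Gamma> then real \<gamma> ^ d N * (1 - \<delta>) ^ k N else 0)"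
      unfolding sum.distrib[symmetric] by (intro sum.cong refl) (simp add: distrib_left)
    also have "(\<Sum>\<gamma>=2..2 * radius N. real \<gamma> ^ d N * (1 / ?n) powr (1/4)) \<le> (\<Sum>\<gamma>=1..2 * radius N. real (2 * radius N) ^ d N * (1 / ?n) powr (1/4))"
    proof (rule order.trans)
      show "(\<Sum>\<gamma>=2..2 * radius N. real \<gamma> ^ d N * (1 / ?n) powr (1/4)) \<le> (\<Sum>\<gamma>=2..2 * radius N. real (2 * radius N) ^ d N * (1 / ?n) powr (1/4))"
        by (intro sum_mono mult_right_mono power_mono of_nat_mono) (simp_all only: atLeastAtMost_iff of_nat_0_le_iff powr_ge_zero)
    qed (rule sum_mono2; simp)
    also have "\<dots> = real (2 * radius N) ^ (d N + 1) * (1 / ?n) powr (1/4)" by simp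
    also have "(\<Sum>\<gamma>=2..2 * radius N. if \<gamma> \<le> \<Gamma> then real \<gamma> ^ d N * (1 - \<delta>) ^ k N else 0) = (\<Sum>\<gamma>\<in>{\<gamma>\<in>{2..2 * radius N}. \<gamma> \<le> \<Gamma>}. real \<gamma> ^ d N * (1 - \<delta>) ^ k N)"
      by (simp only: sum.inter_filter finite_atLeastAtMost)
    also have "\<dots> \<le> (\<Sum>\<gamma>\<in>{1..\<Gamma>'}. real \<Gamma>' ^ d N * (1 - \<delta>) ^ k N)"
    proof (rule order.trans)
      show "(\<Sum>\<gamma>\<in>{\<gamma>\<in>{2..2 * radius N}. \<gamma> \<le> \<Gamma>}. real \<gamma> ^ d N * (1 - \<delta>) ^ k N)
        \<le> (\<Sum>\<gamma>\<in>{\<gamma>\<in>{2..2 * radius N}. \<gamma> \<le> \<Gamma>}. real \<Gamma>' ^ d N * (1 - \<delta>) ^ k N)"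
        using \<delta> by (intro sum_mono mult_right_mono power_mono) (auto simp: \<Gamma>'_def)
    qed (rule sum_mono2; use \<delta> in \<open>auto simp: \<Gamma>'_def\<close>)
    also have "\<dots> = real \<Gamma>' ^ (d N + 1) * (1 - \<delta>) ^ k N" by simp
    finally have tot: "?n * (\<Sum>w\<in>?T. (pmf ?\<mu> w)\<^sup>2) + (\<Sum>\<gamma>=2..2 * radius N. real \<gamma> ^ d N * ?C \<gamma>) \<le> b N"
      using sq unfolding b_def by linarith
    have "sqrt ((\<eta> / 2)\<^sup>2) = \<eta> / 2" using \<eta> by simp
    then have sub: "{Z. dist_at N Z (k N * sa \<alpha> N) > Psi \<alpha> + \<eta>} \<subseteq>
        {Z. dist_at N Z (k N * sa \<alpha> N) > 1 - measure_pmf.prob ?\<mu> ?T + sqrt ((\<eta> / 2)\<^sup>2)}"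
      using elim by auto
    have "measure_pmf.prob (gens N) {Z. dist_at N Z (k N * sa \<alpha> N) > Psi \<alpha> + \<eta>}
      \<le> measure_pmf.prob (gens N) {Z. dist_at N Z (k N * sa \<alpha> N) > 1 - measure_pmf.prob ?\<mu> ?T + sqrt ((\<eta> / 2)\<^sup>2)}"
      by (intro measure_pmf.finite_measure_mono sub) auto
    also have "\<dots> \<le> (?n * (\<Sum>w\<in>?T. (pmf ?\<mu> w)\<^sup>2) + (\<Sum>\<gamma>=2..2 * radius N. real \<gamma> ^ d N * ?C \<gamma>)) / (\<eta> / 2)\<^sup>2"
      using prob_cayley_dist_large[OF k_pos[of N] finite_typical[of \<alpha> N] T, of "(\<eta> / 2)\<^sup>2" ori "k N * sa \<alpha> N"] \<eta> elim
      by (simp add: lattice_law_mu)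
    also have "\<dots> \<le> b N / (\<eta> / 2)\<^sup>2" using tot by (intro divide_right_mono) auto
    finally show ?case by simp
  qed
  ultimately show ?thesis by (rule Lim_null_comparison[rotated])
qed

lemma dist_lower:
  obtains r where "r \<longlonglongrightarrow> 0" "\<forall>\<^sub>F N in sequentially. \<forall>Z\<in>{..<k N} \<rightarrow>\<^sub>E carrier (G N). dist_at N Z (k N * sa \<alpha> N) \<ge> Psi \<alpha> - r N"
proof -
  define l where "l N = measure_pmf.prob (mu \<alpha> N) {w. exp (gap N) / ord N \<le> pmf (mu \<alpha> N) w} - exp (- gap N)" for N
  have "(\<lambda>N. Psi \<alpha> - l N) \<longlonglongrightarrow> Psi \<alpha> - Psi \<alpha>" unfolding l_def by (intro tendsto_diff tendsto_const lower_limit)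
  moreover have "\<forall>\<^sub>F N in sequentially. \<forall>Z\<in>{..<k N} \<rightarrow>\<^sub>E carrier (G N). dist_at N Z (k N * sa \<alpha> N) \<ge> Psi \<alpha> - (Psi \<alpha> - l N)"
    using sa[of \<alpha>]
  proof eventually_elim
    case (elim N)
    interpret finite_comm_group "G N" by (rule group)
    show ?case
    proof
      fix Z assume "Z \<in> {..<k N} \<rightarrow>\<^sub>E carrier (G N)"
      then have Z: "Z \<in> {..<k N} \<rightarrow> carrier (G N)" by (auto simp: PiE_def)
      show "dist_at N Z (k N * sa \<alpha> N) \<ge> Psi \<alpha> - (Psi \<alpha> - l N)"
        using cayley_dist_lower[OF Z k_pos[of N], of ori "k N * sa \<alpha> N" "gap N"] elim by (simp add: lattice_law_mu l_def)
    qed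
  qed
  ultimately show ?thesis using that[of "\<lambda>N. Psi \<alpha> - l N"] by simp
qed

section \<open>Mixing times and the cutoff window\<close>

abbreviation time :: "nat \<Rightarrow> real \<Rightarrow> real" where "time N \<alpha> \<equiv> entropic_time ori (k N) (ord N) \<alpha>"
abbreviation tmix :: "nat \<Rightarrow> (nat \<Rightarrow> 'a) \<Rightarrow> real \<Rightarrow> ereal" where "tmix N Z \<equiv> t_mix ori (G N) (k N) Z"

lemma time_ratio: "(\<lambda>N. time N \<alpha> / time N 0) \<longlonglongrightarrow> 1"
proof -
  have "\<forall>\<^sub>F N in sequentially. sa \<alpha> N / s0 N = time N \<alpha> / time N 0"
    using entropic_time_sa[of \<alpha>] entropic_time_sa[of 0]
  proof eventually_elim
    case (elim N)
    then show ?case using k_pos[of N] by simp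
  qed
  from Lim_transform_eventually[OF sa_ratio this] show ?thesis .
qed

lemma dist_in_prob: "tendsto_in_prob gens (\<lambda>N Z. dist_at N Z (time N \<alpha>)) (Psi \<alpha>)"
  unfolding tendsto_in_prob_def
proof (intro allI impI)
  fix \<delta> :: real assume \<delta>: "\<delta> > 0"
  obtain r where r: "r \<longlonglongrightarrow> 0" "\<forall>\<^sub>F N in sequentially. \<forall>Z\<in>{..<k N} \<rightarrow>\<^sub>E carrier (G N). dist_at N Z (k N * sa \<alpha> N) \<ge> Psi \<alpha> - r N"
    by (rule dist_lower[of \<alpha>])
  have "\<forall>\<^sub>F N in sequentially. norm (measure_pmf.prob (gens N) {Z. \<bar>dist_at N Z (time N \<alpha>) - Psi \<alpha>\<bar> > \<delta>})
      \<le> measure_pmf.prob (gens N) {Z. dist_at N Z (k N * sa \<alpha> N) > Psi \<alpha> + \<delta>}"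
    using r(2) order_tendstoD(2)[OF r(1) \<delta>] entropic_time_sa[of \<alpha>]
  proof eventually_elim
    case (elim N)
    have "measure_pmf.prob (gens N) {Z. \<bar>dist_at N Z (time N \<alpha>) - Psi \<alpha>\<bar> > \<delta>}
       \<le> measure_pmf.prob (gens N) {Z. dist_at N Z (k N * sa \<alpha> N) > Psi \<alpha> + \<delta>}"
    proof (rule measure_pmf.finite_measure_mono_AE)
      show "AE Z in measure_pmf (gens N). Z \<in> {Z. \<bar>dist_at N Z (time N \<alpha>) - Psi \<alpha>\<bar> > \<delta>} \<longrightarrow> Z \<in> {Z. dist_at N Z (k N * sa \<alpha> N) > Psi \<alpha> + \<delta>}"
      proof (intro AE_pmfI impI)
        fix Z assume Z: "Z \<in> set_pmf (gens N)" "Z \<in> {Z. \<bar>dist_at N Z (time N \<alpha>) - Psi \<alpha>\<bar> > \<delta>}"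
        have "dist_at N Z (k N * sa \<alpha> N) \<ge> Psi \<alpha> - r N" using elim gens_PiE[OF Z(1)] by blast
        then show "Z \<in> {Z. dist_at N Z (k N * sa \<alpha> N) > Psi \<alpha> + \<delta>}" using Z(2) elim by auto
      qed
    qed auto
    then show ?case by simp
  qed
  from Lim_null_comparison[OF this dist_upper[OF \<delta>]]
  show "(\<lambda>N. measure_pmf.prob (gens N) {Z. \<bar>dist_at N Z (time N \<alpha>) - Psi \<alpha>\<bar> > \<delta>}) \<longlonglongrightarrow> 0" .
qed

lemma dist_lower_Inf:
  "\<exists>r. r \<longlonglongrightarrow> 0 \<and> (\<forall>N. (INF Z \<in> {..<k N} \<rightarrow>\<^sub>E carrier (G N). dist_at N Z (time N \<alpha>)) \<ge> Psi \<alpha> - r N)"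
proof -
  obtain r where r: "r \<longlonglongrightarrow> 0" "\<forall>\<^sub>F N in sequentially. \<forall>Z\<in>{..<k N} \<rightarrow>\<^sub>E carrier (G N). dist_at N Z (k N * sa \<alpha> N) \<ge> Psi \<alpha> - r N"
    by (rule dist_lower[of \<alpha>])
  define I where "I N = (INF Z \<in> {..<k N} \<rightarrow>\<^sub>E carrier (G N). dist_at N Z (time N \<alpha>))" for N
  \<comment> \<open>Taken from the infimum itself, so that the inequality holds for every
    \<open>N\<close>, including the initial ones about which the asymptotic bounds say
    nothing.\<close>
  define r' where "r' N = max 0 (Psi \<alpha> - I N)" for N
  have "\<forall>\<^sub>F N in sequentially. norm (r' N) \<le> \<bar>r N\<bar>"
    using r(2) entropic_time_sa[of \<alpha>]
  proof eventually_elim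
    case (elim N)
    have ne: "{..<k N} \<rightarrow>\<^sub>E carrier (G N) \<noteq> {}"
      using gens_PiE[of _ N] set_pmf_not_empty[of "gens N"] by blast
    have "Psi \<alpha> - r N \<le> I N" unfolding I_def using elim by (intro cINF_greatest[OF ne]) auto
    then show ?case by (auto simp: r'_def)
  qed
  from Lim_null_comparison[OF this tendsto_rabs_zero[OF r(1)]] have "r' \<longlonglongrightarrow> 0" .
  moreover have "Psi \<alpha> - r' N \<le> I N" for N by (simp add: r'_def)
  ultimately show ?thesis unfolding I_def by blast
qed

text \<open>\<open>Psi\<close> is strictly decreasing, so shifting \<alpha> by \<open>\<eta>\<close>
  separates the limiting distances from \<open>\<epsilon>\<close>, and monotonicity in time traps
  the mixing time. The lower side eventually holds for every \<open>Z\<close>; hence only the upper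
  bound on the distance enters the error probability.\<close>

lemma tmix_between:
  assumes \<epsilon>: "0 < \<epsilon>" "\<epsilon> < 1" and \<eta>: "\<eta> > 0"
  obtains b where "b \<longlonglongrightarrow> 0" "\<forall>\<^sub>F N in sequentially. measure_pmf.prob (gens N)
    {Z. \<not> (ereal (time N (the_inv Psi \<epsilon> - \<eta>)) \<le> tmix N Z \<epsilon> \<and> tmix N Z \<epsilon> \<le> ereal (time N (the_inv Psi \<epsilon> + \<eta>)))} \<le> b N"
proof -
  let ?\<alpha> = "the_inv Psi \<epsilon>"
  have up: "Psi (?\<alpha> + \<eta>) < \<epsilon>" using Psi_strict_antimono[of ?\<alpha> "?\<alpha> + \<eta>"] \<eta> Psi_surj[OF \<epsilon>] by simp
  have lo: "\<epsilon> < Psi (?\<alpha> - \<eta>)" using Psi_strict_antimono[of "?\<alpha> - \<eta>" ?\<alpha>] \<eta> Psi_surj[OF \<epsilon>] by simp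
  define \<delta> where "\<delta> = \<epsilon> - Psi (?\<alpha> + \<eta>)"
  have \<delta>: "\<delta> > 0" using up by (simp add: \<delta>_def)
  obtain r where r: "r \<longlonglongrightarrow> 0" "\<forall>\<^sub>F N in sequentially. \<forall>Z\<in>{..<k N} \<rightarrow>\<^sub>E carrier (G N). dist_at N Z (k N * sa (?\<alpha> - \<eta>) N) \<ge> Psi (?\<alpha> - \<eta>) - r N"
    by (rule dist_lower[of "?\<alpha> - \<eta>"])
  have lo': "0 < Psi (?\<alpha> - \<eta>) - \<epsilon>" using lo by simp
  show ?thesis
  proof (rule that[OF dist_upper[OF \<delta>, of "?\<alpha> + \<eta>"]])
    show "\<forall>\<^sub>F N in sequentially. measure_pmf.prob (gens N)
      {Z. \<not> (ereal (time N (?\<alpha> - \<eta>)) \<le> tmix N Z \<epsilon> \<and> tmix N Z \<epsilon> \<le> ereal (time N (?\<alpha> + \<eta>)))}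
      \<le> measure_pmf.prob (gens N) {Z. dist_at N Z (k N * sa (?\<alpha> + \<eta>) N) > Psi (?\<alpha> + \<eta>) + \<delta>}"
      using r(2) order_tendstoD(2)[OF r(1) lo'] entropic_time_sa[of "?\<alpha> + \<eta>"] entropic_time_sa[of "?\<alpha> - \<eta>"] sa[of "?\<alpha> + \<eta>"] sa[of "?\<alpha> - \<eta>"]
    proof eventually_elim
      case (elim N)
      interpret finite_comm_group "G N" by (rule group)
      let ?t = "k N * sa (?\<alpha> + \<eta>) N" and ?u = "k N * sa (?\<alpha> - \<eta>) N"
      have tu: "?t \<ge> 0" "?u \<ge> 0" using elim by auto
      show ?case
      proof (rule measure_pmf.finite_measure_mono_AE)
        show "AE Z in measure_pmf (gens N). Z \<in> {Z. \<not> (ereal (time N (?\<alpha> - \<eta>)) \<le> tmix N Z \<epsilon> \<and> tmix N Z \<epsilon> \<le> ereal (time N (?\<alpha> + \<eta>)))}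
           \<longrightarrow> Z \<in> {Z. dist_at N Z ?t > Psi (?\<alpha> + \<eta>) + \<delta>}"
        proof (intro AE_pmfI impI)
          fix Z assume Z: "Z \<in> set_pmf (gens N)" "Z \<in> {Z. \<not> (ereal (time N (?\<alpha> - \<eta>)) \<le> tmix N Z \<epsilon> \<and> tmix N Z \<epsilon> \<le> ereal (time N (?\<alpha> + \<eta>)))}"
          have ZP: "Z \<in> {..<k N} \<rightarrow>\<^sub>E carrier (G N)" by (rule gens_PiE[OF Z(1)])
          then have Zc: "Z \<in> {..<k N} \<rightarrow> carrier (G N)" by (auto simp: PiE_def)
          have "dist_at N Z ?u \<ge> Psi (?\<alpha> - \<eta>) - r N" using elim ZP by blast
          then have u: "dist_at N Z ?u > \<epsilon>" using elim by linarith
          have "ereal ?u \<le> tmix N Z \<epsilon>"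
            unfolding t_mix_def
          proof (rule Inf_greatest)
            fix x assume "x \<in> ereal ` {t. 0 \<le> t \<and> dist_at N Z t \<le> \<epsilon>}"
            then obtain t where t: "x = ereal t" "0 \<le> t" "dist_at N Z t \<le> \<epsilon>" by auto
            have "\<not> t \<le> ?u"
            proof
              assume "t \<le> ?u"
              then have "dist_at N Z ?u \<le> dist_at N Z t" by (rule cayley_dist_antimono[OF Zc k_pos t(2)])
              then show False using u t(3) by linarith
            qed
            then show "ereal ?u \<le> x" using t(1) by simp
          qed
          then have "\<not> tmix N Z \<epsilon> \<le> ereal ?t" using Z(2) elim by auto
          moreover have "tmix N Z \<epsilon> \<le> ereal ?t" if "dist_at N Z ?t \<le> \<epsilon>"
            unfolding t_mix_def using that tu by (intro Inf_lower) auto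
          ultimately have "dist_at N Z ?t > \<epsilon>" by (meson not_le)
          then show "Z \<in> {Z. dist_at N Z ?t > Psi (?\<alpha> + \<eta>) + \<delta>}" by (simp add: \<delta>_def)
        qed
      qed auto
    qed
  qed
qed

text \<open>Any fixed shift will do here, as \<open>t\<^sub>\<beta> / t\<^sub>0\<close> tends to 1
  for every \<open>\<beta>\<close>; the choice is 1.\<close>

lemma tmix_cutoff:
  assumes \<epsilon>: "0 < \<epsilon>" "\<epsilon> < 1" and \<delta>: "\<delta> > 0"
  shows "whp gens (\<lambda>N Z. \<bar>tmix N Z \<epsilon> - ereal (time N 0)\<bar> \<le> ereal (\<delta> * time N 0))"
proof -
  let ?\<alpha> = "the_inv Psi \<epsilon>"
  obtain b where b: "b \<longlonglongrightarrow> 0" "\<forall>\<^sub>F N in sequentially. measure_pmf.prob (gens N)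
    {Z. \<not> (ereal (time N (?\<alpha> - 1)) \<le> tmix N Z \<epsilon> \<and> tmix N Z \<epsilon> \<le> ereal (time N (?\<alpha> + 1)))} \<le> b N"
    using tmix_between[OF \<epsilon> zero_less_one] by blast
  have near: "\<forall>\<^sub>F N in sequentially. \<bar>time N \<beta> - time N 0\<bar> \<le> \<delta> * time N 0" for \<beta>
    using tendstoD[OF time_ratio[of \<beta>] \<delta>] entropic_time_sa[of \<beta>] s0
  proof eventually_elim
    case (elim N)
    have t: "time N 0 > 0" using elim k_pos[of N] by simp
    have "\<bar>time N \<beta> - time N 0\<bar> = \<bar>time N \<beta> / time N 0 - 1\<bar> * time N 0"
      using t by (simp add: abs_if field_simps)
    also have "\<dots> \<le> \<delta> * time N 0" using elim t by (intro mult_right_mono) (auto simp: dist_real_def)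
    finally show ?case .
  qed
  show ?thesis
  proof (rule whpI[OF b(1)])
    show "\<forall>\<^sub>F N in sequentially. measure_pmf.prob (gens N) {Z. \<not> \<bar>tmix N Z \<epsilon> - ereal (time N 0)\<bar> \<le> ereal (\<delta> * time N 0)} \<le> b N"
      using b(2) near[of "?\<alpha> - 1"] near[of "?\<alpha> + 1"]
    proof eventually_elim
      case (elim N)
      have "\<bar>tmix N Z \<epsilon> - ereal (time N 0)\<bar> \<le> ereal (\<delta> * time N 0)"
        if "ereal (time N (?\<alpha> - 1)) \<le> tmix N Z \<epsilon>" "tmix N Z \<epsilon> \<le> ereal (time N (?\<alpha> + 1))" for Z
        using that elim by (cases "tmix N Z \<epsilon>") auto
      then have "measure_pmf.prob (gens N) {Z. \<not> \<bar>tmix N Z \<epsilon> - ereal (time N 0)\<bar> \<le> ereal (\<delta> * time N 0)}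
        \<le> measure_pmf.prob (gens N) {Z. \<not> (ereal (time N (?\<alpha> - 1)) \<le> tmix N Z \<epsilon> \<and> tmix N Z \<epsilon> \<le> ereal (time N (?\<alpha> + 1)))}"
        by (intro measure_pmf.finite_measure_mono) auto
      with elim show ?case by linarith
    qed
  qed
qed

text \<open>Puts all differences of entropic times on one scale, so that the profile reduces to
  linear inequalities.\<close>

lemma time_window:
  assumes "\<eta> > 0"
  shows "\<forall>\<^sub>F N in sequentially. sdev N / entropy_rate ori (s0 N) > 0 \<and>
    \<bar>(time N \<beta> - time N \<alpha>) - (\<beta> - \<alpha>) * (sdev N / entropy_rate ori (s0 N))\<bar> \<le> \<eta> * (sdev N / entropy_rate ori (s0 N))"
  using tendstoD[OF sa_window[of \<beta> \<alpha>] assms] entropic_time_sa[of \<alpha>] entropic_time_sa[of \<beta>] s0 sdev_pos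
proof eventually_elim
  case (elim N)
  define u where "u = sdev N / entropy_rate ori (s0 N)"
  have r: "entropy_rate ori (s0 N) > 0" using elim entropy_rate_pos by auto
  have u: "u > 0" using elim r by (simp add: u_def)
  have scale: "(x / u - y) * u = x - y * u" for x y using u by (simp add: left_diff_distrib)
  have "(sa \<beta> N - sa \<alpha> N) * (entropy_rate ori (s0 N) * k N / sdev N) = (time N \<beta> - time N \<alpha>) / u"
    using elim r by (simp add: u_def field_simps)
  then have "\<bar>(time N \<beta> - time N \<alpha>) / u - (\<beta> - \<alpha>)\<bar> \<le> \<eta>" using elim by (simp add: dist_real_def)
  then have "\<bar>(time N \<beta> - time N \<alpha>) / u - (\<beta> - \<alpha>)\<bar> * u \<le> \<eta> * u" using u by (intro mult_right_mono) auto
  also have "\<bar>(time N \<beta> - time N \<alpha>) / u - (\<beta> - \<alpha>)\<bar> * u = \<bar>((time N \<beta> - time N \<alpha>) / u - (\<beta> - \<alpha>)) * u\<bar>"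
    using u by (simp add: abs_mult)
  also have "((time N \<beta> - time N \<alpha>) / u - (\<beta> - \<alpha>)) * u = (time N \<beta> - time N \<alpha>) - (\<beta> - \<alpha>) * u"
    by (rule scale)
  finally show ?case using u by (simp add: u_def)
qed

lemma tmix_profile:
  assumes \<epsilon>: "0 < \<epsilon>" "\<epsilon> < 1" and \<delta>: "\<delta> > 0"
  shows "whp gens (\<lambda>N Z. \<bar>(tmix N Z \<epsilon> - tmix N Z (1 / 2)) - ereal (time N (the_inv Psi \<epsilon>) - time N 0)\<bar>
              \<le> ereal (\<delta> * \<bar>time N (the_inv Psi \<epsilon>) - time N 0\<bar>))"
proof -
  let ?\<alpha> = "the_inv Psi \<epsilon>"
  have half: "the_inv Psi (1/2) = 0" using the_inv_f_f[OF inj_Psi, of 0] by (simp add: Psi_0)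
  define q where "q = min 1 \<delta>"
  have q: "0 < q" "q \<le> 1" "q \<le> \<delta>" using \<delta> by (auto simp: q_def)
  \<comment> \<open>If the quantile is 0, then \<open>\<epsilon> = 1/2\<close>, the two mixing times
    coincide and any positive value serves. Otherwise \<open>\<eta>\<close> has to be small relative
    to the quantile, since the permitted error is proportional to the window.\<close>
  define \<eta> where "\<eta> = (if ?\<alpha> = 0 then 1 else q * \<bar>?\<alpha>\<bar> / 16)"
  have \<eta>: "\<eta> > 0" using q by (simp add: \<eta>_def)
  obtain b1 where b1: "b1 \<longlonglongrightarrow> 0" "\<forall>\<^sub>F N in sequentially. measure_pmf.prob (gens N)
    {Z. \<not> (ereal (time N (?\<alpha> - \<eta>)) \<le> tmix N Z \<epsilon> \<and> tmix N Z \<epsilon> \<le> ereal (time N (?\<alpha> + \<eta>)))} \<le> b1 N"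
    using tmix_between[OF \<epsilon> \<eta>] by blast
  have h: "(0::real) < 1/2" "1/2 < (1::real)" by auto
  obtain b2 where b2: "b2 \<longlonglongrightarrow> 0" "\<forall>\<^sub>F N in sequentially. measure_pmf.prob (gens N)
    {Z. \<not> (ereal (time N (- \<eta>)) \<le> tmix N Z (1/2) \<and> tmix N Z (1/2) \<le> ereal (time N \<eta>))} \<le> b2 N"
    using tmix_between[OF h \<eta>] unfolding half by auto
  have b: "(\<lambda>N. b1 N + b2 N) \<longlonglongrightarrow> 0" using tendsto_add[OF b1(1) b2(1)] by simp
  show ?thesis
  proof (rule whpI[OF b])
    show "\<forall>\<^sub>F N in sequentially. measure_pmf.prob (gens N) {Z. \<not> \<bar>(tmix N Z \<epsilon> - tmix N Z (1 / 2)) - ereal (time N ?\<alpha> - time N 0)\<bar>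
              \<le> ereal (\<delta> * \<bar>time N ?\<alpha> - time N 0\<bar>)} \<le> b1 N + b2 N"
      using b1(2) b2(2) time_window[OF \<eta>, of "?\<alpha> + \<eta>" "- \<eta>"] time_window[OF \<eta>, of "?\<alpha> - \<eta>" \<eta>] time_window[OF \<eta>, of ?\<alpha> 0]
    proof eventually_elim
      case (elim N)
      let ?B1 = "{Z. \<not> (ereal (time N (?\<alpha> - \<eta>)) \<le> tmix N Z \<epsilon> \<and> tmix N Z \<epsilon> \<le> ereal (time N (?\<alpha> + \<eta>)))}"
      let ?B2 = "{Z. \<not> (ereal (time N (- \<eta>)) \<le> tmix N Z (1/2) \<and> tmix N Z (1/2) \<le> ereal (time N \<eta>))}"
      define u where "u = sdev N / entropy_rate ori (s0 N)"
      define D where "D = time N ?\<alpha> - time N 0"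
      have u: "u > 0" using elim by (simp add: u_def)
      have good: "\<bar>(tmix N Z \<epsilon> - tmix N Z (1 / 2)) - ereal D\<bar> \<le> ereal (\<delta> * \<bar>D\<bar>)"
        if Z1: "ereal (time N (?\<alpha> - \<eta>)) \<le> tmix N Z \<epsilon>" "tmix N Z \<epsilon> \<le> ereal (time N (?\<alpha> + \<eta>))"
          and Z2: "ereal (time N (- \<eta>)) \<le> tmix N Z (1/2)" "tmix N Z (1/2) \<le> ereal (time N \<eta>)" for Z
      proof -
        obtain x where x: "tmix N Z \<epsilon> = ereal x" using Z1 by (cases "tmix N Z \<epsilon>") auto
        obtain y where y: "tmix N Z (1/2) = ereal y" using Z2 by (cases "tmix N Z (1/2)") auto
        have xy: "time N (?\<alpha> - \<eta>) \<le> x" "x \<le> time N (?\<alpha> + \<eta>)" "time N (- \<eta>) \<le> y" "y \<le> time N \<eta>"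
          using Z1 Z2 by (auto simp: x y)
        have "\<bar>(x - y) - D\<bar> \<le> \<delta> * \<bar>D\<bar>"
        proof (cases "?\<alpha> = 0")
          case True
          then have "\<epsilon> = 1/2" using Psi_surj[OF \<epsilon>] by (simp add: Psi_0)
          then have "tmix N Z \<epsilon> = tmix N Z (1/2)" by (simp only:)
          then have "x = y" using x y by simp
          then show ?thesis using True by (simp add: D_def)
        next
          case False
          have e1: "\<bar>(time N (?\<alpha> + \<eta>) - time N (- \<eta>)) - (?\<alpha> + \<eta> - - \<eta>) * u\<bar> \<le> \<eta> * u"
            and e2: "\<bar>(time N (?\<alpha> - \<eta>) - time N \<eta>) - (?\<alpha> - \<eta> - \<eta>) * u\<bar> \<le> \<eta> * u"
            and e3: "\<bar>D - (?\<alpha> - 0) * u\<bar> \<le> \<eta> * u"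
            using elim by (auto simp: u_def D_def)
          define p where "p = ?\<alpha> * u"
          define e where "e = \<eta> * u"
          have f1: "\<bar>(time N (?\<alpha> + \<eta>) - time N (- \<eta>)) - p - 2 * e\<bar> \<le> e"
            using e1 by (simp add: p_def e_def algebra_simps)
          have f2: "\<bar>(time N (?\<alpha> - \<eta>) - time N \<eta>) - p + 2 * e\<bar> \<le> e"
            using e2 by (simp add: p_def e_def algebra_simps)
          have f3: "\<bar>D - p\<bar> \<le> e" using e3 by (simp add: p_def e_def)
          have e: "16 * e = q * \<bar>p\<bar>"
            using False u by (simp add: e_def p_def \<eta>_def abs_mult)
          have "q * \<bar>p\<bar> \<le> 1 * \<bar>p\<bar>" using q by (intro mult_right_mono) auto
          then have "16 * e \<le> \<bar>p\<bar>" using e by simp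
          then have "\<bar>p\<bar> / 2 \<le> \<bar>D\<bar>" using f3 by linarith
          then have "q * (\<bar>p\<bar> / 2) \<le> \<delta> * \<bar>D\<bar>" using q by (intro mult_mono) auto
          then have "8 * e \<le> \<delta> * \<bar>D\<bar>" using e by simp
          \<comment> \<open>The sandwich and the window estimates leave an error of at most
            \<open>8 * e\<close>, while \<open>\<delta> * \<bar>D\<bar>\<close> is at least
            \<open>q * \<bar>p\<bar> / 2\<close>. These match because
            \<open>16 * e = q * \<bar>p\<bar>\<close>, whence the 16 in
            \<open>\<eta>\<close>.\<close>
          moreover have "\<bar>(x - y) - D\<bar> \<le> 8 * e" using xy f1 f2 f3 by linarith
          ultimately show ?thesis by linarith
        qed
        then show ?thesis by (simp add: x y)
      qed
      have "{Z. \<not> \<bar>(tmix N Z \<epsilon> - tmix N Z (1 / 2)) - ereal D\<bar> \<le> ereal (\<delta> * \<bar>D\<bar>)} \<subseteq> ?B1 \<union> ?B2"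
        using good by blast
      then have "measure_pmf.prob (gens N) {Z. \<not> \<bar>(tmix N Z \<epsilon> - tmix N Z (1 / 2)) - ereal D\<bar> \<le> ereal (\<delta> * \<bar>D\<bar>)}
        \<le> measure_pmf.prob (gens N) (?B1 \<union> ?B2)"
        by (intro measure_pmf.finite_measure_mono) auto
      also have "\<dots> \<le> measure_pmf.prob (gens N) ?B1 + measure_pmf.prob (gens N) ?B2"
        by (intro measure_Un_le) auto
      also have "\<dots> \<le> b1 N + b2 N" using elim by (intro add_mono) auto
      finally show ?case by (simp add: D_def)
    qed
  qed
qed

end

theorem theorem2p4:
  fixes k :: "nat \<Rightarrow> nat" and G :: "nat \<Rightarrow> 'a monoid" and c :: real and ori :: orientation
  assumes k_pos: "\<And>N. k N > 0"
    and abelian: "\<And>N. comm_group (G N)"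
    and finite_G: "\<And>N. finite (carrier (G N))"
    and size: "filterlim (\<lambda>N. card (carrier (G N))) at_top sequentially"
    and log_k: "(\<lambda>N. ln (real (k N)) / ln (real (card (carrier (G N))))) \<longlonglongrightarrow> 0"
    and c_pos: "c > 0"
    and k_lower: "\<And>N. real (k N) \<ge> c * ln (real (card (carrier (G N))))"
    and m_star_lower: "\<And>N. real (m_star (G N)) \<ge> ln (real (k N)) / ln (ln (real (k N)))"
    and d_upper: "\<And>N. real (min_gen_size (G N))
                     \<le> 1 / 5 * (ln (real (card (carrier (G N)))) / ln (ln (real (k N))))"
  shows
    "let gens = (\<lambda>N. iid_generators (G N) (k N));
         t = (\<lambda>N \<alpha>. entropic_time ori (k N) (card (carrier (G N))) \<alpha>);
         dist = (\<lambda>N Z. cayley_dist ori (G N) (k N) Z);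
         tmix = (\<lambda>N Z. t_mix ori (G N) (k N) Z)
     in
       (\<forall>\<alpha>. (\<lambda>N. t N \<alpha> / t N 0) \<longlonglongrightarrow> 1
          \<and> tendsto_in_prob gens (\<lambda>N Z. dist N Z (t N \<alpha>)) (Psi \<alpha>))
     \<and> (\<forall>\<epsilon>\<in>{0<..<1}. \<forall>\<delta>>0.
          whp gens (\<lambda>N Z. \<bar>tmix N Z \<epsilon> - ereal (t N 0)\<bar> \<le> ereal (\<delta> * t N 0)))
     \<and> (\<forall>\<epsilon>\<in>{0<..<1}. \<forall>\<delta>>0.
          whp gens (\<lambda>N Z.
            \<bar>(tmix N Z \<epsilon> - tmix N Z (1 / 2)) - ereal (t N (the_inv Psi \<epsilon>) - t N 0)\<bar>
              \<le> ereal (\<delta> * \<bar>t N (the_inv Psi \<epsilon>) - t N 0\<bar>)))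
     \<and> (\<forall>\<alpha>. \<exists>r. r \<longlonglongrightarrow> 0 \<and>
          (\<forall>N. (INF Z \<in> {..<k N} \<rightarrow>\<^sub>E carrier (G N). dist N Z (t N \<alpha>)) \<ge> Psi \<alpha> - r N))"
proof -
  have group: "finite_comm_group (G N)" for N
    using abelian[of N] finite_G[of N] by (intro finite_comm_group.intro finite_comm_group_axioms.intro)
  interpret random_cayley G k c ori
    by (intro random_cayley.intro entropic_regime.intro random_cayley_axioms.intro) (fact assms group)+
  show ?thesis
    unfolding Let_def greaterThanLessThan_iff
    by (intro conjI allI ballI impI time_ratio dist_in_prob tmix_cutoff tmix_profile dist_lower_Inf) simp_all
qed

end
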